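(* Consider the tree ensemble $\operatorname{tCSP}(\alpha,p)$ described in the context, with $p=p_k$ satisfying conditions (1)–(4), (a) and (b). There is $\alpha_{\mathrm{tree}}(k)=\frac{\Omega_k}{k}\{\log k+o(\log k)\}$ (as $k\to\infty$) such that the reconstruction problem for $\operatorname{tCSP}(\alpha,p)$ is tree-solvable if and only if $\alpha>\alpha_{\mathrm{tree}}(k)$.
   Context: Let $p=p_k$ be a probability distribution on Boolean functions $\varphi:\{\pm1\}^k\to\{0,1\}$. Tree ensemble $\operatorname{tCSP}(\alpha,p)$: start from a root variable node $\emptyset$; draw $\eta\sim\mathrm{Poisson}(k\alpha)$ and attach $\eta$ function (clause) nodes as children of the root; each function node has $k-1$ variable-node children, each of which is the root of an independent copy of the same infinite random tree; each function node is assigned an independent clause $\varphi\sim p$, whose first argument is its parent variable and the remaining arguments its $k-1$ children. A uniform solution $\mathbf x$ is sampled by drawing the root value uniformly in $\{\pm1\}$ and then recursively: for a function node $a$ with parent $i$ and children $i_1,\dots,i_{k-1}$, $(\mathbf x_{i_1},\dots,\mathbf x_{i_{k-1}})$ is uniform among values with $\varphi_a(\mathbf x_i,\mathbf x_{i_1},\dots,\mathbf x_{i_{k-1}})=1$. Let $\mathbf x_\ell$ denote the values at the variables of generation $\ell$ (variables at distance $2\ell$ from the root). For a fixed tree $T$ let $\mu_{\emptyset,\ell}$ be the joint law of $(\mathbf x_0,\mathbf x_\ell)$ and $\mu_\emptyset,\mu_\ell$ its marginals. The reconstruction problem for a random $\mathbf T\sim\operatorname{tCSP}(\alpha,p)$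 is tree-solvable if $\liminf_{\ell\to\infty}\mathbf E\|\mu_{\emptyset,\ell}-\mu_\emptyset\mu_\ell\|_{TV}>0$ ($\mathbf E$ over $\mathbf T$). Fourier notation: $(f,g)=2^{-k}\sum_xf(x)g(x)$, $\|f\|^2=(f,f)$; $v_\theta(x)=\prod_i\frac{1+x_i\theta}{2}$, $\|f\|_\theta^2=\sum_xf(x)^2v_\theta(x)$; $\gamma_Q(x)=\prod_{i\in Q}x_i$, $f_Q=(\gamma_Q,f)$; $(T_\theta f)(x)=\sum_yf(xy)v_\theta(y)$; $\varphi^{(i)}$ is the function of the other $k-1$ coordinates $\frac12[\varphi(\dots,x_i=1,\dots)-\varphi(\dots,x_i=-1,\dots)]$; $I_i(\varphi)=\|\varphi^{(i)}\|^2$. Assumptions on $p$: (1) $p(\varphi^\pi)=p(\varphi)$ for permutations of arguments; (2) $\varphi(x)=\varphi(-x)$ on the support; (3) for each $\varphi$ in the support every $(x_1,\dots,x_{k-1})$ extends to some $(x_0,\dots,x_{k-1})$ with $\varphi=1$; (4) $\mathbb E_\varphi\log\|\varphi\|_\theta\le\mathbb E_\varphi\log\|\varphi\|$ for all $\theta\in[-1,1]$; (a) a constant $a$ independent of $k$ with $\sum_Q|\varphi^{(i)}_Q|\le k^a$ on the support; (b) a constant $C>0$ independent of $k$ with $\|T_\theta\varphi^{(i)}\|^2\le e^{-Ck(1-\theta)}\|\varphi^{(i)}\|^2$ for $\theta\in[0,1]$ on the support. Define $\frac1{\Omega_k}=\mathbb E_{\varphi\sim p}\frac{2I_1(\varp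hi)}{\|\varphi\|^2}$.
   Formalization: The equivalence is stated for all α > 0 except α = α_tree(k): at the threshold itself the strict "iff" fails, e.g. for random XOR clauses with even k ≥ 4, where the problem is solvable at the critical α. Ω_k may be ∞ (then α_tree(k) = ∞). *)

theory Defs
  imports
    "HOL-Probability.Probability"
    "HOL-Library.Landau_Symbols"
    "HOL-Combinatorics.Combinatorics"
begin

section \<open>Functions on the discrete cube\<close>

text \<open>
  Points of the cube are lists over \<open>{-1, 1}\<close>. Coordinates are numbered from 0, so the
  informal coordinate 1 is the head of the list.
\<close>

definition cube :: "nat \<Rightarrow> real list set" where
  "cube n = {x. length x = n \<and> set x \<subseteq> {-1, 1}}"

definition uinner :: "nat \<Rightarrow> (real list \<Rightarrow> real) \<Rightarrow> (real list \<Rightarrow> real) \<Rightarrow> real" where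
  "uinner n f g = (\<Sum>x\<in>cube n. f x * g x) / 2 ^ n"

definition unorm :: "nat \<Rightarrow> (real list \<Rightarrow> real) \<Rightarrow> real" where
  "unorm n f = sqrt (uinner n f f)"

definition bias_weight :: "nat \<Rightarrow> real \<Rightarrow> real list \<Rightarrow> real" where
  "bias_weight n \<theta> x = (\<Prod>i<n. (1 + x ! i * \<theta>) / 2)"

definition bias_norm :: "nat \<Rightarrow> real \<Rightarrow> (real list \<Rightarrow> real) \<Rightarrow> real" where
  "bias_norm n \<theta> f = sqrt (\<Sum>x\<in>cube n. (f x)\<^sup>2 * bias_weight n \<theta> x)"

definition fourier_char :: "nat set \<Rightarrow> real list \<Rightarrow> real" where
  "fourier_char Q x = (\<Prod>i\<in>Q. x ! i)"

definition fourier_coeff :: "nat \<Rightarrow> (real list \<Rightarrow> real) \<Rightarrow> nat set \<Rightarrow> real" where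
  "fourier_coeff n f Q = uinner n (fourier_char Q) f"

definition noise_op :: "nat \<Rightarrow> real \<Rightarrow> (real list \<Rightarrow> real) \<Rightarrow> real list \<Rightarrow> real" where
  "noise_op n \<theta> f x = (\<Sum>y\<in>cube n. f (map2 (*) x y) * bias_weight n \<theta> y)"

text \<open>The discrete derivative in coordinate \<open>i\<close>; its argument lists the other coordinates.\<close>

definition cube_deriv :: "nat \<Rightarrow> (real list \<Rightarrow> real) \<Rightarrow> real list \<Rightarrow> real" where
  "cube_deriv i f y = (f (take i y @ 1 # drop i y) - f (take i y @ (-1) # drop i y)) / 2"

definition influence :: "nat \<Rightarrow> nat \<Rightarrow> (real list \<Rightarrow> real) \<Rightarrow> real" where
  "influence k i f = (unorm (k - 1) (cube_deriv i f))\<^sup>2"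

section \<open>Clauses and clause distributions\<close>

text \<open>
  A clause of arity \<open>k\<close> is a function from the cube to \<open>{0, 1}\<close>. It is \<open>undefined\<close>
  outside the cube, so that distinct elements are distinct Boolean functions.
\<close>

type_synonym clause = "real list \<Rightarrow> real"

definition clauses :: "nat \<Rightarrow> clause set" where
  "clauses k = cube k \<rightarrow>\<^sub>E {0, 1}"

definition permute_args :: "nat \<Rightarrow> (nat \<Rightarrow> nat) \<Rightarrow> clause \<Rightarrow> clause" where
  "permute_args k \<pi> \<phi> = (\<lambda>x\<in>cube k. \<phi> (permute_list \<pi> x))"

text \<open>The logarithm has to take the value \<open>-\<infinity>\<close> at 0 here: \<open>bias_norm\<close> may vanish
  at \<open>\<theta> = 1\<close> and \<open>\<theta> = -1\<close>, whereas \<open>ln 0 = 0\<close> on the reals.\<close>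

definition elog :: "real \<Rightarrow> ereal" where
  "elog x = (if x > 0 then ereal (ln x) else -\<infinity>)"

text \<open>Expectation of an extended-real function under a finitely supported distribution.\<close>

definition fin_expectation :: "'a pmf \<Rightarrow> ('a \<Rightarrow> ereal) \<Rightarrow> ereal" where
  "fin_expectation p f = (\<Sum>x\<in>set_pmf p. ereal (pmf p x) * f x)"

text \<open>The value is \<open>\<infinity>\<close> exactly when the expectation is 0, that is, when no clause in
  the support depends on its first argument.\<close>

definition Omega :: "nat \<Rightarrow> clause pmf \<Rightarrow> ereal" where
  "Omega k p =
     1 / ereal (measure_pmf.expectation p (\<lambda>\<phi>. 2 * influence k 0 \<phi> / (unorm k \<phi>)\<^sup>2))"

section \<open>The tree ensemble\<close>

text \<open>
  Variable nodes carry Ulam-Harris addresses: \<open>[]\<close> is the root and \<open>v @ [(j, i)]\<close> is the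
  \<open>i\<close>-th child of the \<open>j\<close>-th function node below \<open>v\<close>. An infinite tree is the map that
  sends a variable node to the list of clauses at its child function nodes; the labels at
  addresses that do not occur in the tree are irrelevant.
\<close>

type_synonym ctree = "(nat \<times> nat) list \<Rightarrow> clause list"

definition subtree :: "ctree \<Rightarrow> nat \<times> nat \<Rightarrow> ctree" where
  "subtree T c = (\<lambda>v. T (c # v))"

definition offspring_pmf :: "nat \<Rightarrow> real \<Rightarrow> clause pmf \<Rightarrow> clause list pmf" where
  "offspring_pmf k \<alpha> p =
     bind_pmf (poisson_pmf (real k * \<alpha>)) (\<lambda>\<eta>. replicate_pmf \<eta> p)"

definition tCSP :: "nat \<Rightarrow> real \<Rightarrow> clause pmf \<Rightarrow> ctree measure" where
  "tCSP k \<alpha> p = PiM UNIV (\<lambda>_. measure_pmf (offspring_pmf k \<alpha> p))"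

section \<open>Uniform solutions and reconstruction\<close>

text \<open>Independent sampling, one entry from each distribution of the list.\<close>

primrec sequence_pmf :: "'a pmf list \<Rightarrow> 'a list pmf" where
  "sequence_pmf [] = return_pmf []"
| "sequence_pmf (q # qs) =
     bind_pmf q (\<lambda>x. bind_pmf (sequence_pmf qs) (\<lambda>xs. return_pmf (x # xs)))"

definition children_pmf :: "nat \<Rightarrow> clause \<Rightarrow> real \<Rightarrow> real list pmf" where
  "children_pmf k \<phi> s = pmf_of_set {y \<in> cube (k - 1). \<phi> (s # y) = 1}"

text \<open>The law of the values at the variables of generation \<open>l\<close>, listed from left to right,
  given the value \<open>s\<close> at the root.\<close>

primrec generation_pmf :: "nat \<Rightarrow> nat \<Rightarrow> ctree \<Rightarrow> real \<Rightarrow> real list pmf" where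
  "generation_pmf k 0 T s = return_pmf [s]"
| "generation_pmf k (Suc l) T s =
     map_pmf concat (sequence_pmf (map
       (\<lambda>j. bind_pmf (children_pmf k (T [] ! j) s) (\<lambda>y.
          map_pmf concat (sequence_pmf (map
            (\<lambda>i. generation_pmf k l (subtree T (j, i)) (y ! i)) [0..<k - 1]))))
       [0..<length (T [])]))"

definition root_generation_pmf :: "nat \<Rightarrow> nat \<Rightarrow> ctree \<Rightarrow> (real \<times> real list) pmf" where
  "root_generation_pmf k l T =
     bind_pmf (pmf_of_set {-1, 1}) (\<lambda>s. map_pmf (Pair s) (generation_pmf k l T s))"

definition tv_dist :: "'a pmf \<Rightarrow> 'a pmf \<Rightarrow> real" where
  "tv_dist p q = (SUP A. \<bar>measure_pmf.prob p A - measure_pmf.prob q A\<bar>)"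

definition reconstruction_tv :: "nat \<Rightarrow> nat \<Rightarrow> ctree \<Rightarrow> real" where
  "reconstruction_tv k l T =
     (let \<mu> = root_generation_pmf k l T
      in tv_dist \<mu> (pair_pmf (map_pmf fst \<mu>) (map_pmf snd \<mu>)))"

definition tree_solvable :: "nat \<Rightarrow> real \<Rightarrow> clause pmf \<Rightarrow> bool" where
  "tree_solvable k \<alpha> p \<longleftrightarrow>
     liminf (\<lambda>l. ereal (\<integral>T. reconstruction_tv k l T \<partial>tCSP k \<alpha> p)) > 0"

end

theory Submission
  imports Defs "HOL-Real_Asymp.Real_Asymp"
begin

text \<open>
  Put \<open>\<lambda> = k \<alpha> / \<Omega>\<^sub>k\<close>, the mean number of clauses at a variable whose other arguments determine
  it. The threshold lies between \<open>\<lambda> = (1 - \<delta>) log k\<close> and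
  \<open>\<lambda> = (1 + \<delta>) log k\<close>.

  Above: let \<open>z\<^sub>l\<close> be the probability that generation \<open>l\<close> determines the root. A determining
  clause all of whose children are determined determines its parent, so
  \<open>z\<^sub>l\<^sub>+\<^sub>1 \<ge> 1 - exp (- \<lambda> z\<^sub>l\<^sup>k\<^sup>-\<^sup>1)\<close>, and the iteration stays above \<open>1 - k powr (-1 - \<delta>/2)\<close>.

  Below: let \<open>e\<^sub>l\<close> be the expected square of the posterior mean of the root. For symmetric channels
  \<open>1 - e\<close> is supermultiplicative, and extendability of the clauses bounds the contribution of a
  clause \<open>\<phi>\<close> by \<open>2 \<parallel>T\<^sub>\<theta> \<phi>\<^sup>(\<^sup>1\<^sup>)\<parallel>\<^sup>2 / \<parallel>\<phi>\<parallel>\<^sup>2\<close> with \<open>\<theta> = sqrt e\<^sub>l\<close>. Hence \<open>e\<^sub>1 \<le> 1 - exp (- \<lambda>)\<close>; by noise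
  sensitivity \<open>e\<^sub>2\<close> is then superpolynomially small, and afterwards \<open>e\<^sub>l\<close> contracts because the
  Fourier expansion of \<open>\<phi>\<^sup>(\<^sup>1\<^sup>)\<close> has no constant term.

  Solvability is monotone in \<open>\<alpha>\<close>: appending the clauses of an independent second tree at every
  node couples \<open>\<alpha>\<close> with a larger parameter, and the generations of the first tree can be read
  off from those of the combined tree.
\<close>

section \<open>The cube\<close>

text \<open>The measure of information is chosen so that averages over the random tree close up.
  Relative to the output law under a uniform input sign, the two output densities are
  \<open>1 + m\<close> and \<open>1 - m\<close>, so their inner products involve only the mean of
  \<open>m^2\<close>. For a clause this yields a bound affine in the information of each child, and
  as sibling subtrees are independent, each child may be replaced by its mean. Across clauses
  \<open>1 - e\<close> is only supermultiplicative, but this is the useful direction, and the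
  Poisson generating function turns mean products into exponentials. Two obstacles shape the rest.
  Observations are flat lists, so block boundaries must be recoverable: block lengths depend on the
  tree alone, whence \<open>concat\<close> is injective on the supports. And clause lists form an
  uncountable type, so measurability in the tree is reduced to countably many cases. The threshold
  is the infimum of the solvable parameters, and its error term is obtained by solving the required
  formula for it, so that only its growth has to be estimated. If no clause depends on its first
  argument, the threshold is infinite.\<close>

lemma cube_0 [simp]: "cube 0 = {[]}"
  by (auto simp: cube_def)

lemma cube_Suc: "cube (Suc n) = (#) 1 ` cube n \<union> (#) (-1) ` cube n"
proof -
  have "x \<in> cube (Suc n) \<longleftrightarrow> x \<in> (#) 1 ` cube n \<union> (#) (-1) ` cube n" for x
    by (cases x) (auto simp: cube_def)
  then show ?thesis by blast
qed

lemma finite_cube [simp, intro]: "finite (cube n)"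
  by (induction n) (auto simp: cube_Suc)

lemma sum_cube_Suc:
  fixes g :: "real list \<Rightarrow> 'a :: comm_monoid_add"
  shows "(\<Sum>x\<in>cube (Suc n). g x) = (\<Sum>y\<in>cube n. g (1 # y)) + (\<Sum>y\<in>cube n. g (-1 # y))"
  unfolding cube_Suc
  by (subst sum.union_disjoint) (auto simp: sum.reindex)

lemma card_cube: "card (cube n) = 2 ^ n"
proof (induction n)
  case (Suc n)
  have "card (cube (Suc n)) = (\<Sum>x\<in>cube (Suc n). 1)" by simp
  also have "\<dots> = 2 ^ Suc n" using Suc by (subst sum_cube_Suc) simp
  finally show ?case .
qed simp

lemma cube_nth: "y \<in> cube n \<Longrightarrow> i < n \<Longrightarrow> y ! i = 1 \<or> y ! i = -1"
  using nth_mem by (fastforce simp: cube_def)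

lemma length_cube: "y \<in> cube n \<Longrightarrow> length y = n"
  by (simp add: cube_def)

lemma map_uminus_cube [simp]: "map uminus y \<in> cube n \<longleftrightarrow> y \<in> cube n"
proof -
  have *: "map uminus y \<in> cube n" if "y \<in> cube n" for y
    using that by (auto simp: cube_def)
  from *[of y] *[of "map uminus y"] show ?thesis by (auto simp: comp_def)
qed

lemma sum_cube_uminus: "(\<Sum>y\<in>cube n. g (map uminus y)) = (\<Sum>y\<in>cube n. g y)"
  by (rule sum.reindex_bij_witness[of _ "map uminus" "map uminus"]) (auto simp: comp_def)

section \<open>Independent products of distributions\<close>

lemma sequence_pmf_Cons:
  "sequence_pmf (q # qs) = map_pmf (\<lambda>(x, xs). x # xs) (pair_pmf q (sequence_pmf qs))"
  by (simp add: pair_pmf_def map_bind_pmf)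

declare sequence_pmf.simps(2) [simp del]

lemma pmf_sequence_Cons: "pmf (sequence_pmf (q # qs)) (x # xs) = pmf q x * pmf (sequence_pmf qs) xs"
proof -
  have "pmf (sequence_pmf (q # qs)) ((\<lambda>(x, xs). x # xs) (x, xs))
      = pmf (pair_pmf q (sequence_pmf qs)) (x, xs)"
    unfolding sequence_pmf_Cons by (rule pmf_map_inj') (auto simp: inj_def)
  then show ?thesis by (simp add: pmf_pair)
qed

lemma set_sequence_pmf:
  "set_pmf (sequence_pmf (map P js)) = {xs. list_all2 (\<lambda>j x. x \<in> set_pmf (P j)) js xs}"
proof (induction js)
  case (Cons j js)
  then show ?case by (auto simp: sequence_pmf_Cons list_all2_Cons1)
qed auto

lemma length_sequence_pmf: "xs \<in> set_pmf (sequence_pmf qs) \<Longrightarrow> length xs = length qs"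
  using set_sequence_pmf[of id qs] by (auto dest: list_all2_lengthD)

lemma finite_set_sequence_pmf:
  "(\<And>q. q \<in> set qs \<Longrightarrow> finite (set_pmf q)) \<Longrightarrow> finite (set_pmf (sequence_pmf qs))"
  by (induction qs) (auto simp: sequence_pmf_Cons)

lemma pmf_sequence_Nil: "pmf (sequence_pmf (q # qs)) [] = 0"
  by (auto simp: sequence_pmf_Cons pmf_eq_0_set_pmf)

lemma prob_sequence_pmf:
  "measure_pmf.prob (sequence_pmf (map P js)) {xs. list_all2 (\<lambda>j x. x \<in> A j) js xs}
    = prod_list (map (\<lambda>j. measure_pmf.prob (P j) (A j)) js)"
proof (induction js)
  case (Cons j js)
  let ?S = "sequence_pmf (map P js)" and ?B = "{xs. list_all2 (\<lambda>j x. x \<in> A j) js xs}"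
  have "measure_pmf.prob (sequence_pmf (map P (j # js))) {xs. list_all2 (\<lambda>j x. x \<in> A j) (j # js) xs}
      = measure_pmf.prob (pair_pmf (P j) ?S) (A j \<times> ?B)"
    by (simp add: sequence_pmf_Cons) (auto intro!: arg_cong2[where f = measure])
  \<comment> \<open>The product rule used next is for countable sets, so both factors are first cut
    down to the supports.\<close>
  also have "\<dots> = measure_pmf.prob (pair_pmf (P j) ?S)
      ((A j \<inter> set_pmf (P j)) \<times> (?B \<inter> set_pmf ?S))"
    by (subst measure_Int_set_pmf[symmetric]) (auto intro!: arg_cong2[where f = measure])
  also have "\<dots> = measure_pmf.prob (P j) (A j) * measure_pmf.prob ?S ?B"
    by (subst measure_pmf_prob_product) (auto intro: countable_Int2 simp: measure_Int_set_pmf)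
  finally show ?case using Cons by simp
qed simp

section \<open>Overlap of two distributions\<close>

text \<open>If \<open>P\<close>, \<open>Q\<close> are the laws of the observation given the two values of a uniform sign, this
  is \<open>1 - E m\<^sup>2\<close> for \<open>m = (P - Q) / (P + Q)\<close>, the posterior mean of the sign.\<close>

definition overlap :: "'a pmf \<Rightarrow> 'a pmf \<Rightarrow> real" where
  "overlap P Q = measure_pmf.expectation P (\<lambda>b. 2 * pmf Q b / (pmf P b + pmf Q b))"

lemma overlap_sum:
  assumes "finite B" "set_pmf P \<subseteq> B"
  shows "overlap P Q = (\<Sum>b\<in>B. 2 * pmf P b * pmf Q b / (pmf P b + pmf Q b))"
  unfolding overlap_def using assms
  by (subst integral_measure_pmf_real[of B]) (auto intro!: sum.cong)

lemma overlap_nonneg: "0 \<le> overlap P Q"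
  unfolding overlap_def by (intro Bochner_Integration.integral_nonneg) auto

text \<open>Pointwise the harmonic mean of the two masses is at most their arithmetic mean, and the
  arithmetic means sum to 1.\<close>

lemma overlap_le_1: 
  assumes "finite (set_pmf P)" "finite (set_pmf Q)"
  shows "overlap P Q \<le> 1"
proof -
  let ?B = "set_pmf P \<union> set_pmf Q"
  have *: "4 * (x * y) \<le> x * x + y * y + 2 * (x * y)" for x y :: real
    using sum_squares_bound[of x y] by (simp add: power2_eq_square)
  have "overlap P Q \<le> (\<Sum>b\<in>?B. (pmf P b + pmf Q b) / 2)"
  proof (subst overlap_sum[of ?B P Q], goal_cases)
    case 3
    show ?case
    proof (rule sum_mono)
    fix b assume "b \<in> ?B"
    then have "pmf P b + pmf Q b > 0"
      by (auto simp: pmf_positive_iff intro: add_pos_nonneg add_nonneg_pos)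
    then show "2 * pmf P b * pmf Q b / (pmf P b + pmf Q b) \<le> (pmf P b + pmf Q b) / 2"
      using *[of "pmf P b" "pmf Q b"] by (simp add: field_simps)
    qed
  qed (use assms in auto)
  also have "\<dots> = 1"
    using assms by (simp add: sum.distrib sum_divide_distrib[symmetric] sum_pmf_eq_1)
  finally show ?thesis .
qed

lemma overlap_self: "finite (set_pmf P) \<Longrightarrow> overlap P P = 1"
  by (simp add: overlap_sum[of "set_pmf P"] pmf_eq_0_set_pmf sum_pmf_eq_1 cong: sum.cong)

text \<open>\<open>overlap\<close> evaluates both laws at the same point, which may lie outside the
  support of one of them; therefore injectivity is asked on a common superset.\<close>

lemma pmf_map_inj_on_superset:
  assumes "inj_on f S" "set_pmf P \<subseteq> S" "b \<in> S"
  shows "pmf (map_pmf f P) (f b) = pmf P b"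
proof (cases "b \<in> set_pmf P")
  case True
  with assms show ?thesis by (intro pmf_map_inj) (auto intro: inj_on_subset)
next
  case False
  then have "f b \<notin> f ` set_pmf P"
    using assms by (auto dest: inj_onD)
  with False show ?thesis by (metis pmf_eq_0_set_pmf set_map_pmf)
qed

lemma overlap_map_inj:
  assumes "inj_on f (set_pmf P \<union> set_pmf Q)"
  shows "overlap (map_pmf f P) (map_pmf f Q) = overlap P Q"
  unfolding overlap_def integral_map_pmf
  by (intro integral_cong_AE) (auto simp: AE_measure_pmf_iff
      pmf_map_inj_on_superset[OF assms Un_upper1] pmf_map_inj_on_superset[OF assms Un_upper2])

text \<open>Flipping the first observation exchanges \<open>P1\<close> and \<open>Q1\<close>; averaging over the flip, the
  claim is the inequality between the arithmetic and the harmonic mean. Without this symmetry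
  the claim fails, for instance for two copies of a Z-channel.\<close>

lemma overlap_pair:
  assumes fin: "finite (set_pmf P1)" "finite (set_pmf P2)" "finite (set_pmf Q2)"
    and Q1: "Q1 = map_pmf \<sigma> P1" and \<sigma>: "\<And>x. \<sigma> (\<sigma> x) = x"
  shows "overlap P1 Q1 * overlap P2 Q2 \<le> overlap (pair_pmf P1 P2) (pair_pmf Q1 Q2)"
proof -
  \<comment> \<open>The union of both supports, because the reindexing by \<open>\<sigma>\<close>
    below needs a set closed under \<open>\<sigma>\<close>.\<close>
  define B where "B = set_pmf P1 \<union> set_pmf Q1"
  define D where "D = set_pmf P2"
  have inj: "inj \<sigma>" by (metis injI \<sigma>)
  have finB: "finite B" "finite D" using fin by (auto simp: B_def D_def Q1)
  have B\<sigma>: "\<sigma> b \<in> B" if "b \<in> B" for b using that \<sigma> by (auto simp: B_def Q1)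
  have Q: "pmf Q1 (\<sigma> b) = pmf P1 b" for b
    unfolding Q1 by (rule pmf_map_inj'[OF inj])
  have P: "pmf P1 (\<sigma> b) = pmf Q1 b" for b
    using Q[of "\<sigma> b"] \<sigma> by simp
  define g where "g b d = 2 * (pmf P1 b * pmf P2 d) * (pmf Q1 b * pmf Q2 d) /
      (pmf P1 b * pmf P2 d + pmf Q1 b * pmf Q2 d)" for b d
  define h where "h b d = (2 * pmf P1 b * pmf Q1 b / (pmf P1 b + pmf Q1 b)) *
      (2 * pmf P2 d * pmf Q2 d / (pmf P2 d + pmf Q2 d))" for b d
  \<comment> \<open>If \<open>u\<close> and \<open>v\<close> are the denominators of
    \<open>g\<close> at \<open>b\<close> and at \<open>\<sigma> b\<close>, then the denominator of
    \<open>h\<close> is \<open>u + v = (?p + ?q) * (?r + ?s)\<close>, while the numerators agree up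
    to constants.\<close>
  have *: "2 * h b d \<le> g b d + g (\<sigma> b) d" for b d
  proof -
    let ?p = "pmf P1 b" and ?q = "pmf Q1 b" and ?r = "pmf P2 d" and ?s = "pmf Q2 d"
    show ?thesis
    proof (cases "?p = 0 \<or> ?q = 0 \<or> ?r = 0 \<or> ?s = 0")
      case True
      then show ?thesis by (auto simp: g_def h_def P Q)
    next
      case False
      then have pos: "?p > 0" "?q > 0" "?r > 0" "?s > 0" by (auto simp: order.strict_iff_order)
      define u where "u = ?p * ?r + ?q * ?s"
      define v where "v = ?q * ?r + ?p * ?s"
      have uv: "u > 0" "v > 0" using pos by (auto simp: u_def v_def intro!: add_pos_pos)
      have hm: "4 / (u + v) \<le> 1 / u + 1 / v"
        using uv sum_squares_bound[of u v]
        by (simp add: field_simps power2_eq_square)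
      have "2 * h b d = 2 * (?p * ?q * ?r * ?s) * (4 / (u + v))"
        by (simp add: h_def u_def v_def algebra_simps)
      also have "\<dots> \<le> 2 * (?p * ?q * ?r * ?s) * (1 / u + 1 / v)"
        using pos hm by (intro mult_left_mono) auto
      also have "\<dots> = g b d + g (\<sigma> b) d"
        by (simp add: g_def P Q u_def v_def algebra_simps)
      finally show ?thesis .
    qed
  qed
  have "2 * (overlap P1 Q1 * overlap P2 Q2) = (\<Sum>b\<in>B. \<Sum>d\<in>D. 2 * h b d)"
  proof -
    have "overlap P1 Q1 = (\<Sum>b\<in>B. 2 * pmf P1 b * pmf Q1 b / (pmf P1 b + pmf Q1 b))"
      using finB by (intro overlap_sum) (auto simp: B_def)
    moreover have "overlap P2 Q2 = (\<Sum>d\<in>D. 2 * pmf P2 d * pmf Q2 d / (pmf P2 d + pmf Q2 d))"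
      using finB by (intro overlap_sum) (auto simp: D_def)
    ultimately show ?thesis
      by (simp only: sum_product) (simp only: h_def sum_distrib_left)
  qed
  also have "\<dots> \<le> (\<Sum>b\<in>B. \<Sum>d\<in>D. g b d) + (\<Sum>b\<in>B. \<Sum>d\<in>D. g (\<sigma> b) d)"
    unfolding sum.distrib[symmetric] by (intro sum_mono *)
  also have "(\<Sum>b\<in>B. \<Sum>d\<in>D. g (\<sigma> b) d) = (\<Sum>b\<in>B. \<Sum>d\<in>D. g b d)"
    by (rule sum.reindex_bij_witness[of _ \<sigma> \<sigma>]) (auto simp: \<sigma> B\<sigma>)
  also have "(\<Sum>b\<in>B. \<Sum>d\<in>D. g b d) = overlap (pair_pmf P1 P2) (pair_pmf Q1 Q2)"
    using finB by (subst overlap_sum[of "B \<times> D"])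
      (auto simp: B_def D_def sum.cartesian_product pmf_pair g_def intro!: sum.cong)
  finally show ?thesis by simp
qed

text \<open>\<open>overlap_pair\<close> asks for the symmetry of its first factor only, so the
  induction can treat the tail as an arbitrary pair of laws.\<close>

lemma overlap_sequence:
  assumes "\<And>j. j \<in> set js \<Longrightarrow> finite (set_pmf (P j))"
    and "\<And>j. j \<in> set js \<Longrightarrow> Q j = map_pmf \<sigma> (P j)" and \<sigma>: "\<And>x. \<sigma> (\<sigma> x) = x"
  shows "prod_list (map (\<lambda>j. overlap (P j) (Q j)) js)
    \<le> overlap (sequence_pmf (map P js)) (sequence_pmf (map Q js))"
  using assms(1,2)
proof (induction js)
  case Nil
  then show ?case by (simp add: overlap_self)
next
  case (Cons j js)
  have "prod_list (map (\<lambda>j. overlap (P j) (Q j)) (j # js))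
      \<le> overlap (P j) (Q j) * overlap (sequence_pmf (map P js)) (sequence_pmf (map Q js))"
    using Cons by (auto intro!: mult_left_mono overlap_nonneg)
  also have "\<dots> \<le> overlap (pair_pmf (P j) (sequence_pmf (map P js)))
      (pair_pmf (Q j) (sequence_pmf (map Q js)))"
    using Cons.prems(1)
    by (intro overlap_pair[where \<sigma> = \<sigma>] finite_set_sequence_pmf)
      (auto simp: \<sigma> Cons.prems(2))
  also have "\<dots> = overlap (sequence_pmf (map P (j # js))) (sequence_pmf (map Q (j # js)))"
    unfolding list.map sequence_pmf_Cons
    by (rule overlap_map_inj[symmetric]) (auto simp: inj_on_def)
  finally show ?case .
qed

section \<open>Channels with a sign as input\<close>

lemma prob_bind_pmf_of_set:
  assumes "S \<noteq> {}" "finite S"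
  shows "measure_pmf.prob (bind_pmf (pmf_of_set S) F) A
    = (\<Sum>x\<in>S. measure_pmf.prob (F x) A) / card S"
proof -
  have "ennreal (measure_pmf.prob (bind_pmf (pmf_of_set S) F) A)
      = (\<Sum>x\<in>S. ennreal (measure_pmf.prob (F x) A)) / card S"
    using assms by (simp add: measure_pmf.emeasure_eq_measure[symmetric] nn_integral_pmf_of_set)
  also have "\<dots> = ennreal ((\<Sum>x\<in>S. measure_pmf.prob (F x) A) / card S)"
    using assms by (simp add: divide_ennreal card_gt_0_iff sum_nonneg ennreal_of_nat_eq_real_of_nat)
  finally show ?thesis
    by (subst (asm) ennreal_inj) (auto intro!: sum_nonneg divide_nonneg_nonneg)
qed

definition mix :: "(real \<Rightarrow> 'a pmf) \<Rightarrow> 'a pmf" where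
  "mix W = bind_pmf (pmf_of_set {1, -1}) W"

lemma pmf_mix: "pmf (mix W) b = (pmf (W 1) b + pmf (W (-1)) b) / 2"
  unfolding mix_def by (subst pmf_bind_pmf_of_set) auto

lemma set_mix: "set_pmf (mix W) = set_pmf (W 1) \<union> set_pmf (W (-1))"
  unfolding mix_def by auto

definition info :: "(real \<Rightarrow> 'a pmf) \<Rightarrow> real" where
  "info W = 1 - overlap (W 1) (W (-1))"

text \<open>The channels form a list rather than an indexed family, so that induction on the list
  runs in parallel with the recursion of the cube.\<close>

definition channel_product :: "(real \<Rightarrow> 'a pmf) list \<Rightarrow> real list \<Rightarrow> 'a list pmf" where
  "channel_product Ws y = sequence_pmf (map2 (\<lambda>W t. W t) Ws y)"

lemma channel_product_Nil [simp]: "channel_product [] y = return_pmf []"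
  by (simp add: channel_product_def)

lemma channel_product_Cons:
  "channel_product (W # Ws) (t # y) = sequence_pmf (W t # map2 (\<lambda>W t. W t) Ws y)"
  by (simp add: channel_product_def)

lemma pmf_channel_product_Cons [simp]:
  "pmf (channel_product (W # Ws) (t # y)) (x # xs) = pmf (W t) x * pmf (channel_product Ws y) xs"
  "pmf (channel_product (W # Ws) (t # y)) [] = 0"
  by (simp_all add: channel_product_Cons pmf_sequence_Cons pmf_sequence_Nil)
    (simp add: channel_product_def)

lemma channel_product_map:
  assumes "length y = n"
  shows "channel_product (map W [0..<n]) y = sequence_pmf (map (\<lambda>i. W i (y ! i)) [0..<n])"
  unfolding channel_product_def
  by (rule arg_cong[of _ _ sequence_pmf], rule nth_equalityI) (use assms in auto)

text \<open>A uniform point of the cube has independent uniform coordinates, so averaging over the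
  inputs can be done in each channel separately.\<close>

lemma sum_channel_product:
  "(\<Sum>y\<in>cube (length Ws). pmf (channel_product Ws y) b)
    = 2 ^ length Ws * pmf (sequence_pmf (map mix Ws)) b"
proof (induction Ws arbitrary: b)
  case (Cons W Ws)
  show ?case
  proof (cases b)
    case Nil
    then show ?thesis by (simp add: sum_cube_Suc pmf_sequence_Nil)
  next
    case (Cons x xs)
    then show ?thesis
      by (simp add: sum_cube_Suc pmf_sequence_Cons pmf_mix sum_distrib_left[symmetric] Cons.IH)
        (simp add: field_simps)
  qed
qed simp

text \<open>With \<open>m\<close> the posterior mean of the sign, the density of \<open>W t\<close>
  relative to \<open>mix W\<close> is \<open>1 + t * m\<close>. Under \<open>mix W\<close> the mean
  of \<open>m\<close> is 0 and that of \<open>m^2\<close> is \<open>info W\<close>, which gives the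
  right side.\<close>

lemma kernel_single:
  assumes fin: "finite (set_pmf (W 1))" "finite (set_pmf (W (-1)))"
    and t: "t \<in> {1, -1}" "t' \<in> {1, -1}"
  shows "(\<Sum>b\<in>set_pmf (mix W). pmf (W t) b * pmf (W t') b / pmf (mix W) b) = 1 + t * t' * info W"
proof -
  define P Q where "P = pmf (W 1)" and "Q = pmf (W (-1))"
  define B where "B = set_pmf (mix W)"
  have B: "finite B" "set_pmf (W 1) \<subseteq> B" "set_pmf (W (-1)) \<subseteq> B"
    using fin by (auto simp: B_def set_mix)
  have ov: "overlap (W 1) (W (-1)) = (\<Sum>b\<in>B. 2 * P b * Q b / (P b + Q b))"
    unfolding P_def Q_def using B by (intro overlap_sum)
  have pos: "P b + Q b > 0" if "b \<in> B" for b
    using that by (auto simp: B_def set_mix P_def Q_def pmf_positive_iff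
        intro: add_pos_nonneg add_nonneg_pos)
  have sq: "x * x / ((x + z) / 2) = 2 * x - 2 * x * z / (x + z)" if "x + z > 0" for x z :: real
    using that by (simp add: field_simps)
  have one: "(\<Sum>b\<in>B. P b) = 1" "(\<Sum>b\<in>B. Q b) = 1"
    unfolding P_def Q_def using B by (auto intro: sum_pmf_eq_1)
  have PP: "(\<Sum>b\<in>B. P b * P b / ((P b + Q b) / 2)) = 1 + info W"
  proof -
    have "(\<Sum>b\<in>B. P b * P b / ((P b + Q b) / 2))
        = (\<Sum>b\<in>B. 2 * P b - 2 * P b * Q b / (P b + Q b))"
      by (intro sum.cong refl sq pos)
    then show ?thesis using one by (simp add: sum_subtractf sum_distrib_left[symmetric] info_def ov)
  qed
  have QQ: "(\<Sum>b\<in>B. Q b * Q b / ((P b + Q b) / 2)) = 1 + info W"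
  proof -
    have "(\<Sum>b\<in>B. Q b * Q b / ((P b + Q b) / 2))
        = (\<Sum>b\<in>B. 2 * Q b - 2 * P b * Q b / (P b + Q b))"
      using sq[of "Q b" "P b" for b] pos by (intro sum.cong refl) (simp add: algebra_simps)
    then show ?thesis using one by (simp add: sum_subtractf sum_distrib_left[symmetric] info_def ov)
  qed
  have PQ: "(\<Sum>b\<in>B. P b * Q b / ((P b + Q b) / 2)) = 1 - info W"
    by (simp add: info_def ov algebra_simps)
  have QP: "(\<Sum>b\<in>B. Q b * P b / ((P b + Q b) / 2)) = 1 - info W"
    using PQ by (simp add: mult.commute)
  show ?thesis
    using t PP QQ PQ QP unfolding pmf_mix B_def[symmetric] P_def Q_def by auto
qed

text \<open>These are the inner products of the output densities relative to the product of the
  averaged laws. Everything factorizes over the coordinates, which reduces the claim to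
  \<open>kernel_single\<close>.\<close>

lemma kernel_product:
  assumes "\<And>W t. W \<in> set Ws \<Longrightarrow> t \<in> {1, -1} \<Longrightarrow> finite (set_pmf (W t))"
    and "y \<in> cube (length Ws)" "y' \<in> cube (length Ws)"
  shows "(\<Sum>b\<in>set_pmf (sequence_pmf (map mix Ws)).
      pmf (channel_product Ws y) b * pmf (channel_product Ws y') b / pmf (sequence_pmf (map mix Ws)) b)
    = (\<Prod>i<length Ws. 1 + y ! i * y' ! i * info (Ws ! i))"
  using assms
proof (induction Ws arbitrary: y y')
  case (Cons W Ws)
  from Cons.prems(2) obtain t u where y: "y = t # u" "t \<in> {1, -1}" "u \<in> cube (length Ws)"
    by (auto simp: cube_Suc)
  from Cons.prems(3) obtain t' u' where y': "y' = t' # u'" "t' \<in> {1, -1}" "u' \<in> cube (length Ws)"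
    by (auto simp: cube_Suc)
  let ?S = "sequence_pmf (map mix Ws)"
  have "(\<Sum>b\<in>set_pmf (sequence_pmf (map mix (W # Ws))).
      pmf (channel_product (W # Ws) y) b * pmf (channel_product (W # Ws) y') b /
        pmf (sequence_pmf (map mix (W # Ws))) b)
    = (\<Sum>(x, xs)\<in>set_pmf (mix W) \<times> set_pmf ?S.
        (pmf (W t) x * pmf (W t') x / pmf (mix W) x) *
        (pmf (channel_product Ws u) xs * pmf (channel_product Ws u') xs / pmf ?S xs))"
    by (rule sum.reindex_bij_witness[of _ "\<lambda>(x, xs). x # xs" "\<lambda>b. (hd b, tl b)"])
      (auto simp: sequence_pmf_Cons y y' pmf_sequence_Cons[unfolded sequence_pmf_Cons])
  also have "\<dots> = (1 + t * t' * info W) * (\<Prod>i<length Ws. 1 + u ! i * u' ! i * info (Ws ! i))"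
  proof -
    have "(\<Sum>xs\<in>set_pmf ?S. pmf (channel_product Ws u) xs * pmf (channel_product Ws u') xs / pmf ?S xs)
        = (\<Prod>i<length Ws. 1 + u ! i * u' ! i * info (Ws ! i))"
      by (rule Cons.IH) (use Cons.prems(1) y y' in auto)
    moreover have "(\<Sum>x\<in>set_pmf (mix W). pmf (W t) x * pmf (W t') x / pmf (mix W) x)
        = 1 + t * t' * info W"
      by (rule kernel_single) (use Cons.prems(1) y y' in auto)
    ultimately show ?thesis
      by (simp only: sum.cartesian_product[symmetric] sum_product[symmetric])
  qed
  also have "\<dots> = (\<Prod>i<length (W # Ws). 1 + y ! i * y' ! i * info ((W # Ws) ! i))"
    by (simp add: prod.lessThan_Suc_shift y y' del: prod.lessThan_Suc)
  finally show ?case .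
qed simp

section \<open>Noise stability\<close>

text \<open>The inner product of \<open>f\<close> with its image under the Fourier multiplier that
  scales \<open>\<gamma>_Q\<close> by the product of \<open>t i\<close> over
  \<open>i \<in> Q\<close>. The parameter may vary with the coordinate because different subtrees
  carry different information, and the form is affine in each \<open>t i\<close>.\<close>

definition stab :: "nat \<Rightarrow> (real list \<Rightarrow> real) \<Rightarrow> (nat \<Rightarrow> real) \<Rightarrow> real" where
  "stab n f t = (\<Sum>y\<in>cube n. \<Sum>z\<in>cube n. f y * f z * (\<Prod>i<n. 1 + y ! i * z ! i * t i)) / 4 ^ n"

section \<open>A single clause\<close>

text \<open>Here \<open>n\<close> counts the children, so the arity is \<open>Suc n\<close>. The
  children's observations stay separate entries of a list; they are flattened only outside, where
  \<open>concat\<close> is injective.\<close>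

definition clause_channel ::
  "nat \<Rightarrow> clause \<Rightarrow> (nat \<Rightarrow> real \<Rightarrow> 'a pmf) \<Rightarrow> real \<Rightarrow> 'a list pmf" where
  "clause_channel n \<phi> W s = bind_pmf (children_pmf (Suc n) \<phi> s)
     (\<lambda>y. sequence_pmf (map (\<lambda>i. W i (y ! i)) [0..<n]))"

text \<open>For a valid clause this is the chance that a uniform completion of the first argument
  determines it, by \<open>card_pivotal\<close> and \<open>unorm_sq\<close>. Its mean is the
  reciprocal of \<open>Omega\<close>.\<close>

definition pivotal :: "nat \<Rightarrow> clause \<Rightarrow> real" where
  "pivotal k \<phi> = 2 * influence k 0 \<phi> / (unorm k \<phi>)\<^sup>2"

locale valid_clause =
  fixes n :: nat and \<phi> :: clause
  assumes clause: "\<phi> \<in> clauses (Suc n)"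
    and sign_symmetric: "x \<in> cube (Suc n) \<Longrightarrow> \<phi> (map uminus x) = \<phi> x"
    and extendable: "y \<in> cube n \<Longrightarrow> \<exists>s\<in>{-1, 1}. \<phi> (s # y) = 1"
begin

abbreviation f :: "real list \<Rightarrow> real" where
  "f \<equiv> cube_deriv 0 \<phi>"

definition completions :: "real \<Rightarrow> real list set" where
  "completions s = {y \<in> cube n. \<phi> (s # y) = 1}"

definition N :: nat where
  "N = card (completions 1)"

lemma f_eq: "f y = (\<phi> (1 # y) - \<phi> (-1 # y)) / 2"
  by (simp add: cube_deriv_def)

lemma Cons_in_cube: "s \<in> {1, -1} \<Longrightarrow> y \<in> cube n \<Longrightarrow> s # y \<in> cube (Suc n)"
  by (auto simp: cube_Suc)

lemma range: "s \<in> {1, -1} \<Longrightarrow> y \<in> cube n \<Longrightarrow> \<phi> (s # y) = 0 \<or> \<phi> (s # y) = 1"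
  using clause Cons_in_cube[of s y] by (fastforce simp: clauses_def dest: PiE_mem)

lemma flip: "s \<in> {1, -1} \<Longrightarrow> y \<in> cube n \<Longrightarrow> \<phi> ((- s) # map uminus y) = \<phi> (s # y)"
  using sign_symmetric[OF Cons_in_cube[of s y]] by simp

lemma finite_completions [simp]: "finite (completions s)"
  by (auto simp: completions_def)

lemma completions_uminus: "s \<in> {1, -1} \<Longrightarrow> completions (- s) = map uminus ` completions s"
proof (intro set_eqI iffI)
  fix y assume s: "s \<in> {1, -1}" and y: "y \<in> completions (- s)"
  then have "map uminus y \<in> completions s"
    using flip[of "- s" y] by (auto simp: completions_def)
  then show "y \<in> map uminus ` completions s"
    by (intro image_eqI[of _ _ "map uminus y"]) (auto simp: comp_def)
next
  fix y assume "s \<in> {1, -1}" "y \<in> map uminus ` completions s"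
  then show "y \<in> completions (- s)"
    using flip[of s] by (auto simp: completions_def)
qed

lemma card_completions: "s \<in> {1, -1} \<Longrightarrow> card (completions s) = N"
proof -
  have "card (completions (-1)) = N"
    using completions_uminus[of 1] unfolding N_def
    by (simp add: card_image inj_on_def)
  then show "s \<in> {1, -1} \<Longrightarrow> card (completions s) = N" by (auto simp: N_def)
qed

lemma sum_phi:
  assumes "s \<in> {1, -1}"
  shows "(\<Sum>y\<in>cube n. \<phi> (s # y) * g y) = (\<Sum>y\<in>completions s. g y)"
proof -
  have "\<phi> (s # y) * g y = (if \<phi> (s # y) = 1 then g y else 0)" if "y \<in> cube n" for y
    using range[OF assms that] by auto
  then show ?thesis by (simp add: completions_def sum.inter_filter cong: sum.cong)
qed

lemma N_pos: "N > 0"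
proof -
  have "cube n \<noteq> {}" using card_cube[of n] by auto
  then obtain y where "y \<in> cube n" by auto
  then obtain s where "s \<in> {1, -1}" "y \<in> completions s"
    using extendable[of y] by (auto simp: completions_def)
  then show ?thesis
    using card_completions[of s] card_gt_0_iff[of "completions s"] by auto
qed

lemma completions_nonempty: "s \<in> {1, -1} \<Longrightarrow> completions s \<noteq> {}"
  using card_completions[of s] N_pos by auto

lemma unorm_sq: "(unorm (Suc n) \<phi>)\<^sup>2 = N / 2 ^ n"
proof -
  have "(\<Sum>x\<in>cube (Suc n). \<phi> x * \<phi> x) = 2 * N"
  proof -
    have "(\<Sum>y\<in>cube n. \<phi> (s # y) * \<phi> (s # y)) = N" if s: "s \<in> {1, -1}" for s
      using card_completions[OF s] by (subst sum_phi[OF s]) (simp add: completions_def)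
    then show ?thesis by (simp add: sum_cube_Suc)
  qed
  moreover have "(\<Sum>x\<in>cube (Suc n). \<phi> x * \<phi> x) \<ge> 0" by (intro sum_nonneg) auto
  ultimately show ?thesis by (simp add: unorm_def uinner_def)
qed

lemma children_pmf_eq: "children_pmf (Suc n) \<phi> s = pmf_of_set (completions s)"
  by (simp add: children_pmf_def completions_def)

abbreviation channel :: "(nat \<Rightarrow> real \<Rightarrow> 'a pmf) \<Rightarrow> real \<Rightarrow> 'a list pmf" where
  "channel \<equiv> clause_channel n \<phi>"

lemma pmf_channel:
  assumes "s \<in> {1, -1}"
  shows "pmf (channel W s) b
    = (\<Sum>y\<in>cube n. \<phi> (s # y) * pmf (channel_product (map W [0..<n]) y) b) / N"
proof -
  have "pmf (channel W s) b = (\<Sum>y\<in>completions s.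
      pmf (sequence_pmf (map (\<lambda>i. W i (y ! i)) [0..<n])) b) / card (completions s)"
    unfolding clause_channel_def children_pmf_eq
    using completions_nonempty[OF assms] by (intro pmf_bind_pmf_of_set) auto
  also have "(\<Sum>y\<in>completions s. pmf (sequence_pmf (map (\<lambda>i. W i (y ! i)) [0..<n])) b)
      = (\<Sum>y\<in>completions s. pmf (channel_product (map W [0..<n]) y) b)"
    by (intro sum.cong refl) (auto simp: completions_def length_cube channel_product_map)
  finally show ?thesis unfolding sum_phi[OF assms] card_completions[OF assms] .
qed

lemma set_channel_subset:
  assumes "s \<in> {1, -1}"
  shows "set_pmf (channel W s) \<subseteq> set_pmf (sequence_pmf (map mix (map W [0..<n])))"
proof
  fix b assume "b \<in> set_pmf (channel W s)"
  then obtain y where y: "y \<in> completions s" 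
    and b: "b \<in> set_pmf (sequence_pmf (map (\<lambda>i. W i (y ! i)) [0..<n]))"
    using completions_nonempty[OF assms] by (auto simp: clause_channel_def children_pmf_eq)
  have "y \<in> cube n" using y by (simp add: completions_def)
  with b show "b \<in> set_pmf (sequence_pmf (map mix (map W [0..<n])))"
    unfolding map_map comp_def set_sequence_pmf
    by (auto simp: list_all2_conv_all_nth set_mix) (metis cube_nth)
qed

lemma finite_set_channel:
  assumes "s \<in> {1, -1}" "\<And>i t. i < n \<Longrightarrow> t \<in> {1, -1} \<Longrightarrow> finite (set_pmf (W i t))"
  shows "finite (set_pmf (channel W s))"
  by (rule finite_subset[OF set_channel_subset[OF assms(1)]])
    (use assms(2) in \<open>auto intro!: finite_set_sequence_pmf simp: set_mix\<close>)

text \<open>Extendability bounds the denominator \<open>R 1 + R (-1)\<close> from below by a product measure, for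
  which the sum of the squared numerators factorizes.\<close>

lemma info_channel_le:
  assumes fin: "\<And>i t. i < n \<Longrightarrow> t \<in> {1, -1} \<Longrightarrow> finite (set_pmf (W i t))"
  shows "info (channel W) \<le> 2 / (unorm (Suc n) \<phi>)\<^sup>2 * stab n f (\<lambda>i. info (W i))"
proof -
  define Ws where "Ws = map W [0..<n]"
  define V where "V y = pmf (channel_product Ws y)" for y
  define base where "base = pmf (sequence_pmf (map mix Ws))"
  define B where "B = set_pmf (sequence_pmf (map mix Ws))"
  define R where "R s = pmf (channel W s)" for s
  have len [simp]: "length Ws = n" by (simp add: Ws_def)
  have finB: "finite B"
    unfolding B_def Ws_def by (rule finite_set_sequence_pmf) (use fin in \<open>auto simp: set_mix\<close>)
  have sub: "set_pmf (channel W 1) \<subseteq> B" "set_pmf (channel W (-1)) \<subseteq> B"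
    using set_channel_subset[of 1 W] set_channel_subset[of "-1" W] by (auto simp: B_def Ws_def)
  have R: "R s b = (\<Sum>y\<in>cube n. \<phi> (s # y) * V y b) / N" if "s \<in> {1, -1}" for s b
    unfolding R_def V_def Ws_def by (rule pmf_channel[OF that])
  have lower: "2 ^ n / N * base b \<le> R 1 b + R (-1) b" for b
  proof -
    have "2 ^ n / N * base b = (\<Sum>y\<in>cube n. V y b) / N"
      using sum_channel_product[of Ws b] by (simp add: base_def V_def)
    also have "\<dots> \<le> (\<Sum>y\<in>cube n. (\<phi> (1 # y) + \<phi> (-1 # y)) * V y b) / N"
    proof (intro divide_right_mono sum_mono)
      fix y assume y: "y \<in> cube n"
      have "1 \<le> \<phi> (1 # y) + \<phi> (-1 # y)"
        using extendable[OF y] range[OF _ y, of 1] range[OF _ y, of "-1"] by auto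
      then show "V y b \<le> (\<phi> (1 # y) + \<phi> (-1 # y)) * V y b"
        using mult_right_mono[of 1 "\<phi> (1 # y) + \<phi> (-1 # y)" "V y b"] by (simp add: V_def)
    qed simp
    also have "\<dots> = R 1 b + R (-1) b"
      by (simp add: R distrib_right sum.distrib add_divide_distrib)
    finally show ?thesis .
  qed
  have base_pos: "base b > 0" if "b \<in> B" for b
    using that by (simp add: base_def B_def pmf_positive_iff)
  have diff: "R 1 b - R (-1) b = 2 / N * (\<Sum>y\<in>cube n. f y * V y b)" for b
    by (simp add: R f_eq diff_divide_distrib[symmetric] sum_subtractf[symmetric] sum_distrib_left)
      (simp add: sum_divide_distrib algebra_simps diff_divide_distrib)
  have one: "(\<Sum>b\<in>B. R s b) = 1" if "s \<in> {1, -1}" for s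
    unfolding R_def using that sub finB by (intro sum_pmf_eq_1) auto
  have "info (channel W) = (\<Sum>b\<in>B. R 1 b + R (-1) b) / 2 - (\<Sum>b\<in>B. 2 * R 1 b * R (-1) b / (R 1 b + R (-1) b))"
    unfolding info_def by (subst overlap_sum[OF finB sub(1)]) (simp add: sum.distrib one R_def[symmetric])
  also have "\<dots> = (\<Sum>b\<in>B. (R 1 b + R (-1) b) / 2 - 2 * R 1 b * R (-1) b / (R 1 b + R (-1) b))"
    by (simp add: sum_subtractf sum_divide_distrib)
  \<comment> \<open>The summand equals the squared difference over twice the sum of the two masses,
    so only its denominator has to be estimated, by \<open>lower\<close>.\<close>
  also have "\<dots> \<le> (\<Sum>b\<in>B. (R 1 b - R (-1) b)\<^sup>2 / (2 * (2 ^ n / N * base b)))"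
  proof (rule sum_mono)
    fix b assume b: "b \<in> B"
    have pos: "0 < 2 ^ n / N * base b" using base_pos[OF b] N_pos by simp
    then have pos': "0 < R 1 b + R (-1) b" using lower[of b] by linarith
    have "(R 1 b + R (-1) b) / 2 - 2 * R 1 b * R (-1) b / (R 1 b + R (-1) b)
        = (R 1 b - R (-1) b)\<^sup>2 / (2 * (R 1 b + R (-1) b))"
      using pos' by (simp add: field_simps power2_eq_square)
    also have "\<dots> \<le> (R 1 b - R (-1) b)\<^sup>2 / (2 * (2 ^ n / N * base b))"
    proof -
      have "D\<^sup>2 / (2 * x) \<le> D\<^sup>2 / (2 * c)" if "0 < c" "c \<le> x" for c x D :: real
        using that by (intro divide_left_mono mult_left_mono mult_pos_pos) auto
      from this[OF pos lower] show ?thesis .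
    qed
    finally show "(R 1 b + R (-1) b) / 2 - 2 * R 1 b * R (-1) b / (R 1 b + R (-1) b)
        \<le> (R 1 b - R (-1) b)\<^sup>2 / (2 * (2 ^ n / N * base b))" .
  qed
  also have "\<dots> = (\<Sum>b\<in>B. 2 / (N * 2 ^ n) *
      (\<Sum>y\<in>cube n. \<Sum>z\<in>cube n. f y * f z * (V y b * V z b / base b)))"
  proof (rule sum.cong[OF refl])
    fix b assume b: "b \<in> B"
    have "(\<Sum>y\<in>cube n. f y * V y b)\<^sup>2 / base b
        = (\<Sum>y\<in>cube n. \<Sum>z\<in>cube n. f y * f z * (V y b * V z b / base b))"
      unfolding power2_eq_square sum_product sum_divide_distrib
      by (intro sum.cong refl) (simp add: mult_ac)
    moreover have "(2 / N * S)\<^sup>2 / (2 * (2 ^ n / N * base b)) = 2 / (N * 2 ^ n) * (S\<^sup>2 / base b)" for S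
      using N_pos base_pos[OF b] by (simp add: field_simps power2_eq_square)
    ultimately show "(R 1 b - R (-1) b)\<^sup>2 / (2 * (2 ^ n / N * base b)) = 2 / (N * 2 ^ n) *
      (\<Sum>y\<in>cube n. \<Sum>z\<in>cube n. f y * f z * (V y b * V z b / base b))"
      by (simp only: diff)
  qed
  also have "\<dots> = 2 / (N * 2 ^ n) *
      (\<Sum>y\<in>cube n. \<Sum>z\<in>cube n. f y * f z * (\<Sum>b\<in>B. V y b * V z b / base b))"
  proof -
    have "(\<Sum>b\<in>B. \<Sum>y\<in>cube n. \<Sum>z\<in>cube n. f y * f z * (V y b * V z b / base b))
        = (\<Sum>y\<in>cube n. \<Sum>z\<in>cube n. \<Sum>b\<in>B. f y * f z * (V y b * V z b / base b))"
      by (subst sum.swap) (intro sum.cong refl sum.swap)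
    then show ?thesis by (simp only: sum_distrib_left[symmetric])
  qed
  also have "\<dots> = 2 / (N * 2 ^ n) *
      (\<Sum>y\<in>cube n. \<Sum>z\<in>cube n. f y * f z * (\<Prod>i<n. 1 + y ! i * z ! i * info (W i)))"
  proof -
    \<comment> \<open>Once the denominator is the product law \<open>base\<close>, the observations
      can be summed out and only the information of the children remains.\<close>
    have "(\<Sum>b\<in>B. V y b * V z b / base b) = (\<Prod>i<n. 1 + y ! i * z ! i * info (W i))"
      if "y \<in> cube n" "z \<in> cube n" for y z
    proof -
      have "finite (set_pmf (U t))" if "U \<in> set Ws" "t \<in> {1, -1}" for U t
        using fin that by (auto simp: Ws_def)
      then have "(\<Sum>b\<in>B. V y b * V z b / base b) = (\<Prod>i<n. 1 + y ! i * z ! i * info (Ws ! i))"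
        unfolding B_def V_def base_def using that kernel_product[of Ws y z] by simp
      then show ?thesis by (simp add: Ws_def)
    qed
    then show ?thesis by (simp cong: sum.cong)
  qed
  also have "\<dots> = 2 / (unorm (Suc n) \<phi>)\<^sup>2 * stab n f (\<lambda>i. info (W i))"
  proof -
    have "(4 :: real) ^ n = 2 ^ n * 2 ^ n" by (simp flip: power_mult_distrib)
    then have "2 / (N * 2 ^ n) * X = 2 / (N / 2 ^ n) * (X / 4 ^ n)" for X :: real
      using N_pos by simp
    then show ?thesis by (simp only: stab_def unorm_sq)
  qed
  finally show ?thesis .
qed

text \<open>The derivative is 1/2 or -1/2 exactly at the pivotal points, according to the sign they
  force, and 0 elsewhere. Negation exchanges the two kinds, so each makes up half of the
  total.\<close>

lemma card_pivotal:
  assumes "s \<in> {1, -1}"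
  shows "real (card {y \<in> cube n. \<phi> (s # y) = 1 \<and> \<phi> ((- s) # y) = 0})
    = 2 * 2 ^ n * influence (Suc n) 0 \<phi>"
proof -
  define Piv where "Piv s = {y \<in> cube n. \<phi> (s # y) = 1 \<and> \<phi> ((- s) # y) = 0}" for s
  have "Piv (-1) = map uminus ` Piv 1"
  proof (intro set_eqI iffI)
    fix y assume "y \<in> Piv (-1)"
    then have "map uminus y \<in> Piv 1"
      using flip[of 1 y] flip[of "-1" y] by (auto simp: Piv_def)
    then show "y \<in> map uminus ` Piv 1"
      by (intro image_eqI[of _ _ "map uminus y"]) (auto simp: comp_def)
  next
    fix y assume "y \<in> map uminus ` Piv 1"
    then show "y \<in> Piv (-1)" using flip[of 1] flip[of "-1"] by (auto simp: Piv_def)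
  qed
  then have eq: "card (Piv (-1)) = card (Piv 1)"
    by (simp add: card_image inj_on_def)
  have "(\<Sum>y\<in>cube n. 4 * (f y * f y)) = (\<Sum>y\<in>cube n. of_bool (y \<in> Piv 1) + of_bool (y \<in> Piv (-1)))"
    using range[of 1] range[of "-1"]
    by (intro sum.cong refl) (fastforce simp: f_eq Piv_def)
  also have "\<dots> = real (card (Piv 1)) + real (card (Piv (-1)))"
    by (simp add: sum.distrib of_bool_def sum.If_cases) (auto simp: Piv_def Int_def)
  finally have "4 * (\<Sum>y\<in>cube n. f y * f y) = 2 * real (card (Piv 1))"
    by (simp add: eq sum_distrib_left)
  moreover have "influence (Suc n) 0 \<phi> = (\<Sum>y\<in>cube n. f y * f y) / 2 ^ n"
    by (simp add: influence_def unorm_def uinner_def sum_nonneg)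
  ultimately have "real (card (Piv 1)) = 2 * 2 ^ n * influence (Suc n) 0 \<phi>" by simp
  with eq assms show ?thesis unfolding Piv_def[symmetric] by auto
qed

text \<open>If the completion \<open>y\<close> is pivotal and every child's observation excludes the
  opposite sign, then \<open>y\<close> is the only compatible assignment. It does not complete
  \<open>- s\<close>, so the observation is impossible there. Given \<open>y\<close>, the children
  are independent, whence the product of the \<open>d i\<close>.\<close>

lemma prob_channel_determined:
  assumes s: "s \<in> {1, -1}"
    and d: "\<And>i t. i < n \<Longrightarrow> t \<in> {1, -1} \<Longrightarrow>
      measure_pmf.prob (W i t) (- set_pmf (W i (- t))) = d i"
  shows "pivotal (Suc n) \<phi> * (\<Prod>i<n. d i) \<le> measure_pmf.prob (channel W s) (- set_pmf (channel W (- s)))"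
proof -
  let ?A = "- set_pmf (channel W (- s))"
  define V where "V y = sequence_pmf (map (\<lambda>i. W i (y ! i)) [0..<n])" for y
  define Piv where "Piv = {y \<in> cube n. \<phi> (s # y) = 1 \<and> \<phi> ((- s) # y) = 0}"
  have Piv: "Piv \<subseteq> completions s" by (auto simp: Piv_def completions_def)
  have piv: "(\<Prod>i<n. d i) \<le> measure_pmf.prob (V y) ?A" if y: "y \<in> Piv" for y
  proof -
    have yc: "y \<in> cube n" using y by (simp add: Piv_def)
    define D where "D i = - set_pmf (W i (- (y ! i)))" for i
    have "(\<Prod>i<n. d i) = prod_list (map (\<lambda>i. measure_pmf.prob (W i (y ! i)) (D i)) [0..<n])"
      unfolding D_def using d cube_nth[OF yc]
      by (subst prod.list_conv_set_nth) (auto simp: atLeast0LessThan intro!: prod.cong)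
    also have "\<dots> = measure_pmf.prob (V y) {xs. list_all2 (\<lambda>i x. x \<in> D i) [0..<n] xs}"
      by (simp add: V_def prob_sequence_pmf)
    also have "\<dots> \<le> measure_pmf.prob (V y) ?A"
    proof (rule measure_pmf.finite_measure_mono)
      show "{xs. list_all2 (\<lambda>i x. x \<in> D i) [0..<n] xs} \<subseteq> ?A"
      proof (clarify)
        fix xs assume D: "list_all2 (\<lambda>i x. x \<in> D i) [0..<n] xs"
          and "xs \<in> set_pmf (channel W (- s))"
        then obtain z where z: "z \<in> completions (- s)" 
          "list_all2 (\<lambda>i x. x \<in> set_pmf (W i (z ! i))) [0..<n] xs"
          using completions_nonempty[of "- s"] s
          by (auto simp: clause_channel_def children_pmf_eq set_sequence_pmf)
        have zc: "z \<in> cube n" using z by (simp add: completions_def)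
        have "z ! i = y ! i" if "i < n" for i
        proof -
          have "xs ! i \<in> set_pmf (W i (z ! i))" "xs ! i \<notin> set_pmf (W i (- (y ! i)))"
            using D z(2) that by (auto simp: list_all2_conv_all_nth D_def)
          then show ?thesis using cube_nth[OF yc that] cube_nth[OF zc that] by fastforce
        qed
        then have "z = y" using length_cube[OF yc] length_cube[OF zc] by (intro nth_equalityI) auto
        then show False using z y by (simp add: completions_def Piv_def)
      qed
    qed simp
    finally show ?thesis .
  qed
  have "pivotal (Suc n) \<phi> * (\<Prod>i<n. d i) = (\<Sum>y\<in>Piv. (\<Prod>i<n. d i)) / N"
    using card_pivotal[OF s] N_pos unfolding pivotal_def unorm_sq Piv_def[symmetric]
    by (simp add: field_simps)
  also have "\<dots> \<le> (\<Sum>y\<in>Piv. measure_pmf.prob (V y) ?A) / N"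
    by (intro divide_right_mono sum_mono piv) auto
  also have "\<dots> \<le> (\<Sum>y\<in>completions s. measure_pmf.prob (V y) ?A) / N"
    by (intro divide_right_mono sum_mono2 Piv) auto
  also have "\<dots> = measure_pmf.prob (channel W s) ?A"
    unfolding clause_channel_def children_pmf_eq V_def[symmetric]
    using completions_nonempty[OF s] by (simp add: prob_bind_pmf_of_set card_completions[OF s])
  finally show ?thesis .
qed

end

section \<open>Noise stability in terms of Fourier coefficients\<close>

lemma sum_cube_prod:
  "(\<Sum>x\<in>cube n. \<Prod>i<n. g i (x ! i)) = (\<Prod>i<n. g i 1 + g i (-1 :: real) :: real)"
proof (induction n arbitrary: g)
  case (Suc n)
  show ?case
    unfolding sum_cube_Suc prod.lessThan_Suc_shift comp_def
    using Suc[of "\<lambda>i. g (Suc i)"] by (simp add: sum_distrib_left[symmetric] distrib_right)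
qed simp

text \<open>Coordinatewise multiplication by a point of the cube is an involution of the
  cube.\<close>

lemma noise_op_eq:
  assumes x: "x \<in> cube n"
  shows "noise_op n \<theta> f x = (\<Sum>u\<in>cube n. f u * (\<Prod>i<n. (1 + x ! i * u ! i * \<theta>) / 2))"
proof -
  have x2: "x ! i * x ! i = 1" if "i < n" for i using cube_nth[OF x that] by auto
  have inv: "map2 (*) x (map2 (*) x u) = u" if "u \<in> cube n" for u
    using length_cube[OF x] length_cube[OF that]
    by (intro nth_equalityI) (auto simp: x2 mult.assoc[symmetric])
  have mem: "map2 (*) x u \<in> cube n" if "u \<in> cube n" for u
    using length_cube[OF x] length_cube[OF that] cube_nth[OF x] cube_nth[OF that]
    by (fastforce simp: cube_def set_zip)
  show ?thesis
    unfolding noise_op_def bias_weight_def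
    by (rule sum.reindex_bij_witness[of _ "map2 (*) x" "map2 (*) x"])
      (auto simp: inv mem length_cube x length_cube[OF x] x2 mult.assoc[symmetric] intro!: prod.cong)
qed

text \<open>The noise operator is self-adjoint and applying it twice squares its parameter; here
  this appears as the composition law of its kernel, summed over the middle point.\<close>

lemma noise_op_norm: "(unorm n (noise_op n \<theta> f))\<^sup>2 = stab n f (\<lambda>_. \<theta>\<^sup>2)"
proof -
  define K where "K x u = (\<Prod>i<n. (1 + x ! i * u ! i * \<theta>) / 2)" for x u :: "real list"
  have K: "(\<Sum>x\<in>cube n. K x u * K x v) = (\<Prod>i<n. 1 + u ! i * v ! i * \<theta>\<^sup>2) / 2 ^ n" for u v
  proof -
    have "(\<Sum>x\<in>cube n. K x u * K x v)
        = (\<Sum>x\<in>cube n. \<Prod>i<n. (1 + x ! i * u ! i * \<theta>) / 2 * ((1 + x ! i * v ! i * \<theta>) / 2))"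
      by (simp only: K_def prod.distrib)
    also have "\<dots> = (\<Prod>i<n. (1 + u ! i * v ! i * \<theta>\<^sup>2) / 2)"
      by (subst sum_cube_prod) (auto intro!: prod.cong simp: field_simps power2_eq_square)
    finally show ?thesis by (simp add: prod_dividef)
  qed
  have "(\<Sum>x\<in>cube n. noise_op n \<theta> f x * noise_op n \<theta> f x)
      = (\<Sum>x\<in>cube n. \<Sum>u\<in>cube n. \<Sum>v\<in>cube n. f u * f v * (K x u * K x v))"
  proof (rule sum.cong[OF refl])
    fix x assume "x \<in> cube n"
    then have "noise_op n \<theta> f x = (\<Sum>u\<in>cube n. f u * K x u)"
      by (simp only: noise_op_eq K_def)
    then show "noise_op n \<theta> f x * noise_op n \<theta> f x
        = (\<Sum>u\<in>cube n. \<Sum>v\<in>cube n. f u * f v * (K x u * K x v))"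
      by (simp add: sum_product mult_ac)
  qed
  also have "\<dots> = (\<Sum>u\<in>cube n. \<Sum>v\<in>cube n. f u * f v * (\<Sum>x\<in>cube n. K x u * K x v))"
    unfolding sum_distrib_left
    by (subst sum.swap) (intro sum.cong refl sum.swap)
  also have "\<dots> = stab n f (\<lambda>_. \<theta>\<^sup>2) * 2 ^ n"
  proof -
    have "(4 :: real) ^ n = 2 ^ n * 2 ^ n" by (simp flip: power_mult_distrib)
    then have "X / 2 ^ n = X / 4 ^ n * 2 ^ n" for X :: real by simp
    then show ?thesis unfolding K stab_def times_divide_eq_right sum_divide_distrib[symmetric] by metis
  qed
  finally have *: "uinner n (noise_op n \<theta> f) (noise_op n \<theta> f) = stab n f (\<lambda>_. \<theta>\<^sup>2)"
    by (simp add: uinner_def)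
  have "0 \<le> uinner n (noise_op n \<theta> f) (noise_op n \<theta> f)"
    unfolding uinner_def by (intro divide_nonneg_nonneg sum_nonneg) auto
  with * show ?thesis by (simp add: unorm_def)
qed

lemma stab_fourier: "stab n f (\<lambda>_. t) = (\<Sum>Q\<in>Pow {..<n}. t ^ card Q * (fourier_coeff n f Q)\<^sup>2)"
proof -
  have "(\<Prod>i<n. 1 + y ! i * z ! i * t)
      = (\<Sum>Q\<in>Pow {..<n}. t ^ card Q * (fourier_char Q y * fourier_char Q z))" for y z :: "real list"
    by (simp add: add.commute[of 1] prod_add fourier_char_def prod.distrib mult_ac)
  then have "stab n f (\<lambda>_. t) = (\<Sum>y\<in>cube n. \<Sum>z\<in>cube n. \<Sum>Q\<in>Pow {..<n}.
      f y * f z * (t ^ card Q * (fourier_char Q y * fourier_char Q z))) / 4 ^ n"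
    by (simp add: stab_def sum_distrib_left)
  also have "(\<Sum>y\<in>cube n. \<Sum>z\<in>cube n. \<Sum>Q\<in>Pow {..<n}.
      f y * f z * (t ^ card Q * (fourier_char Q y * fourier_char Q z)))
      = (\<Sum>y\<in>cube n. \<Sum>Q\<in>Pow {..<n}. \<Sum>z\<in>cube n. 
      f y * f z * (t ^ card Q * (fourier_char Q y * fourier_char Q z)))"
    by (intro sum.cong refl sum.swap)
  also have "\<dots> = (\<Sum>Q\<in>Pow {..<n}. \<Sum>y\<in>cube n. \<Sum>z\<in>cube n. 
      f y * f z * (t ^ card Q * (fourier_char Q y * fourier_char Q z)))"
    by (rule sum.swap)
  also have "\<dots> = (\<Sum>Q\<in>Pow {..<n}. t ^ card Q * (\<Sum>y\<in>cube n. fourier_char Q y * f y)\<^sup>2)"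
    by (simp add: power2_eq_square sum_product sum_distrib_left mult_ac)
  also have "\<dots> / 4 ^ n = (\<Sum>Q\<in>Pow {..<n}. t ^ card Q * (fourier_coeff n f Q)\<^sup>2)"
  proof -
    have "(4 :: real) ^ n = (2 ^ n)\<^sup>2" by (simp add: power2_eq_square flip: power_mult_distrib)
    then show ?thesis
      by (simp add: fourier_coeff_def uinner_def power_divide sum_divide_distrib[of _ "Pow {..<n}"])
  qed
  finally show ?thesis .
qed

text \<open>Without a constant term every power of \<open>t\<close> has positive degree, so one
  factor \<open>t\<close> can be split off and the others bounded by \<open>1 / 4\<close>. This
  value is \<open>\<theta>^2\<close> for \<open>\<theta> = 1 / 2\<close>, where the noise bound is
  applied later.\<close>

lemma stab_linear_bound:
  assumes "0 \<le> t" "t \<le> 1 / 4" and mean: "fourier_coeff n f {} = 0"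
  shows "stab n f (\<lambda>_. t) \<le> 4 * t * stab n f (\<lambda>_. 1 / 4)"
  unfolding stab_fourier sum_distrib_left
proof (rule sum_mono)
  fix Q assume "Q \<in> Pow {..<n}"
  then have fin: "finite Q" by (auto intro: finite_subset)
  show "t ^ card Q * (fourier_coeff n f Q)\<^sup>2 \<le> 4 * t * ((1 / 4) ^ card Q * (fourier_coeff n f Q)\<^sup>2)"
  proof (cases "Q = {}")
    case False
    with fin obtain m where m: "card Q = Suc m" by (metis card_eq_0_iff not0_implies_Suc)
    have "t ^ Suc m \<le> t * (1 / 4) ^ m"
      using assms by (auto intro!: mult_left_mono power_mono)
    also have "\<dots> = 4 * t * (1 / 4) ^ Suc m" by simp
    finally have "t ^ Suc m * (fourier_coeff n f Q)\<^sup>2 \<le> 4 * t * (1 / 4) ^ Suc m * (fourier_coeff n f Q)\<^sup>2"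
      by (rule mult_right_mono) simp
    then show ?thesis by (simp add: m mult_ac)
  qed (simp add: mean)
qed

text \<open>Sign symmetry of the clause makes its derivative an odd function.\<close>

lemma (in valid_clause) mean_f: "fourier_coeff n f {} = 0"
proof -
  have "(\<Sum>y\<in>cube n. f y) = (\<Sum>y\<in>cube n. f (map uminus y))"
    by (rule sum_cube_uminus[symmetric])
  also have "\<dots> = (\<Sum>y\<in>cube n. - f y)"
    using flip[of 1] flip[of "-1"] by (intro sum.cong refl) (simp add: f_eq field_simps)
  finally have "(\<Sum>y\<in>cube n. f y) = 0" by (simp add: sum_negf)
  then show ?thesis by (simp add: fourier_coeff_def uinner_def fourier_char_def)
qed

section \<open>The generations of a fixed tree\<close>

text \<open>The lengths are a function of the tree and not of the sampled values; this is what
  allows concatenated blocks to be separated again.\<close>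

primrec gen_length :: "nat \<Rightarrow> nat \<Rightarrow> ctree \<Rightarrow> nat" where
  "gen_length n 0 T = 1"
| "gen_length n (Suc l) T = sum_list (map (\<lambda>j. sum_list (map (\<lambda>i. gen_length n l (subtree T (j, i)))
     [0..<n])) [0..<length (T [])])"

lemma generation_Suc:
  "generation_pmf (Suc n) (Suc l) T s = map_pmf concat (sequence_pmf (map (\<lambda>j. map_pmf concat
     (clause_channel n (T [] ! j) (\<lambda>i. generation_pmf (Suc n) l (subtree T (j, i))) s))
     [0..<length (T [])]))"
  by (simp add: clause_channel_def map_bind_pmf)

declare generation_pmf.simps(2) [simp del]

text \<open>Blocks of known lengths can be read off from their concatenation, so flattening a
  generation to one list changes neither its overlap nor its chance of determining the root.\<close>

lemma inj_on_concat: "inj_on concat {bss. map length bss = ms}"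
proof (rule inj_onI)
  fix xs ys :: "'a list list"
  assume *: "xs \<in> {bss. map length bss = ms}" "ys \<in> {bss. map length bss = ms}"
    and eq: "concat xs = concat ys"
  then have lens: "map length xs = map length ys" by simp
  then have "length xs = length ys" by (metis length_map)
  moreover have "\<forall>(x, y)\<in>set (zip xs ys). length x = length y"
    using lens by (auto simp: set_zip) (metis length_map nth_map)
  ultimately show "xs = ys" using eq by (intro concat_injective)
qed

lemma map_length_sequence:
  assumes "bss \<in> set_pmf (sequence_pmf (map P js))"
    and "\<And>j b. j \<in> set js \<Longrightarrow> b \<in> set_pmf (P j) \<Longrightarrow> length b = m j"
  shows "map length bss = map m js"
  using assms(1) unfolding set_sequence_pmf
proof clarify
  assume "list_all2 (\<lambda>j x. x \<in> set_pmf (P j)) js bss"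
  then show "map length bss = map m js"
    using assms(2) by (intro nth_equalityI) (auto simp: list_all2_conv_all_nth)
qed

lemma map_length_clause_channel:
  assumes "bss \<in> set_pmf (clause_channel n \<phi> W s)"
    and "\<And>i t b. b \<in> set_pmf (W i t) \<Longrightarrow> length b = m i"
  shows "map length bss = map m [0..<n]"
  using assms unfolding clause_channel_def by (auto dest!: map_length_sequence)

lemma length_generation:
  "b \<in> set_pmf (generation_pmf (Suc n) l T s) \<Longrightarrow> length b = gen_length n l T"
proof (induction l arbitrary: T s b)
  case (Suc l)
  let ?ch = "\<lambda>j. clause_channel n (T [] ! j) (\<lambda>i. generation_pmf (Suc n) l (subtree T (j, i))) s"
  let ?m = "\<lambda>j. sum_list (map (\<lambda>i. gen_length n l (subtree T (j, i))) [0..<n])"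
  have len: "length c = ?m j" if c: "c \<in> set_pmf (map_pmf concat (?ch j))" for c j
  proof -
    from c obtain bs where bs: "bs \<in> set_pmf (?ch j)" "c = concat bs" by auto
    then have "map length bs = map (\<lambda>i. gen_length n l (subtree T (j, i))) [0..<n]"
      using Suc.IH by (intro map_length_clause_channel)
    then show ?thesis by (simp add: bs length_concat)
  qed
  from Suc.prems obtain bss where b: "b = concat bss"
    and "bss \<in> set_pmf (sequence_pmf (map (\<lambda>j. map_pmf concat (?ch j)) [0..<length (T [])]))"
    unfolding generation_Suc by auto
  from this(2) have "map length bss = map ?m [0..<length (T [])]"
    by (rule map_length_sequence) (use len in auto)
  then show ?case by (simp add: b length_concat)
qed simp

definition valid_tree :: "nat \<Rightarrow> ctree \<Rightarrow> bool" where
  "valid_tree n T \<longleftrightarrow> (\<forall>v. \<forall>\<phi>\<in>set (T v). valid_clause n \<phi>)"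

lemma valid_tree_subtree: "valid_tree n T \<Longrightarrow> valid_tree n (subtree T c)"
  by (auto simp: valid_tree_def subtree_def)

lemma valid_tree_nth: "valid_tree n T \<Longrightarrow> j < length (T []) \<Longrightarrow> valid_clause n (T [] ! j)"
  by (meson nth_mem valid_tree_def)

lemma finite_set_generation:
  "valid_tree n T \<Longrightarrow> s \<in> {1, -1} \<Longrightarrow> finite (set_pmf (generation_pmf (Suc n) l T s))"
proof (induction l arbitrary: T s)
  case (Suc l)
  have "finite (set_pmf (clause_channel n (T [] ! j) (\<lambda>i. generation_pmf (Suc n) l (subtree T (j, i))) s))"
    if "j < length (T [])" for j
    using Suc that
    by (intro valid_clause.finite_set_channel valid_tree_nth Suc.IH valid_tree_subtree) auto
  then show ?case
    unfolding generation_Suc by (auto intro!: finite_imageI finite_set_sequence_pmf)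
qed simp

lemma sequence_pmf_map_pmf:
  "length hs \<le> length qs \<Longrightarrow>
    sequence_pmf (map2 map_pmf hs qs) = map_pmf (map2 (\<lambda>h x. h x) hs) (sequence_pmf qs)"
proof (induction hs arbitrary: qs)
  case Nil
  then show ?case by simp
next
  case (Cons h hs)
  then obtain q qs' where qs: "qs = q # qs'" by (cases qs) auto
  with Cons have "sequence_pmf (map2 map_pmf hs qs') = map_pmf (map2 (\<lambda>h x. h x) hs) (sequence_pmf qs')"
    by simp
  then show ?case
    by (simp add: qs sequence_pmf_Cons map_pmf_comp case_prod_unfold comp_def
        map_pair[symmetric] map_pmf_comp)
qed

text \<open>The case \<open>a < a'\<close> explains the form: surplus entries are sampled and then
  discarded, as happens when a tree is compared with a larger one.\<close>

lemma sequence_pmf_map_pmf_upt: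
  assumes "a \<le> a'"
  shows "sequence_pmf (map (\<lambda>j. map_pmf (h j) (q j)) [0..<a])
    = map_pmf (\<lambda>xs. map (\<lambda>j. h j (xs ! j)) [0..<a]) (sequence_pmf (map q [0..<a']))"
proof -
  have "map (\<lambda>j. map_pmf (h j) (q j)) [0..<a] = map2 map_pmf (map h [0..<a]) (map q [0..<a'])"
    using assms by (intro nth_equalityI) auto
  then have "sequence_pmf (map (\<lambda>j. map_pmf (h j) (q j)) [0..<a])
      = map_pmf (map2 (\<lambda>h x. h x) (map h [0..<a])) (sequence_pmf (map q [0..<a']))"
    using assms by (simp add: sequence_pmf_map_pmf)
  also have "\<dots> = map_pmf (\<lambda>xs. map (\<lambda>j. h j (xs ! j)) [0..<a]) (sequence_pmf (map q [0..<a']))"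
  proof (rule map_pmf_cong[OF refl])
    fix xs assume "xs \<in> set_pmf (sequence_pmf (map q [0..<a']))"
    then have "length xs = a'" using length_sequence_pmf by fastforce
    then show "map2 (\<lambda>h x. h x) (map h [0..<a]) xs = map (\<lambda>j. h j (xs ! j)) [0..<a]"
      using assms by (intro nth_equalityI) auto
  qed
  finally show ?thesis .
qed

section \<open>Symmetry of the generations under a global sign flip\<close>

lemma map_uminus_concat: "map uminus (concat bss) = concat (map (map uminus) bss)"
  by (simp add: map_concat)

text \<open>Negation carries the uniform law on the completions of \<open>s\<close> to that on the
  completions of \<open>- s\<close>, and it acts on each child's observation through
  \<open>g\<close>.\<close>

lemma (in valid_clause) channel_uminus:
  assumes W: "\<And>i t. i < n \<Longrightarrow> t \<in> {1, -1} \<Longrightarrow> W i (- t) = map_pmf g (W i t)"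
    and s: "s \<in> {1, -1}"
  shows "channel W (- s) = map_pmf (map g) (channel W s)"
proof -
  let ?S = "\<lambda>y. sequence_pmf (map (\<lambda>i. W i (y ! i)) [0..<n])"
  have "channel W (- s) = bind_pmf (map_pmf (map uminus) (pmf_of_set (completions s))) ?S"
    unfolding clause_channel_def children_pmf_eq completions_uminus[OF s]
    using completions_nonempty[OF s] by (subst map_pmf_of_set_inj) (auto simp: inj_on_def)
  also have "\<dots> = bind_pmf (pmf_of_set (completions s)) (\<lambda>y. map_pmf (map g) (?S y))"
    unfolding bind_map_pmf
  proof (rule bind_pmf_cong[OF refl])
    fix y assume "y \<in> set_pmf (pmf_of_set (completions s))"
    then have y: "y \<in> cube n" using completions_nonempty[OF s] by (auto simp: completions_def)
    have "map (\<lambda>i. W i (map uminus y ! i)) [0..<n] = map (\<lambda>i. map_pmf g (W i (y ! i))) [0..<n]"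
      using W cube_nth[OF y] length_cube[OF y] by auto
    then have "?S (map uminus y) = sequence_pmf (map (\<lambda>i. map_pmf g (W i (y ! i))) [0..<n])"
      by (rule arg_cong)
    also have "\<dots> = map_pmf (\<lambda>xs. map (\<lambda>i. g (xs ! i)) [0..<n]) (?S y)"
      by (rule sequence_pmf_map_pmf_upt[OF order.refl])
    also have "\<dots> = map_pmf (map g) (?S y)"
    proof (rule map_pmf_cong[OF refl])
      fix xs assume "xs \<in> set_pmf (?S y)"
      then have "length xs = n" using length_sequence_pmf by fastforce
      then show "map (\<lambda>i. g (xs ! i)) [0..<n] = map g xs" by (intro nth_equalityI) auto
    qed
    finally show "?S (map uminus y) = map_pmf (map g) (?S y)" .
  qed
  finally show ?thesis by (simp add: clause_channel_def children_pmf_eq map_bind_pmf)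
qed

text \<open>This supplies the involution required in \<open>overlap_sequence\<close>, and it makes
  the probability of determination the same for both root signs.\<close>

lemma generation_uminus:
  "valid_tree n T \<Longrightarrow> s \<in> {1, -1} \<Longrightarrow>
    generation_pmf (Suc n) l T (- s) = map_pmf (map uminus) (generation_pmf (Suc n) l T s)"
proof (induction l arbitrary: T s)
  case (Suc l)
  let ?ch = "\<lambda>j. clause_channel n (T [] ! j) (\<lambda>i. generation_pmf (Suc n) l (subtree T (j, i)))"
  let ?a = "length (T [])"
  have ch: "map_pmf concat (?ch j (- s)) = map_pmf (map uminus) (map_pmf concat (?ch j s))"
    if "j < ?a" for j
  proof -
    have "?ch j (- s) = map_pmf (map (map uminus)) (?ch j s)"
      by (rule valid_clause.channel_uminus)
        (use Suc that in \<open>auto intro: valid_tree_nth valid_tree_subtree\<close>)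
    then show ?thesis by (simp add: map_pmf_comp map_uminus_concat)
  qed
  have "generation_pmf (Suc n) (Suc l) T (- s)
      = map_pmf concat (sequence_pmf (map (\<lambda>j. map_pmf (map uminus) (map_pmf concat (?ch j s))) [0..<?a]))"
    unfolding generation_Suc using ch by (auto intro!: arg_cong[of _ _ sequence_pmf] arg_cong[of _ _ "map_pmf concat"])
  also have "\<dots> = map_pmf concat (map_pmf (\<lambda>xs. map (\<lambda>j. map uminus (xs ! j)) [0..<?a])
      (sequence_pmf (map (\<lambda>j. map_pmf concat (?ch j s)) [0..<?a])))"
    by (subst sequence_pmf_map_pmf_upt[OF order.refl]) simp
  also have "\<dots> = map_pmf (map uminus) (generation_pmf (Suc n) (Suc l) T s)"
    unfolding generation_Suc map_pmf_comp
  proof (rule map_pmf_cong[OF refl])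
    fix xs assume "xs \<in> set_pmf (sequence_pmf (map (\<lambda>j. map_pmf concat (?ch j s)) [0..<?a]))"
    then have "length xs = ?a" using length_sequence_pmf by fastforce
    then have "map (\<lambda>j. map uminus (xs ! j)) [0..<?a] = map (map uminus) xs"
      by (intro nth_equalityI) auto
    then show "concat (map (\<lambda>j. map uminus (xs ! j)) [0..<?a]) = map uminus (concat xs)"
      by (simp add: map_uminus_concat)
  qed
  finally show ?case .
qed simp

text \<open>For generations of a valid tree the root value -1 gives the same probability
  (\<open>determined_generation\<close>), so one sign suffices. As the probability of a support, it
  factorizes exactly over independent observations.\<close>

definition undetermined :: "(real \<Rightarrow> 'a pmf) \<Rightarrow> real" where
  "undetermined W = measure_pmf.prob (W 1) (set_pmf (W (-1)))"

lemma undetermined_nonneg: "0 \<le> undetermined W" and undetermined_le_1: "undetermined W \<le> 1"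
  by (auto simp: undetermined_def)

lemma undetermined_map_inj:
  assumes "inj_on g (set_pmf (W 1) \<union> set_pmf (W (-1)))"
  shows "undetermined (\<lambda>s. map_pmf g (W s)) = undetermined W"
proof -
  have "measure_pmf.prob (W 1) (g -` g ` set_pmf (W (-1)))
      = measure_pmf.prob (W 1) (g -` g ` set_pmf (W (-1)) \<inter> set_pmf (W 1))"
    by (simp add: measure_Int_set_pmf)
  also have "g -` g ` set_pmf (W (-1)) \<inter> set_pmf (W 1) = set_pmf (W (-1)) \<inter> set_pmf (W 1)"
    using assms by (auto dest: inj_onD)
  finally show ?thesis by (simp add: undetermined_def measure_Int_set_pmf)
qed

lemma undetermined_sequence:
  "undetermined (\<lambda>s. sequence_pmf (map (\<lambda>j. W j s) js)) = prod_list (map (\<lambda>j. undetermined (W j)) js)"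
  unfolding undetermined_def set_sequence_pmf by (rule prob_sequence_pmf)

lemma info_map_inj:
  assumes "inj_on g (set_pmf (W 1) \<union> set_pmf (W (-1)))"
  shows "info (\<lambda>s. map_pmf g (W s)) = info W"
  using overlap_map_inj[OF assms] by (simp add: info_def)

context
  fixes n l :: nat and T :: ctree
begin

private abbreviation ch where
  "ch j \<equiv> clause_channel n (T [] ! j) (\<lambda>i. generation_pmf (Suc n) l (subtree T (j, i)))"

private lemma inj_channel: "inj_on concat (set_pmf (ch j 1) \<union> set_pmf (ch j (-1)))"
  by (rule inj_on_subset[OF inj_on_concat[of "map (\<lambda>i. gen_length n l (subtree T (j, i))) [0..<n]"]])
    (auto dest: map_length_clause_channel length_generation)

private lemma inj_node: "inj_on concat (set_pmf (sequence_pmf (map (\<lambda>j. map_pmf concat (ch j 1)) [0..<a]))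
    \<union> set_pmf (sequence_pmf (map (\<lambda>j. map_pmf concat (ch j (-1))) [0..<a])))"
proof -
  define m where "m j = sum_list (map (\<lambda>i. gen_length n l (subtree T (j, i))) [0..<n])" for j
  have "length b = m j" if "b \<in> set_pmf (map_pmf concat (ch j s))" for b j s
  proof -
    from that obtain bs where bs: "bs \<in> set_pmf (ch j s)" "b = concat bs" by auto
    then have "map length bs = map (\<lambda>i. gen_length n l (subtree T (j, i))) [0..<n]"
      by (intro map_length_clause_channel length_generation)
    then show ?thesis by (simp add: bs length_concat m_def)
  qed
  note len = this
  have "bss \<in> set_pmf (sequence_pmf (map (\<lambda>j. map_pmf concat (ch j s)) [0..<a])) \<Longrightarrow>
      map length bss = map m [0..<a]" for bss s
    by (erule map_length_sequence) (rule len)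
  then show ?thesis by (intro inj_on_subset[OF inj_on_concat[of "map m [0..<a]"]]) auto
qed

lemma undetermined_generation_Suc:
  "undetermined (generation_pmf (Suc n) (Suc l) T) = (\<Prod>j<length (T []). undetermined (ch j))"
proof -
  have "undetermined (generation_pmf (Suc n) (Suc l) T)
      = prod_list (map (\<lambda>j. undetermined (\<lambda>s. map_pmf concat (ch j s))) [0..<length (T [])])"
    unfolding generation_Suc by (subst undetermined_map_inj[OF inj_node]) (rule undetermined_sequence)
  moreover have "undetermined (\<lambda>s. map_pmf concat (ch j s)) = undetermined (ch j)" for j
    by (rule undetermined_map_inj[OF inj_channel])
  ultimately show ?thesis
    by (simp add: prod.list_conv_set_nth atLeast0LessThan)
qed

text \<open>The clauses at a node are independent symmetric observations of the same sign, so this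
  is \<open>overlap_sequence\<close> with the sign flip as involution. Validity of the clauses
  enters through finite supports and through this flip.\<close>

lemma info_generation_Suc:
  assumes T: "valid_tree n T"
  shows "(\<Prod>j<length (T []). 1 - info (ch j)) \<le> 1 - info (generation_pmf (Suc n) (Suc l) T)"
proof -
  have fin: "finite (set_pmf (ch j s))" if "j < length (T [])" "s \<in> {1, -1}" for j s
    using that T by (intro valid_clause.finite_set_channel)
      (auto intro!: valid_tree_nth valid_tree_subtree finite_set_generation)
  have flip: "map_pmf concat (ch j (- 1)) = map_pmf (map uminus) (map_pmf concat (ch j 1))"
    if "j < length (T [])" for j
  proof -
    have "ch j (- 1) = map_pmf (map (map uminus)) (ch j 1)"
      by (rule valid_clause.channel_uminus)
        (use T that in \<open>auto intro!: valid_tree_nth valid_tree_subtree generation_uminus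
          simp: generation_uminus[of _ _ 1, simplified] generation_uminus[of _ _ "-1", simplified]\<close>)
    then show ?thesis by (simp add: map_pmf_comp map_uminus_concat)
  qed
  have "(\<Prod>j<length (T []). 1 - info (ch j))
      = prod_list (map (\<lambda>j. 1 - info (\<lambda>s. map_pmf concat (ch j s))) [0..<length (T [])])"
  proof -
    have "info (\<lambda>s. map_pmf concat (ch j s)) = info (ch j)" for j
      by (rule info_map_inj[OF inj_channel])
    then show ?thesis by (simp add: prod.list_conv_set_nth atLeast0LessThan)
  qed
  also have "\<dots> \<le> overlap (sequence_pmf (map (\<lambda>j. map_pmf concat (ch j 1)) [0..<length (T [])]))
      (sequence_pmf (map (\<lambda>j. map_pmf concat (ch j (-1))) [0..<length (T [])]))"
    unfolding info_def diff_diff_eq2 add_diff_cancel_left'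
    by (rule overlap_sequence[where \<sigma> = "map uminus"]) (use fin flip in \<open>auto simp: comp_def\<close>)
  also have "\<dots> = 1 - info (generation_pmf (Suc n) (Suc l) T)"
    unfolding generation_Suc info_def by (simp add: overlap_map_inj[OF inj_node])
  finally show ?thesis .
qed

end

lemma determined_generation:
  assumes "valid_tree n T" "s \<in> {1, -1}"
  shows "measure_pmf.prob (generation_pmf (Suc n) l T s) (- set_pmf (generation_pmf (Suc n) l T (- s)))
    = 1 - undetermined (generation_pmf (Suc n) l T)"
proof -
  let ?G = "generation_pmf (Suc n) l T"
  have compl: "measure_pmf.prob (?G s) (- set_pmf (?G (- s))) = 1 - measure_pmf.prob (?G s) (set_pmf (?G (- s)))" for s
    using measure_pmf.prob_compl[of "set_pmf (?G (- s))" "?G s"] by (simp add: Compl_eq_Diff_UNIV)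
  have "measure_pmf.prob (?G (-1)) (set_pmf (?G 1)) = measure_pmf.prob (?G 1) (set_pmf (?G (-1)))"
  proof -
    have [simp]: "map uminus -` (map uminus ` A) = A" for A :: "real list set"
      by (rule inj_vimage_image_eq) (auto simp: inj_def)
    have 1: "?G (-1) = map_pmf (map uminus) (?G 1)"
      using generation_uminus[OF assms(1), of 1] by simp
    moreover have "?G 1 = map_pmf (map uminus) (?G (-1))"
      using generation_uminus[OF assms(1), of "-1"] by simp
    then have "set_pmf (?G 1) = map uminus ` set_pmf (?G (-1))" by (metis set_map_pmf)
    ultimately show ?thesis by (metis (no_types) measure_map_pmf \<open>\<And>A. map uminus -` (map uminus ` A) = A\<close>)
  qed
  with assms(2) compl[of s] show ?thesis by (auto simp: undetermined_def)
qed

section \<open>Total variation\<close>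

lemma tv_dist_bdd: "bdd_above (range (\<lambda>A. \<bar>measure_pmf.prob p A - measure_pmf.prob q A\<bar>))"
proof (rule bdd_aboveI2)
  fix A
  show "\<bar>measure_pmf.prob p A - measure_pmf.prob q A\<bar> \<le> 1"
    using measure_pmf.prob_le_1[of p A] measure_pmf.prob_le_1[of q A]
      measure_nonneg[of p A] measure_nonneg[of q A] by linarith
qed

lemma tv_dist_ge: "\<bar>measure_pmf.prob p A - measure_pmf.prob q A\<bar> \<le> tv_dist p q"
  unfolding tv_dist_def by (rule cSUP_upper[OF UNIV_I tv_dist_bdd])

lemma tv_dist_le:
  "(\<And>A. \<bar>measure_pmf.prob p A - measure_pmf.prob q A\<bar> \<le> c) \<Longrightarrow> tv_dist p q \<le> c"
  unfolding tv_dist_def by (rule cSUP_least) auto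

lemma tv_dist_nonneg: "0 \<le> tv_dist p q"
  using tv_dist_ge[of p "{}" q] by simp

lemma tv_dist_le_1: "tv_dist p q \<le> 1"
proof (rule tv_dist_le)
  fix A
  show "\<bar>measure_pmf.prob p A - measure_pmf.prob q A\<bar> \<le> 1"
    using measure_pmf.prob_le_1[of p A] measure_pmf.prob_le_1[of q A]
      measure_nonneg[of p A] measure_nonneg[of q A] by linarith
qed

lemma tv_dist_map_le: "tv_dist (map_pmf g p) (map_pmf g q) \<le> tv_dist p q"
  by (rule tv_dist_le) (simp add: tv_dist_ge)

definition coupled_tv :: "(real \<Rightarrow> 'a pmf) \<Rightarrow> real" where
  "coupled_tv W = (let \<mu> = bind_pmf (pmf_of_set {-1, 1}) (\<lambda>s. map_pmf (Pair s) (W s))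
    in tv_dist \<mu> (pair_pmf (map_pmf fst \<mu>) (map_pmf snd \<mu>)))"

lemma reconstruction_tv_eq: "reconstruction_tv k l T = coupled_tv (generation_pmf k l T)"
  by (simp add: reconstruction_tv_def coupled_tv_def root_generation_pmf_def)

text \<open>Data processing: the joint law and the product of its marginals are transported by the
  same map.\<close>

lemma coupled_tv_map_le: "coupled_tv (\<lambda>s. map_pmf h (W s)) \<le> coupled_tv W"
proof -
  define \<mu> where "\<mu> = bind_pmf (pmf_of_set {-1, 1}) (\<lambda>s. map_pmf (Pair s) (W s))"
  have "bind_pmf (pmf_of_set {-1, 1}) (\<lambda>s. map_pmf (Pair s) (map_pmf h (W s)))
      = map_pmf (apsnd h) \<mu>"
    by (simp add: \<mu>_def map_bind_pmf map_pmf_comp)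
  then have "coupled_tv (\<lambda>s. map_pmf h (W s)) = tv_dist (map_pmf (apsnd h) \<mu>)
      (pair_pmf (map_pmf fst \<mu>) (map_pmf h (map_pmf snd \<mu>)))"
    by (simp add: coupled_tv_def map_pmf_comp)
  also have "\<dots> \<le> coupled_tv W"
    unfolding pair_map_pmf2 coupled_tv_def Let_def \<mu>_def[symmetric] by (rule tv_dist_map_le)
  finally show ?thesis .
qed

text \<open>On the slice with root value \<open>s\<close> the joint law is \<open>W s / 2\<close>
  and the product law is \<open>(W 1 + W (-1)) / 4\<close>; their difference is
  \<open>s * (W 1 - W (-1)) / 4\<close>.\<close>

lemma coupled_tv_event:
  fixes W :: "real \<Rightarrow> 'a pmf"
  defines "\<mu> \<equiv> bind_pmf (pmf_of_set {-1, 1}) (\<lambda>s. map_pmf (Pair s) (W s))"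
  shows "measure_pmf.prob \<mu> A - measure_pmf.prob (pair_pmf (map_pmf fst \<mu>) (map_pmf snd \<mu>)) A
    = ((measure_pmf.prob (W 1) (Pair 1 -` A) - measure_pmf.prob (W (-1)) (Pair 1 -` A))
     - (measure_pmf.prob (W 1) (Pair (-1) -` A) - measure_pmf.prob (W (-1)) (Pair (-1) -` A))) / 4"
proof -
  have fst: "map_pmf fst \<mu> = pmf_of_set {-1, 1}"
    by (simp add: \<mu>_def map_bind_pmf map_pmf_comp map_pmf_const bind_return_pmf')
  have snd: "map_pmf snd \<mu> = bind_pmf (pmf_of_set {-1, 1}) W"
    by (simp add: \<mu>_def map_bind_pmf map_pmf_comp)
  have pair: "pair_pmf (map_pmf fst \<mu>) (map_pmf snd \<mu>)
      = bind_pmf (pmf_of_set {-1, 1}) (\<lambda>s. map_pmf (Pair s) (bind_pmf (pmf_of_set {-1, 1}) W))"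
    unfolding fst snd by (simp add: pair_pmf_def map_pmf_def)
  show ?thesis
    unfolding pair unfolding \<mu>_def
    by (simp add: prob_bind_pmf_of_set field_simps)
qed

text \<open>The test event: the root is 1 and the observation is impossible for the root value
  -1.\<close>

lemma coupled_tv_ge: "(1 - undetermined W) / 4 \<le> coupled_tv W"
proof -
  let ?D = "- set_pmf (W (-1))"
  have "measure_pmf.prob (W (-1)) ?D = 0"
    by (simp add: measure_pmf.prob_eq_0 AE_measure_pmf_iff)
  moreover have "measure_pmf.prob (W 1) ?D = 1 - undetermined W"
    using measure_pmf.prob_compl[of "set_pmf (W (-1))" "W 1"]
    by (simp add: undetermined_def Compl_eq_Diff_UNIV)
  moreover have "Pair (1 :: real) -` ({1} \<times> ?D) = ?D" "Pair (-1 :: real) -` ({1} \<times> ?D) = {}"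
    by auto
  ultimately have "(1 - undetermined W) / 4 = \<bar>measure_pmf.prob (bind_pmf (pmf_of_set {-1, 1}) (\<lambda>s. map_pmf (Pair s) (W s))) ({1} \<times> ?D)
    - measure_pmf.prob (let \<mu> = bind_pmf (pmf_of_set {-1, 1}) (\<lambda>s. map_pmf (Pair s) (W s)) in pair_pmf (map_pmf fst \<mu>) (map_pmf snd \<mu>)) ({1} \<times> ?D)\<bar>"
    using undetermined_le_1[of W] unfolding Let_def coupled_tv_event by simp
  also have "\<dots> \<le> coupled_tv W"
    unfolding coupled_tv_def Let_def by (rule tv_dist_ge)
  finally show ?thesis .
qed

text \<open>Cauchy-Schwarz with weights \<open>pmf P b + pmf Q b\<close>: the first sum is 2, the
  second is \<open>2 * (1 - overlap P Q)\<close>.\<close>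

lemma sum_abs_diff_le:
  assumes fin: "finite (set_pmf P)" "finite (set_pmf Q)"
  shows "(\<Sum>b\<in>set_pmf P \<union> set_pmf Q. \<bar>pmf P b - pmf Q b\<bar>) \<le> 2 * sqrt (1 - overlap P Q)"
proof -
  let ?B = "set_pmf P \<union> set_pmf Q"
  have pos: "pmf P b + pmf Q b > 0" if "b \<in> ?B" for b
    using that by (auto simp: pmf_positive_iff intro: add_pos_nonneg add_nonneg_pos)
  have one: "(\<Sum>b\<in>?B. pmf P b) = 1" "(\<Sum>b\<in>?B. pmf Q b) = 1"
    using fin by (auto intro: sum_pmf_eq_1)
  have "(\<Sum>b\<in>?B. \<bar>pmf P b - pmf Q b\<bar>)
      = (\<Sum>b\<in>?B. sqrt (pmf P b + pmf Q b) * (\<bar>pmf P b - pmf Q b\<bar> / sqrt (pmf P b + pmf Q b)))"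
    using pos by (intro sum.cong refl) (simp add: less_imp_neq[symmetric])
  also have "\<dots> \<le> sqrt ((\<Sum>b\<in>?B. (sqrt (pmf P b + pmf Q b))\<^sup>2) *
      (\<Sum>b\<in>?B. (\<bar>pmf P b - pmf Q b\<bar> / sqrt (pmf P b + pmf Q b))\<^sup>2))"
    by (intro real_le_rsqrt Cauchy_Schwarz_ineq_sum)
  also have "(\<Sum>b\<in>?B. (sqrt (pmf P b + pmf Q b))\<^sup>2) = 2"
    by (simp add: sum.distrib one)
  also have "(\<Sum>b\<in>?B. (\<bar>pmf P b - pmf Q b\<bar> / sqrt (pmf P b + pmf Q b))\<^sup>2)
      = (\<Sum>b\<in>?B. (pmf P b + pmf Q b) - 2 * (2 * pmf P b * pmf Q b / (pmf P b + pmf Q b)))"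
  proof (rule sum.cong[OF refl])
    fix b assume "b \<in> ?B"
    from pos[OF this] show "(\<bar>pmf P b - pmf Q b\<bar> / sqrt (pmf P b + pmf Q b))\<^sup>2
        = (pmf P b + pmf Q b) - 2 * (2 * pmf P b * pmf Q b / (pmf P b + pmf Q b))"
      by (simp add: power_divide field_simps power2_eq_square)
  qed
  also have "\<dots> = 2 * (1 - overlap P Q)"
  proof -
    have "overlap P Q = (\<Sum>b\<in>?B. 2 * pmf P b * pmf Q b / (pmf P b + pmf Q b))"
      using fin by (intro overlap_sum) auto
    then show ?thesis
      by (simp only: sum_subtractf sum.distrib one sum_distrib_left[symmetric]) simp
  qed
  also have "sqrt (2 * (2 * (1 - overlap P Q))) = 2 * sqrt (1 - overlap P Q)"
  proof -
    have "sqrt (2 * (2 * x)) = 2 * sqrt x" for x :: real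
      using real_sqrt_mult[of "2\<^sup>2" x] by simp
    then show ?thesis .
  qed
  finally show ?thesis .
qed

lemma coupled_tv_le:
  assumes fin: "finite (set_pmf (W 1))" "finite (set_pmf (W (-1)))"
  shows "coupled_tv W \<le> sqrt (info W)"
proof -
  let ?B = "set_pmf (W 1) \<union> set_pmf (W (-1))"
  have *: "\<bar>measure_pmf.prob (W 1) A - measure_pmf.prob (W (-1)) A\<bar> \<le> 2 * sqrt (info W)" for A
  proof -
    have "measure_pmf.prob (W s) A = (\<Sum>b\<in>?B \<inter> A. pmf (W s) b)" if "s \<in> {1, -1}" for s
    proof -
      have "measure_pmf.prob (W s) A = measure_pmf.prob (W s) (A \<inter> set_pmf (W s))"
        by (simp add: measure_Int_set_pmf)
      also have "\<dots> = measure_pmf.prob (W s) (?B \<inter> A \<inter> set_pmf (W s))"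
        using that by (intro arg_cong[of _ _ "measure_pmf.prob (W s)"]) auto
      also have "\<dots> = (\<Sum>b\<in>?B \<inter> A. pmf (W s) b)"
        using fin by (simp add: measure_Int_set_pmf measure_measure_pmf_finite)
      finally show ?thesis .
    qed
    then have "\<bar>measure_pmf.prob (W 1) A - measure_pmf.prob (W (-1)) A\<bar>
        = \<bar>\<Sum>b\<in>?B \<inter> A. pmf (W 1) b - pmf (W (-1)) b\<bar>"
      by (simp add: sum_subtractf)
    also have "\<dots> \<le> (\<Sum>b\<in>?B \<inter> A. \<bar>pmf (W 1) b - pmf (W (-1)) b\<bar>)" by (rule sum_abs)
    also have "\<dots> \<le> (\<Sum>b\<in>?B. \<bar>pmf (W 1) b - pmf (W (-1)) b\<bar>)"
      using fin by (intro sum_mono2) auto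
    also have "\<dots> \<le> 2 * sqrt (info W)"
      unfolding info_def by (rule sum_abs_diff_le[OF fin])
    finally show ?thesis .
  qed
  show ?thesis
    unfolding coupled_tv_def Let_def
  proof (rule tv_dist_le, unfold coupled_tv_event)
    fix A :: "(real \<times> 'a) set"
    show "\<bar>((measure_pmf.prob (W 1) (Pair 1 -` A) - measure_pmf.prob (W (-1)) (Pair 1 -` A))
     - (measure_pmf.prob (W 1) (Pair (-1) -` A) - measure_pmf.prob (W (-1)) (Pair (-1) -` A))) / 4\<bar>
      \<le> sqrt (info W)"
      using *[of "Pair 1 -` A"] *[of "Pair (-1) -` A"] by (simp add: abs_le_iff)
  qed
qed

section \<open>Enlarging the tree\<close>

text \<open>Appending at the end preserves the addresses of the children of the old clauses, so
  forming subtrees commutes with it.\<close>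

definition tree_append :: "ctree \<Rightarrow> ctree \<Rightarrow> ctree" where
  "tree_append T R = (\<lambda>v. T v @ R v)"

lemma subtree_append: "subtree (tree_append T R) c = tree_append (subtree T c) (subtree R c)"
  by (simp add: subtree_def tree_append_def)

text \<open>\<open>H\<close> is obtained before \<open>q\<close> because one map has to serve both
  root signs; of \<open>q\<close> it uses only the block lengths \<open>m\<close>. It splits the
  flat list into blocks, drops those from \<open>a\<close> on and applies \<open>h j\<close> to the
  others.\<close>

lemma project_blocks:
  fixes m :: "nat \<Rightarrow> nat" and h :: "nat \<Rightarrow> 'a list \<Rightarrow> 'b list"
  assumes "a \<le> a'"
  obtains H where "\<And>q. (\<And>j b. j < a' \<Longrightarrow> b \<in> set_pmf (q j) \<Longrightarrow> length b = m j) \<Longrightarrow>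
    map_pmf concat (sequence_pmf (map (\<lambda>j. map_pmf (h j) (q j)) [0..<a]))
      = map_pmf H (map_pmf concat (sequence_pmf (map q [0..<a'])))"
proof -
  define S :: "'a list list set" where "S = {bss. map length bss = map m [0..<a']}"
  define H where "H b = concat (map (\<lambda>j. h j (inv_into S concat b ! j)) [0..<a])" for b
  have "map_pmf concat (sequence_pmf (map (\<lambda>j. map_pmf (h j) (q j)) [0..<a]))
      = map_pmf H (map_pmf concat (sequence_pmf (map q [0..<a'])))"
    if q: "\<And>j b. j < a' \<Longrightarrow> b \<in> set_pmf (q j) \<Longrightarrow> length b = m j" for q
    unfolding sequence_pmf_map_pmf_upt[OF assms] map_pmf_comp
  proof (rule map_pmf_cong[OF refl])
    fix bss assume "bss \<in> set_pmf (sequence_pmf (map q [0..<a']))"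
    then have "bss \<in> S" unfolding S_def by (auto intro!: map_length_sequence[of bss q] q)
    then have "inv_into S concat (concat bss) = bss"
      by (intro inv_into_f_f) (simp_all add: S_def inj_on_concat)
    then show "concat (map (\<lambda>j. h j (bss ! j)) [0..<a]) = H (concat bss)"
      by (simp add: H_def)
  qed
  then show ?thesis by (rule that)
qed

text \<open>What is observed in the smaller tree is a function of what is observed in the larger
  one. As \<open>h\<close> does not depend on \<open>s\<close>, it is a legitimate
  postprocessing.\<close>

lemma generation_append:
  "\<exists>h. \<forall>s. generation_pmf (Suc n) l T s = map_pmf h (generation_pmf (Suc n) l (tree_append T R) s)"
proof (induction l arbitrary: T R)
  case 0
  show ?case by (rule exI[of _ id]) simp
next
  case (Suc l)
  let ?G = "\<lambda>T. generation_pmf (Suc n) l T" and ?T' = "tree_append T R"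
  let ?a = "length (T [])" and ?a' = "length (?T' [])"
  have a: "?a \<le> ?a'" by (simp add: tree_append_def)
  have "\<forall>c. \<exists>h. \<forall>s. ?G (subtree T c) s = map_pmf h (?G (subtree ?T' c) s)"
    unfolding subtree_append using Suc.IH by blast
  then obtain h where h: "\<And>c s. ?G (subtree T c) s = map_pmf (h c) (?G (subtree ?T' c) s)"
    by metis
  \<comment> \<open>The map must not depend on the children's values \<open>y\<close> either, since
    these are hidden.\<close>
  have "\<exists>H. \<forall>y. map_pmf concat (sequence_pmf (map (\<lambda>i. ?G (subtree T (j, i)) (y ! i)) [0..<n]))
      = map_pmf H (map_pmf concat (sequence_pmf (map (\<lambda>i. ?G (subtree ?T' (j, i)) (y ! i)) [0..<n])))" for j
  proof -
    obtain H where H: "\<And>q. (\<And>i b. i < n \<Longrightarrow> b \<in> set_pmf (q i) \<Longrightarrow> length b = gen_length n l (subtree ?T' (j, i))) \<Longrightarrow>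
      map_pmf concat (sequence_pmf (map (\<lambda>i. map_pmf (h (j, i)) (q i)) [0..<n]))
      = map_pmf H (map_pmf concat (sequence_pmf (map q [0..<n])))"
      using project_blocks[OF order.refl, of n "\<lambda>i. gen_length n l (subtree ?T' (j, i))" "\<lambda>i. h (j, i)"]
      by blast
    show ?thesis
      unfolding h
    proof (intro exI allI)
      fix y :: "real list"
      show "map_pmf concat (sequence_pmf (map (\<lambda>i. map_pmf (h (j, i)) (?G (subtree ?T' (j, i)) (y ! i))) [0..<n]))
        = map_pmf H (map_pmf concat (sequence_pmf (map (\<lambda>i. ?G (subtree ?T' (j, i)) (y ! i)) [0..<n])))"
        by (rule H) (rule length_generation)
    qed
  qed
  then have "\<forall>j. \<exists>H. \<forall>y. map_pmf concat (sequence_pmf (map (\<lambda>i. ?G (subtree T (j, i)) (y ! i)) [0..<n]))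
      = map_pmf H (map_pmf concat (sequence_pmf (map (\<lambda>i. ?G (subtree ?T' (j, i)) (y ! i)) [0..<n])))"
    by (rule allI)
  from choice[OF this] obtain K where K: "\<And>j y. map_pmf concat (sequence_pmf (map (\<lambda>i. ?G (subtree T (j, i)) (y ! i)) [0..<n]))
      = map_pmf (K j) (map_pmf concat (sequence_pmf (map (\<lambda>i. ?G (subtree ?T' (j, i)) (y ! i)) [0..<n])))"
    by (elim exE) (rule that, elim allE)
  define q where "q s j = map_pmf concat
     (clause_channel n (?T' [] ! j) (\<lambda>i. ?G (subtree ?T' (j, i))) s)" for s j
  define m where "m j = sum_list (map (\<lambda>i. gen_length n l (subtree ?T' (j, i))) [0..<n])" for j
  have len: "length b = m j" if "b \<in> set_pmf (q s j)" for b j s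
  proof -
    from that obtain bs where bs: "bs \<in> set_pmf (clause_channel n (?T' [] ! j) (\<lambda>i. ?G (subtree ?T' (j, i))) s)"
      "b = concat bs" by (auto simp: q_def)
    then have "map length bs = map (\<lambda>i. gen_length n l (subtree ?T' (j, i))) [0..<n]"
      by (intro map_length_clause_channel length_generation)
    then show ?thesis by (simp add: bs length_concat m_def)
  qed
  have ch: "map_pmf concat (clause_channel n (T [] ! j) (\<lambda>i. ?G (subtree T (j, i))) s) = map_pmf (K j) (q s j)"
    if "j < ?a" for j s
    using that by (simp add: clause_channel_def map_bind_pmf K q_def tree_append_def nth_append)
  obtain H where H: "\<And>q. (\<And>j b. j < ?a' \<Longrightarrow> b \<in> set_pmf (q j) \<Longrightarrow> length b = m j) \<Longrightarrow>
    map_pmf concat (sequence_pmf (map (\<lambda>j. map_pmf (K j) (q j)) [0..<?a]))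
      = map_pmf H (map_pmf concat (sequence_pmf (map q [0..<?a'])))"
    using project_blocks[OF a, of m K] by blast
  have "generation_pmf (Suc n) (Suc l) T s = map_pmf H (generation_pmf (Suc n) (Suc l) ?T' s)" for s
  proof -
    have "map (\<lambda>j. map_pmf concat (clause_channel n (T [] ! j) (\<lambda>i. ?G (subtree T (j, i))) s)) [0..<?a]
        = map (\<lambda>j. map_pmf (K j) (q s j)) [0..<?a]"
      by (simp add: ch)
    moreover have "map_pmf concat (sequence_pmf (map (\<lambda>j. map_pmf (K j) (q s j)) [0..<?a]))
      = map_pmf H (map_pmf concat (sequence_pmf (map (q s) [0..<?a'])))"
      by (rule H) (rule len)
    ultimately show ?thesis unfolding generation_Suc by (simp only: q_def[abs_def])
  qed
  then show ?case by blast
qed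

lemma reconstruction_tv_append:
  "reconstruction_tv (Suc n) l T \<le> reconstruction_tv (Suc n) l (tree_append T R)"
proof -
  obtain h where "\<And>s. generation_pmf (Suc n) l T s = map_pmf h (generation_pmf (Suc n) l (tree_append T R) s)"
    using generation_append by blast
  then have "generation_pmf (Suc n) l T = (\<lambda>s. map_pmf h (generation_pmf (Suc n) l (tree_append T R) s))"
    by (intro ext)
  then show ?thesis unfolding reconstruction_tv_eq by (simp add: coupled_tv_map_le)
qed

section \<open>Measurability\<close>

lemma measurable_nn_integral_count_space:
  assumes B: "countable B" and f: "\<And>b. b \<in> B \<Longrightarrow> f b \<in> borel_measurable N"
  shows "(\<lambda>\<omega>. \<integral>\<^sup>+b. f b \<omega> \<partial>count_space B) \<in> borel_measurable N"
proof -
  interpret sigma_finite_measure "count_space B"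
    using B by (rule sigma_finite_measure_count_space_countable)
  have "(\<lambda>x. f (snd x) (fst x)) \<in> borel_measurable (N \<Otimes>\<^sub>M count_space B)"
    by (rule measurable_compose_countable'[where I = B])
      (auto intro: B measurable_compose[OF measurable_fst f])
  then show ?thesis
    by (intro borel_measurable_nn_integral) (simp add: case_prod_unfold)
qed

text \<open>Asking for measurability of every point mass avoids a sigma-algebra on the type of
  distributions.\<close>

definition pmf_measurable :: "'w measure \<Rightarrow> ('w \<Rightarrow> 'a pmf) \<Rightarrow> bool" where
  "pmf_measurable N Q \<longleftrightarrow> (\<forall>b. (\<lambda>\<omega>. pmf (Q \<omega>) b) \<in> borel_measurable N)"

lemma pmf_measurableD: "pmf_measurable N Q \<Longrightarrow> (\<lambda>\<omega>. pmf (Q \<omega>) b) \<in> borel_measurable N"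
  by (simp add: pmf_measurable_def)

lemma pmf_measurable_const: "pmf_measurable N (\<lambda>_. q)"
  by (simp add: pmf_measurable_def)

lemma pmf_measurable_compose:
  "g \<in> measurable N' N \<Longrightarrow> pmf_measurable N Q \<Longrightarrow> pmf_measurable N' (\<lambda>\<omega>. Q (g \<omega>))"
  unfolding pmf_measurable_def using measurable_compose[of g N' N] by blast

lemma pmf_measurable_bind:
  assumes "\<And>y. pmf_measurable N (R y)"
  shows "pmf_measurable N (\<lambda>\<omega>. bind_pmf q (\<lambda>y. R y \<omega>))"
  unfolding pmf_measurable_def
proof
  fix b
  have "(\<lambda>\<omega>. enn2real (\<integral>\<^sup>+y. ennreal (pmf q y) * ennreal (pmf (R y \<omega>) b) \<partial>count_space (set_pmf q)))
      \<in> borel_measurable N"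
    by (intro measurable_nn_integral_count_space[THEN measurable_compose[OF _ borel_measurable_enn2real]]
        borel_measurable_times_ennreal measurable_compose[OF pmf_measurableD[OF assms] measurable_ennreal])
      auto
  also have "(\<lambda>\<omega>. enn2real (\<integral>\<^sup>+y. ennreal (pmf q y) * ennreal (pmf (R y \<omega>) b) \<partial>count_space (set_pmf q)))
      = (\<lambda>\<omega>. pmf (bind_pmf q (\<lambda>y. R y \<omega>)) b)"
  proof
    fix \<omega>
    have "ennreal (pmf (bind_pmf q (\<lambda>y. R y \<omega>)) b)
        = (\<integral>\<^sup>+y. ennreal (pmf q y) * ennreal (pmf (R y \<omega>) b) \<partial>count_space UNIV)"
      by (simp add: ennreal_pmf_bind nn_integral_measure_pmf)
    also have "\<dots> = (\<integral>\<^sup>+y. ennreal (pmf q y) * ennreal (pmf (R y \<omega>) b) \<partial>count_space (set_pmf q))"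
      by (rule nn_integral_count_space_eq) (auto simp: pmf_eq_0_set_pmf)
    finally show "enn2real (\<integral>\<^sup>+y. ennreal (pmf q y) * ennreal (pmf (R y \<omega>) b) \<partial>count_space (set_pmf q))
      = pmf (bind_pmf q (\<lambda>y. R y \<omega>)) b" by (metis enn2real_ennreal pmf_nonneg)
  qed
  finally show "(\<lambda>\<omega>. pmf (bind_pmf q (\<lambda>y. R y \<omega>)) b) \<in> borel_measurable N" .
qed

lemma pmf_measurable_sequence:
  assumes "\<And>j. j \<in> set js \<Longrightarrow> pmf_measurable N (Q j)"
  shows "pmf_measurable N (\<lambda>\<omega>. sequence_pmf (map (\<lambda>j. Q j \<omega>) js))"
  using assms
proof (induction js)
  case (Cons j js)
  show ?case
    unfolding pmf_measurable_def
  proof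
    fix b
    show "(\<lambda>\<omega>. pmf (sequence_pmf (map (\<lambda>j. Q j \<omega>) (j # js))) b) \<in> borel_measurable N"
      using Cons by (cases b) (auto simp: pmf_sequence_Nil pmf_sequence_Cons
          intro!: borel_measurable_times pmf_measurableD)
  qed
qed (simp add: pmf_measurable_const)

text \<open>Only finitely many lists of \<open>m\<close> blocks concatenate to \<open>b\<close>, so
  its mass is a finite sum. The number of blocks has to be fixed: empty blocks would make the fibre
  infinite.\<close>

lemma pmf_measurable_map_concat:
  assumes Q: "pmf_measurable N Q" and len: "\<And>\<omega> bs. bs \<in> set_pmf (Q \<omega>) \<Longrightarrow> length bs = m"
  shows "pmf_measurable N (\<lambda>\<omega>. map_pmf concat (Q \<omega>))"
  unfolding pmf_measurable_def
proof
  fix b :: "'b list"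
  define F where "F = {bss. set bss \<subseteq> {xs. set xs \<subseteq> set b \<and> length xs \<le> length b} \<and> length bss = m}
    \<inter> {bss. concat bss = b}"
  have fin: "finite F"
    unfolding F_def by (intro finite_Int disjI1 finite_lists_length_eq finite_lists_length_le) simp
  have len_le: "length xs \<le> length (concat bss)" if "xs \<in> set bss" for xs and bss :: "'b list list"
    using that by (induction bss) auto
  have "pmf (map_pmf concat (Q \<omega>)) b = (\<Sum>bss\<in>F. pmf (Q \<omega>) bss)" for \<omega>
  proof -
    have "concat -` {b} \<inter> set_pmf (Q \<omega>) = F \<inter> set_pmf (Q \<omega>)"
      using len len_le by (fastforce simp: F_def)
    then have "pmf (map_pmf concat (Q \<omega>)) b = measure_pmf.prob (Q \<omega>) (F \<inter> set_pmf (Q \<omega>))"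
      by (simp add: pmf_map flip: measure_Int_set_pmf[of _ "concat -` {b}"])
    then show ?thesis by (simp add: measure_Int_set_pmf measure_measure_pmf_finite[OF fin])
  qed
  then show "(\<lambda>\<omega>. pmf (map_pmf concat (Q \<omega>)) b) \<in> borel_measurable N"
    using Q by (simp only: borel_measurable_sum pmf_measurableD)
qed

lemma pmf_measurable_Pair:
  assumes "pmf_measurable N Q"
  shows "pmf_measurable N (\<lambda>\<omega>. map_pmf (Pair s) (Q \<omega>))"
  unfolding pmf_measurable_def
proof
  fix b
  have "pmf (map_pmf (Pair s) (Q \<omega>)) b = (if fst b = s then pmf (Q \<omega>) (snd b) else 0)" for \<omega>
  proof (cases "fst b = s")
    case True
    then have "b = Pair s (snd b)" by auto
    then have "pmf (map_pmf (Pair s) (Q \<omega>)) b = pmf (map_pmf (Pair s) (Q \<omega>)) (Pair s (snd b))" by simp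
    also have "\<dots> = pmf (Q \<omega>) (snd b)" by (rule pmf_map_inj') (auto simp: inj_def)
    finally show ?thesis using True by simp
  next
    case False
    then show ?thesis by (auto simp: pmf_eq_0_set_pmf)
  qed
  then show "(\<lambda>\<omega>. pmf (map_pmf (Pair s) (Q \<omega>)) b) \<in> borel_measurable N"
    using pmf_measurableD[OF assms, of "snd b"] by (cases "fst b = s") simp_all
qed

lemma nn_integral_measure_pmf_superset:
  "set_pmf P \<subseteq> B \<Longrightarrow> (\<integral>\<^sup>+b. f b \<partial>measure_pmf P) = (\<integral>\<^sup>+b. ennreal (pmf P b) * f b \<partial>count_space B)"
  unfolding nn_integral_measure_pmf
  by (rule nn_integral_count_space_eq) (auto simp: pmf_eq_0_set_pmf)

text \<open>One countable set contains all supports, which turns integration against varying laws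
  into a fixed countable sum.\<close>

lemma measurable_expectation_density:
  fixes h :: "real \<Rightarrow> real \<Rightarrow> real"
  assumes PQ: "pmf_measurable N P" "pmf_measurable N Q"
    and B: "countable B" "\<And>\<omega>. set_pmf (P \<omega>) \<subseteq> B"
    and h: "case_prod h \<in> borel_measurable (borel \<Otimes>\<^sub>M borel)" "\<And>x y. 0 \<le> h x y"
  shows "(\<lambda>\<omega>. measure_pmf.expectation (P \<omega>) (\<lambda>b. h (pmf (P \<omega>) b) (pmf (Q \<omega>) b))) \<in> borel_measurable N"
proof -
  have "(\<lambda>\<omega>. case_prod h (pmf (P \<omega>) b, pmf (Q \<omega>) b)) \<in> borel_measurable N" for b
    by (rule measurable_compose[OF measurable_Pair[OF pmf_measurableD[OF PQ(1)] pmf_measurableD[OF PQ(2)]] h(1)])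
  then have hm: "(\<lambda>\<omega>. ennreal (h (pmf (P \<omega>) b) (pmf (Q \<omega>) b))) \<in> borel_measurable N" for b
    by simp
  have "(\<lambda>\<omega>. enn2real (\<integral>\<^sup>+b. ennreal (pmf (P \<omega>) b) * ennreal (h (pmf (P \<omega>) b) (pmf (Q \<omega>) b)) \<partial>count_space B))
      \<in> borel_measurable N"
    by (intro measurable_nn_integral_count_space[THEN measurable_compose[OF _ borel_measurable_enn2real]]
        borel_measurable_times_ennreal measurable_compose[OF pmf_measurableD[OF PQ(1)] measurable_ennreal] hm B)
      auto
  then show ?thesis
    by (subst integral_eq_nn_integral) (auto simp: h(2) nn_integral_measure_pmf_superset[OF B(2)])
qed

lemma info_measurable:
  assumes "pmf_measurable N (\<lambda>\<omega>. W \<omega> 1)" "pmf_measurable N (\<lambda>\<omega>. W \<omega> (-1))"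
    and "countable B" "\<And>\<omega>. set_pmf (W \<omega> 1) \<subseteq> B"
  shows "(\<lambda>\<omega>. info (W \<omega>)) \<in> borel_measurable N"
proof -
  \<comment> \<open>The guard makes the integrand nonnegative for all real arguments; for point
    masses it always holds.\<close>
  have "(\<lambda>\<omega>. measure_pmf.expectation (W \<omega> 1) (\<lambda>b. (\<lambda>x y. if 0 \<le> x \<and> 0 \<le> y then 2 * y / (x + y) else 0)
      (pmf (W \<omega> 1) b) (pmf (W \<omega> (-1)) b))) \<in> borel_measurable N"
    by (rule measurable_expectation_density[OF assms]) (auto simp: case_prod_unfold)
  then show ?thesis
    unfolding info_def overlap_def by (intro borel_measurable_diff) auto
qed

lemma undetermined_measurable:
  assumes "pmf_measurable N (\<lambda>\<omega>. W \<omega> 1)" "pmf_measurable N (\<lambda>\<omega>. W \<omega> (-1))"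
    and "countable B" "\<And>\<omega>. set_pmf (W \<omega> 1) \<subseteq> B"
  shows "(\<lambda>\<omega>. undetermined (W \<omega>)) \<in> borel_measurable N"
proof -
  have "(\<lambda>\<omega>. measure_pmf.expectation (W \<omega> 1) (\<lambda>b. (\<lambda>x y. indicator {0<..} y :: real)
      (pmf (W \<omega> 1) b) (pmf (W \<omega> (-1)) b))) \<in> borel_measurable N"
  proof -
    have "case_prod (\<lambda>x y. indicator {0<..} y :: real) \<in> borel_measurable (borel \<Otimes>\<^sub>M (borel :: real measure))"
      by (simp add: case_prod_unfold)
    from measurable_expectation_density[OF assms this] show ?thesis by simp
  qed
  also have "(\<lambda>\<omega>. measure_pmf.expectation (W \<omega> 1) (\<lambda>b. (\<lambda>x y. indicator {0<..} y :: real)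
      (pmf (W \<omega> 1) b) (pmf (W \<omega> (-1)) b))) = (\<lambda>\<omega>. undetermined (W \<omega>))"
  proof
    fix \<omega>
    have "(\<lambda>b. indicator {0<..} (pmf (W \<omega> (-1)) b)) = (indicator (set_pmf (W \<omega> (-1))) :: _ \<Rightarrow> real)"
      by (auto simp: fun_eq_iff indicator_def pmf_positive_iff)
    then show "measure_pmf.expectation (W \<omega> 1) (\<lambda>b. (\<lambda>x y. indicator {0<..} y :: real)
      (pmf (W \<omega> 1) b) (pmf (W \<omega> (-1)) b)) = undetermined (W \<omega>)"
      by (simp add: undetermined_def)
  qed
  finally show ?thesis .
qed

text \<open>The supremum over all events is attained where \<open>pmf q b < pmf p b\<close>. The
  resulting sum over points, unlike the supremum, is visibly measurable in both laws.\<close>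

lemma tv_dist_eq_nn_integral:
  "ennreal (tv_dist p q) = (\<integral>\<^sup>+b. ennreal (pmf p b - pmf q b) \<partial>count_space UNIV)" (is "_ = ?X")
proof -
  have split: "ennreal (pmf p b) \<le> ennreal (pmf q b) + ennreal (pmf p b - pmf q b)" for b
    by (cases "pmf p b \<le> pmf q b") (auto simp: ennreal_neg ennreal_leI simp flip: ennreal_plus)
  have le: "emeasure (measure_pmf p) A \<le> emeasure (measure_pmf q) A + ?X" for A
  proof -
    have "emeasure (measure_pmf p) A \<le> (\<integral>\<^sup>+b. ennreal (pmf q b) + ennreal (pmf p b - pmf q b) \<partial>count_space A)"
      unfolding nn_integral_pmf[symmetric] by (intro nn_integral_mono split)
    also have "\<dots> = emeasure (measure_pmf q) A + (\<integral>\<^sup>+b. ennreal (pmf p b - pmf q b) \<partial>count_space A)"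
      by (subst nn_integral_add) (auto simp: nn_integral_pmf)
    also have "(\<integral>\<^sup>+b. ennreal (pmf p b - pmf q b) \<partial>count_space A) \<le> ?X"
      by (subst nn_integral_count_space_indicator) (auto intro!: nn_integral_mono simp: indicator_def)
    finally show ?thesis by simp
  qed
  define A where "A = {b. pmf q b < pmf p b}"
  have eq: "emeasure (measure_pmf p) A = emeasure (measure_pmf q) A + ?X"
  proof -
    have "emeasure (measure_pmf p) A = (\<integral>\<^sup>+b. ennreal (pmf q b) + ennreal (pmf p b - pmf q b) \<partial>count_space A)"
      unfolding nn_integral_pmf[symmetric]
      by (intro nn_integral_cong) (auto simp: A_def simp flip: ennreal_plus)
    also have "\<dots> = emeasure (measure_pmf q) A + (\<integral>\<^sup>+b. ennreal (pmf p b - pmf q b) \<partial>count_space A)"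
      by (subst nn_integral_add) (auto simp: nn_integral_pmf)
    also have "(\<integral>\<^sup>+b. ennreal (pmf p b - pmf q b) \<partial>count_space A) = ?X"
      by (rule nn_integral_count_space_eq) (auto simp: A_def ennreal_neg)
    finally show ?thesis .
  qed
  have "?X \<le> emeasure (measure_pmf p) A" unfolding eq by simp
  also have "\<dots> \<le> 1" by (rule measure_pmf.emeasure_le_1)
  finally have fin: "?X < \<top>" by (simp add: order_le_less_trans)
  define x where "x = enn2real ?X"
  have X: "?X = ennreal x" "0 \<le> x" using fin by (auto simp: x_def)
  have le': "measure_pmf.prob p A \<le> measure_pmf.prob q A + x" for A
    using le[of A] X(2) unfolding X measure_pmf.emeasure_eq_measure
    by (simp add: ennreal_le_iff flip: ennreal_plus)
  have eq': "measure_pmf.prob p A = measure_pmf.prob q A + x"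
    using eq X(2) unfolding X measure_pmf.emeasure_eq_measure
    by (simp flip: ennreal_plus)
  have "tv_dist p q = x"
  proof (rule antisym)
    show "tv_dist p q \<le> x"
    proof (rule tv_dist_le)
      fix A
      \<comment> \<open>The complement of \<open>A\<close> takes care of the opposite sign inside
        the absolute value.\<close>
      show "\<bar>measure_pmf.prob p A - measure_pmf.prob q A\<bar> \<le> x"
        using le'[of A] le'[of "- A"] measure_pmf.prob_compl[of A p] measure_pmf.prob_compl[of A q]
        by (simp add: Compl_eq_Diff_UNIV)
    qed
    show "x \<le> tv_dist p q" using tv_dist_ge[of p A q] eq' by simp
  qed
  with X show ?thesis by simp
qed

lemma tv_dist_measurable:
  assumes PQ: "pmf_measurable N P" "pmf_measurable N Q"
    and B: "countable B" "\<And>\<omega>. set_pmf (P \<omega>) \<subseteq> B"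
  shows "(\<lambda>\<omega>. tv_dist (P \<omega>) (Q \<omega>)) \<in> borel_measurable N"
proof -
  have "(\<lambda>\<omega>. enn2real (\<integral>\<^sup>+b. ennreal (pmf (P \<omega>) b - pmf (Q \<omega>) b) \<partial>count_space B)) \<in> borel_measurable N"
    by (intro measurable_nn_integral_count_space[THEN measurable_compose[OF _ borel_measurable_enn2real]] B
        measurable_compose[OF borel_measurable_diff[OF pmf_measurableD[OF PQ(1)] pmf_measurableD[OF PQ(2)]] measurable_ennreal])
      auto
  also have "(\<lambda>\<omega>. enn2real (\<integral>\<^sup>+b. ennreal (pmf (P \<omega>) b - pmf (Q \<omega>) b) \<partial>count_space B)) = (\<lambda>\<omega>. tv_dist (P \<omega>) (Q \<omega>))"
  proof
    fix \<omega>
    have "(\<integral>\<^sup>+b. ennreal (pmf (P \<omega>) b - pmf (Q \<omega>) b) \<partial>count_space B)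
        = (\<integral>\<^sup>+b. ennreal (pmf (P \<omega>) b - pmf (Q \<omega>) b) \<partial>count_space UNIV)"
    proof -
      have "pmf (P \<omega>) b = 0" if "b \<notin> B" for b
        using that B(2)[of \<omega>] by (auto simp: pmf_eq_0_set_pmf)
      then show ?thesis by (intro nn_integral_count_space_eq) (auto simp: ennreal_neg)
    qed
    then show "enn2real (\<integral>\<^sup>+b. ennreal (pmf (P \<omega>) b - pmf (Q \<omega>) b) \<partial>count_space B) = tv_dist (P \<omega>) (Q \<omega>)"
      by (simp add: tv_dist_nonneg flip: tv_dist_eq_nn_integral)
  qed
  finally show ?thesis .
qed

lemma coupled_tv_measurable:
  assumes W: "\<And>s. pmf_measurable N (\<lambda>\<omega>. W \<omega> s)"
    and B: "countable B" "\<And>\<omega>. set_pmf (W \<omega> 1) \<subseteq> B" "\<And>\<omega>. set_pmf (W \<omega> (-1)) \<subseteq> B"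
  shows "(\<lambda>\<omega>. coupled_tv (W \<omega>)) \<in> borel_measurable N"
proof -
  have "coupled_tv V = tv_dist (bind_pmf (pmf_of_set {-1, 1}) (\<lambda>s. map_pmf (Pair s) (V s)))
    (bind_pmf (pmf_of_set {-1, 1}) (\<lambda>s. map_pmf (Pair s) (bind_pmf (pmf_of_set {-1, 1}) V)))"
    for V :: "real \<Rightarrow> 'b pmf"
    unfolding coupled_tv_def Let_def
    by (rule arg_cong[of _ _ "tv_dist _"])
      (simp add: pair_pmf_def map_pmf_def bind_assoc_pmf bind_return_pmf)
  moreover have "(\<lambda>\<omega>. tv_dist (bind_pmf (pmf_of_set {-1, 1}) (\<lambda>s. map_pmf (Pair s) (W \<omega> s)))
    (bind_pmf (pmf_of_set {-1, 1}) (\<lambda>s. map_pmf (Pair s) (bind_pmf (pmf_of_set {-1, 1}) (W \<omega>))))) \<in> borel_measurable N"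
    by (rule tv_dist_measurable[where B = "{-1, 1} \<times> B"])
      (use B in \<open>auto intro!: pmf_measurable_bind pmf_measurable_Pair W\<close>)
  ultimately show ?thesis by simp
qed

text \<open>A clause without satisfying completion samples its children from the unspecified
  distribution \<open>pmf_of_set {}\<close>. Such trees form a null set, but a function that is not measurable
  everywhere would have integral 0, so measurability has to be shown on these trees as well.\<close>

definition possible_signs :: "real set" where
  "possible_signs = {-1, 1} \<union> (\<Union>y\<in>set_pmf (pmf_of_set {}). range (\<lambda>i. y ! i))"

lemma countable_possible_signs: "countable possible_signs"
  unfolding possible_signs_def by (intro countable_Un countable_UN) auto

lemma possible_signs_children:
  "y \<in> set_pmf (children_pmf (Suc n) \<phi> s) \<Longrightarrow> i < n \<Longrightarrow> y ! i \<in> possible_signs"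
proof (cases "{y \<in> cube n. \<phi> (s # y) = 1} = {}")
  case True
  assume "y \<in> set_pmf (children_pmf (Suc n) \<phi> s)"
  then have "y \<in> set_pmf (pmf_of_set {})" unfolding children_pmf_def diff_Suc_1 True .
  then show ?thesis by (auto simp: possible_signs_def)
next
  case False
  assume "y \<in> set_pmf (children_pmf (Suc n) \<phi> s)" "i < n"
  moreover from False have "set_pmf (children_pmf (Suc n) \<phi> s) = {y \<in> cube n. \<phi> (s # y) = 1}"
    unfolding children_pmf_def diff_Suc_1 by (intro set_pmf_of_set) auto
  ultimately show ?thesis using cube_nth[of y n i]
    by (auto simp: possible_signs_def)
qed

lemma set_clause_channel_subset:
  assumes "\<And>i t. i < n \<Longrightarrow> t \<in> possible_signs \<Longrightarrow> set_pmf (W i t) \<subseteq> B"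
  shows "set_pmf (clause_channel n \<phi> W s) \<subseteq> lists B"
proof
  fix bs assume "bs \<in> set_pmf (clause_channel n \<phi> W s)"
  then obtain y where "y \<in> set_pmf (children_pmf (Suc n) \<phi> s)"
    "list_all2 (\<lambda>i x. x \<in> set_pmf (W i (y ! i))) [0..<n] bs"
    by (auto simp: clause_channel_def set_sequence_pmf)
  then show "bs \<in> lists B"
    using assms possible_signs_children
    by (fastforce simp: list_all2_conv_all_nth in_set_conv_nth lists_eq_set)
qed

lemma set_generation_subset:
  "s \<in> possible_signs \<Longrightarrow> set_pmf (generation_pmf (Suc n) l T s) \<subseteq> lists possible_signs"
proof (induction l arbitrary: T s)
  case (Suc l)
  show ?case
  proof
    fix b assume "b \<in> set_pmf (generation_pmf (Suc n) (Suc l) T s)"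
    then obtain bss where b: "b = concat bss" and bss: "list_all2 (\<lambda>j x. x \<in> set_pmf (map_pmf concat
      (clause_channel n (T [] ! j) (\<lambda>i. generation_pmf (Suc n) l (subtree T (j, i))) s))) [0..<length (T [])] bss"
      by (auto simp: generation_Suc set_sequence_pmf)
    have "c \<in> lists possible_signs" if "c \<in> set bss" for c
    proof -
      from that obtain j where j: "j < length bss" "c = bss ! j" by (auto simp: in_set_conv_nth)
      with bss have "c \<in> set_pmf (map_pmf concat
        (clause_channel n (T [] ! j) (\<lambda>i. generation_pmf (Suc n) l (subtree T (j, i))) s))"
        by (simp add: list_all2_conv_all_nth)
      moreover have "set_pmf (clause_channel n (T [] ! j) (\<lambda>i. generation_pmf (Suc n) l (subtree T (j, i))) s)
          \<subseteq> lists (lists possible_signs)"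
        by (rule set_clause_channel_subset) (rule Suc.IH)
      ultimately show ?thesis by fastforce
    qed
    then show "b \<in> lists possible_signs" by (fastforce simp: b)
  qed
qed simp

text \<open>The discrete product sigma-algebra is shared by all \<open>\<alpha>\<close> and
  \<open>p\<close> (see \<open>sets_tCSP\<close>), so measurability is proved only once.\<close>

abbreviation tree_space :: "('i \<Rightarrow> clause list) measure" where
  "tree_space \<equiv> PiM UNIV (\<lambda>_. count_space UNIV)"

lemma measurable_reindex:
  "(\<lambda>T v. T (r v)) \<in> measurable (PiM UNIV (\<lambda>_. M)) (PiM UNIV (\<lambda>_. M))"
  by (rule measurable_PiM_single') (auto simp: space_PiM PiE_iff)

lemma measurable_subtree: "(\<lambda>T. subtree T c) \<in> measurable tree_space tree_space"
  unfolding subtree_def by (rule measurable_reindex)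

lemma pmf_measurable_clause_channel:
  assumes "\<And>i t. i < n \<Longrightarrow> pmf_measurable N (\<lambda>\<omega>. W \<omega> i t)"
  shows "pmf_measurable N (\<lambda>\<omega>. clause_channel n \<phi> (W \<omega>) s)"
  unfolding clause_channel_def
  by (intro pmf_measurable_bind pmf_measurable_sequence assms) auto

lemma pmf_measurable_generation: "pmf_measurable tree_space (\<lambda>T. generation_pmf (Suc n) l T s)"
proof (induction l arbitrary: s)
  case 0
  show ?case by (simp add: pmf_measurable_const)
next
  case (Suc l)
  define D where "D c j T = bind_pmf (pmf_of_set (c ! j)) (\<lambda>y. sequence_pmf
    (map (\<lambda>i. generation_pmf (Suc n) l (subtree T (j, i)) (y ! i)) [0..<n]))"
    for c :: "real list set list" and j T
  define H where "H c T = map_pmf concat (sequence_pmf (map (\<lambda>j. map_pmf concat (D c j T)) [0..<length c]))"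
    for c T
  \<comment> \<open>Root labels range over an uncountable type, but the law depends on the root
    label only through the completion sets of its clauses; \<open>code\<close> records these and
    takes countably many values.\<close>
  define code where "code T = map (\<lambda>\<phi>. {y \<in> cube n. \<phi> (s # y) = 1}) (T [])" for T :: ctree
  define I where "I = lists (Pow (cube n))"
  have I: "countable I" unfolding I_def by (intro countable_lists countable_finite) simp
  have eq: "generation_pmf (Suc n) (Suc l) T s = H (code T) T" for T
    unfolding generation_Suc H_def D_def
    by (auto simp: code_def clause_channel_def children_pmf_def
        intro!: arg_cong[of _ _ sequence_pmf] arg_cong[of _ _ "map_pmf concat"])
  have root: "(\<lambda>T. T []) \<in> measurable tree_space (count_space UNIV)"
    by (rule measurable_component_singleton) simp
  have code: "code \<in> measurable tree_space (count_space I)"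
  proof -
    have "(\<lambda>cl. map (\<lambda>\<phi>. {y \<in> cube n. \<phi> (s # y) = 1}) cl) \<in> measurable (count_space UNIV) (count_space I)"
      by (auto simp: I_def)
    from measurable_compose[OF root this] show ?thesis by (simp add: code_def[abs_def])
  qed
  have Hm: "pmf_measurable tree_space (H c)" for c
  proof -
    have D: "pmf_measurable tree_space (D c j)" for j
      unfolding D_def[abs_def]
      by (intro pmf_measurable_bind pmf_measurable_sequence
          pmf_measurable_compose[OF measurable_subtree Suc.IH])
    have "pmf_measurable tree_space (\<lambda>T. map_pmf concat (D c j T))" for j
      by (rule pmf_measurable_map_concat[OF D, of _ n])
        (auto simp: D_def dest: length_sequence_pmf)
    then show ?thesis
      unfolding H_def[abs_def]
      by (rule pmf_measurable_map_concat[where m = "length c", OF pmf_measurable_sequence])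
        (auto dest: length_sequence_pmf)
  qed
  show ?case
    unfolding pmf_measurable_def eq
    using measurable_compose_countable'[OF _ code I, of "\<lambda>c T. pmf (H c T) b" borel for b]
    by (blast intro: pmf_measurableD[OF Hm])
qed

lemma reconstruction_tv_measurable: "reconstruction_tv (Suc n) l \<in> borel_measurable tree_space"
  unfolding reconstruction_tv_eq[abs_def]
  by (rule coupled_tv_measurable[where B = "lists possible_signs"])
    (auto intro!: pmf_measurable_generation countable_possible_signs
      simp: set_generation_subset possible_signs_def[THEN eqset_imp_iff])

section \<open>Independent blocks of a product measure\<close>

text \<open>Restrictions of an independent family to disjoint index sets are independent, and the
  injective reindexing \<open>r j\<close> turns each restriction into a copy of the same product
  measure.\<close>

lemma integral_PiM_blocks:
  fixes Q :: "'a measure" and r :: "'j \<Rightarrow> 'k \<Rightarrow> 'i" and F :: "'j \<Rightarrow> ('k \<Rightarrow> 'a) \<Rightarrow> real"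
  assumes Q: "prob_space Q" and J: "finite J"
    and r: "\<And>j. j \<in> J \<Longrightarrow> inj (r j)" "disjoint_family_on (\<lambda>j. range (r j)) J"
    and F: "\<And>j. j \<in> J \<Longrightarrow> F j \<in> borel_measurable (PiM UNIV (\<lambda>_. Q))"
    and bound: "\<And>j x. j \<in> J \<Longrightarrow> \<bar>F j x\<bar> \<le> B"
  shows "(\<integral>T. (\<Prod>j\<in>J. F j (\<lambda>v. T (r j v))) \<partial>PiM UNIV (\<lambda>_. Q))
    = (\<Prod>j\<in>J. \<integral>X. F j X \<partial>PiM UNIV (\<lambda>_. Q))"
proof -
  define P where "P = PiM (UNIV :: 'i set) (\<lambda>_. Q)"
  interpret P: prob_space P unfolding P_def by (intro prob_space_PiM Q)
  have comp: "(\<lambda>T. T i) \<in> measurable P Q" for i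
    unfolding P_def by (rule measurable_component_singleton) simp
  have "P.indep_vars (\<lambda>_. Q) (\<lambda>i T. T i) UNIV"
  proof (subst P.indep_vars_iff_distr_eq_PiM)
    have "distr P Q (\<lambda>x. x i) = Q" for i
      unfolding P_def by (rule distr_PiM_component) (auto intro: Q)
    then show "distr P (Pi\<^sub>M UNIV (\<lambda>_. Q)) (\<lambda>x. \<lambda>i\<in>UNIV. x i) = Pi\<^sub>M UNIV (\<lambda>i. distr P Q (\<lambda>x. x i))"
      by (simp add: P_def restrict_def distr_id2)
  qed (auto intro: comp)
  then have "P.indep_vars (\<lambda>j. PiM (range (r j)) (\<lambda>_. Q)) (\<lambda>j \<omega>. restrict (\<lambda>i. \<omega> i) (range (r j))) J"
    using r by (intro P.indep_vars_restrict) auto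
  then have "P.indep_vars (\<lambda>_. borel) (\<lambda>j \<omega>. (\<lambda>T. F j (\<lambda>v. T (r j v))) (restrict (\<lambda>i. \<omega> i) (range (r j)))) J"
  proof (rule P.indep_vars_compose2)
    fix j assume "j \<in> J"
    have "(\<lambda>T v. T (r j v)) \<in> measurable (PiM (range (r j)) (\<lambda>_. Q)) (PiM UNIV (\<lambda>_. Q))"
      by (rule measurable_PiM_single') (auto simp: space_PiM PiE_iff)
    from measurable_compose[OF this F[OF \<open>j \<in> J\<close>]]
    show "(\<lambda>T. F j (\<lambda>v. T (r j v))) \<in> borel_measurable (PiM (range (r j)) (\<lambda>_. Q))" .
  qed
  then have ind: "P.indep_vars (\<lambda>_. borel) (\<lambda>j T. F j (\<lambda>v. T (r j v))) J"
    by simp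
  have meas: "(\<lambda>T. F j (\<lambda>v. T (r j v))) \<in> borel_measurable P" if "j \<in> J" for j
    unfolding P_def by (rule measurable_compose[OF measurable_reindex F[OF that]])
  have "(\<integral>T. (\<Prod>j\<in>J. F j (\<lambda>v. T (r j v))) \<partial>P) = (\<Prod>j\<in>J. \<integral>T. F j (\<lambda>v. T (r j v)) \<partial>P)"
    using ind J meas bound
    by (intro P.indep_vars_lebesgue_integral) (auto intro!: P.integrable_const_bound[of _ B])
  also have "\<dots> = (\<Prod>j\<in>J. \<integral>X. F j X \<partial>PiM UNIV (\<lambda>_. Q))"
  proof (rule prod.cong[OF refl])
    fix j assume j: "j \<in> J"
    have "distr P (PiM UNIV (\<lambda>_. Q)) (\<lambda>T. \<lambda>v\<in>UNIV. T (r j v)) = PiM UNIV (\<lambda>_. Q)"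
      unfolding P_def using r(1)[OF j] Q by (intro distr_PiM_reindex) auto
    then have "(\<integral>X. F j X \<partial>PiM UNIV (\<lambda>_. Q)) = (\<integral>X. F j X \<partial>distr P (PiM UNIV (\<lambda>_. Q)) (\<lambda>T v. T (r j v)))"
      by (simp add: restrict_def)
    also have "\<dots> = (\<integral>T. F j (\<lambda>v. T (r j v)) \<partial>P)"
      unfolding P_def by (rule integral_distr[OF measurable_reindex F[OF j]])
    finally show "(\<integral>T. F j (\<lambda>v. T (r j v)) \<partial>P) = (\<integral>X. F j X \<partial>PiM UNIV (\<lambda>_. Q))" by simp
  qed
  finally show ?thesis by (simp add: P_def)
qed

section \<open>Poisson offspring\<close>

lemma nn_integral_replicate_pmf:
  assumes "finite (set_pmf p)" "\<And>x. 0 \<le> a x"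
  shows "(\<integral>\<^sup>+xs. ennreal (prod_list (map a xs)) \<partial>replicate_pmf m p)
    = ennreal (measure_pmf.expectation p a ^ m)"
proof (induction m)
  case (Suc m)
  have a: "0 \<le> prod_list (map a xs)" for xs using assms(2) by (induction xs) auto
  have E: "0 \<le> measure_pmf.expectation p a"
    using assms(2) by (intro Bochner_Integration.integral_nonneg) auto
  have "(\<integral>\<^sup>+xs. ennreal (prod_list (map a xs)) \<partial>replicate_pmf (Suc m) p)
      = (\<integral>\<^sup>+x. \<integral>\<^sup>+xs. ennreal (a x) * ennreal (prod_list (map a xs)) \<partial>replicate_pmf m p \<partial>p)"
    by (simp add: ennreal_mult assms(2) a)
  also have "\<dots> = (\<integral>\<^sup>+x. ennreal (a x) \<partial>p) * ennreal (measure_pmf.expectation p a ^ m)"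
    by (simp add: nn_integral_cmult nn_integral_multc Suc)
  also have "(\<integral>\<^sup>+x. ennreal (a x) \<partial>p) = ennreal (measure_pmf.expectation p a)"
    using assms by (intro nn_integral_eq_integral integrable_measure_pmf_finite) auto
  finally show ?case using E by (simp add: ennreal_mult)
qed simp

lemma nn_integral_poisson_power:
  assumes "0 < r" "0 \<le> x"
  shows "(\<integral>\<^sup>+m. ennreal (x ^ m) \<partial>poisson_pmf r) = ennreal (exp (r * (x - 1)))"
proof -
  have "(\<lambda>m. exp (- r) * ((r * x) ^ m /\<^sub>R fact m)) sums (exp (- r) * exp (r * x))"
    by (intro sums_mult exp_converges)
  then have sums: "(\<lambda>m. r ^ m / fact m * exp (- r) * x ^ m) sums exp (r * (x - 1))"
    by (simp add: mult_exp_exp right_diff_distrib power_mult_distrib field_simps)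
  have "(\<integral>\<^sup>+m. ennreal (x ^ m) \<partial>poisson_pmf r)
      = (\<Sum>m. ennreal (r ^ m / fact m * exp (- r) * x ^ m))"
    using assms by (simp add: nn_integral_measure_pmf nn_integral_count_space_nat flip: ennreal_mult)
  also have "\<dots> = ennreal (exp (r * (x - 1)))"
    using sums assms by (intro suminf_ennreal_eq) auto
  finally show ?thesis .
qed

text \<open>A mean product over a Poisson number of independent clauses is a value of the Poisson
  generating function; this is the source of the exponentials in both recursions.\<close>

lemma expectation_offspring_prod:
  assumes p: "finite (set_pmf p)" and a: "\<And>x. 0 \<le> a x" and r: "0 < real k * \<alpha>"
  shows "measure_pmf.expectation (offspring_pmf k \<alpha> p) (\<lambda>cl. prod_list (map a cl))
    = exp (real k * \<alpha> * (measure_pmf.expectation p a - 1))"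
proof -
  have nonneg: "0 \<le> prod_list (map a xs)" for xs using a by (induction xs) auto
  have E: "0 \<le> measure_pmf.expectation p a"
    using a by (intro Bochner_Integration.integral_nonneg) auto
  have "(\<integral>\<^sup>+cl. ennreal (prod_list (map a cl)) \<partial>offspring_pmf k \<alpha> p)
      = ennreal (exp (real k * \<alpha> * (measure_pmf.expectation p a - 1)))"
    unfolding offspring_pmf_def
    by (simp add: nn_integral_replicate_pmf[OF p a] nn_integral_poisson_power[OF r E])
  then show ?thesis by (subst integral_eq_nn_integral) (auto simp: nonneg)
qed

lemma set_offspring_pmf: "cl \<in> set_pmf (offspring_pmf k \<alpha> p) \<Longrightarrow> set cl \<subseteq> set_pmf p"
  by (auto simp: offspring_pmf_def set_replicate_pmf)

section \<open>Superposition of independent Poisson offspring\<close>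

lemma poisson_pmf_add:
  assumes "0 < r" "0 < s"
  shows "poisson_pmf (r + s) = bind_pmf (poisson_pmf r) (\<lambda>i. map_pmf (\<lambda>j. i + j) (poisson_pmf s))"
proof (rule pmf_eqI)
  fix m
  have "ennreal (pmf (bind_pmf (poisson_pmf r) (\<lambda>i. map_pmf (\<lambda>j. i + j) (poisson_pmf s))) m)
      = (\<integral>\<^sup>+i. ennreal (pmf (map_pmf (\<lambda>j. i + j) (poisson_pmf s)) m) \<partial>poisson_pmf r)"
    by (rule ennreal_pmf_bind)
  also have "\<dots> = (\<Sum>i\<le>m. ennreal (pmf (map_pmf (\<lambda>j. i + j) (poisson_pmf s)) m) * ennreal (pmf (poisson_pmf r) i))"
    by (rule nn_integral_measure_pmf_support) (auto simp: pmf_eq_0_set_pmf)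
  also have "\<dots> = (\<Sum>i\<le>m. ennreal (pmf (poisson_pmf s) (m - i) * pmf (poisson_pmf r) i))"
  proof (rule sum.cong[OF refl])
    fix i assume "i \<in> {..m}"
    then have "pmf (map_pmf (\<lambda>j. i + j) (poisson_pmf s)) m
        = pmf (map_pmf (\<lambda>j. i + j) (poisson_pmf s)) (i + (m - i))" by simp
    also have "\<dots> = pmf (poisson_pmf s) (m - i)" by (rule pmf_map_inj') (auto simp: inj_def)
    finally show "ennreal (pmf (map_pmf (\<lambda>j. i + j) (poisson_pmf s)) m) * ennreal (pmf (poisson_pmf r) i)
        = ennreal (pmf (poisson_pmf s) (m - i) * pmf (poisson_pmf r) i)"
      by (simp only: ennreal_mult' pmf_nonneg)
  qed
  also have "\<dots> = ennreal (\<Sum>i\<le>m. pmf (poisson_pmf s) (m - i) * pmf (poisson_pmf r) i)"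
    by (rule sum_ennreal) (intro mult_nonneg_nonneg pmf_nonneg)
  also have "(\<Sum>i\<le>m. pmf (poisson_pmf s) (m - i) * pmf (poisson_pmf r) i) = pmf (poisson_pmf (r + s)) m"
  proof -
    have "pmf (poisson_pmf s) (m - i) * pmf (poisson_pmf r) i
        = exp (- (r + s)) / fact m * (real (m choose i) * r ^ i * s ^ (m - i))" if "i \<le> m" for i
      using assms that by (simp add: binomial_fact exp_add[symmetric] field_simps mult_exp_exp)
    then have "(\<Sum>i\<le>m. pmf (poisson_pmf s) (m - i) * pmf (poisson_pmf r) i)
        = exp (- (r + s)) / fact m * (\<Sum>i\<le>m. real (m choose i) * r ^ i * s ^ (m - i))"
      by (simp add: sum_distrib_left)
    also have "\<dots> = pmf (poisson_pmf (r + s)) m"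
      using assms by (simp add: binomial_ring[symmetric])
    finally show ?thesis .
  qed
  finally show "pmf (poisson_pmf (r + s)) m
      = pmf (bind_pmf (poisson_pmf r) (\<lambda>i. map_pmf (\<lambda>j. i + j) (poisson_pmf s))) m"
    by (simp add: pmf_nonneg)
qed

text \<open>Given the two counts, \<open>i + j\<close> independent clauses split into the first
  \<open>i\<close> and the last \<open>j\<close>. Exchanging the order of the draws then lets each
  count meet its own clauses.\<close>

lemma offspring_pmf_add:
  assumes "0 < k" "0 < \<alpha>" "0 < \<beta>"
  shows "offspring_pmf k (\<alpha> + \<beta>) p
    = map_pmf (\<lambda>(x, y). x @ y) (pair_pmf (offspring_pmf k \<alpha> p) (offspring_pmf k \<beta> p))"
proof -
  let ?A = "poisson_pmf (real k * \<alpha>)" and ?B = "poisson_pmf (real k * \<beta>)"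
  have "offspring_pmf k (\<alpha> + \<beta>) p = bind_pmf ?A (\<lambda>i. bind_pmf ?B (\<lambda>j.
      bind_pmf (replicate_pmf i p) (\<lambda>xs. bind_pmf (replicate_pmf j p) (\<lambda>ys. return_pmf (xs @ ys)))))"
    using assms by (simp add: offspring_pmf_def distrib_left poisson_pmf_add bind_assoc_pmf
        bind_map_pmf replicate_pmf_distrib)
  also have "\<dots> = bind_pmf ?A (\<lambda>i. bind_pmf (replicate_pmf i p) (\<lambda>xs. bind_pmf ?B (\<lambda>j.
       bind_pmf (replicate_pmf j p) (\<lambda>ys. return_pmf (xs @ ys)))))"
    by (subst bind_commute_pmf) simp
  also have "\<dots> = map_pmf (\<lambda>(x, y). x @ y) (pair_pmf (offspring_pmf k \<alpha> p) (offspring_pmf k \<beta> p))"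
    by (simp add: offspring_pmf_def pair_pmf_def map_bind_pmf bind_assoc_pmf)
  finally show ?thesis .
qed

section \<open>The tree ensemble\<close>

lemma prob_space_tCSP: "prob_space (tCSP k \<alpha> p)"
  unfolding tCSP_def by (intro prob_space_PiM prob_space_measure_pmf)

lemma sets_tCSP: "sets (PiM UNIV (\<lambda>_. measure_pmf q)) = sets tree_space"
  by (intro sets_PiM_cong) auto

lemma measurable_tCSP [simp]:
  "measurable (PiM UNIV (\<lambda>_. measure_pmf q)) M = measurable tree_space M"
  "measurable (tCSP k \<alpha> p) M = measurable tree_space M"
  by (auto simp: tCSP_def intro!: measurable_cong_sets sets_tCSP)

lemma distr_PiM_pointwise:
  assumes "\<And>i :: 'i. prob_space (M i)" "\<And>i. g \<in> measurable (M i) (N i)"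
  shows "distr (PiM UNIV M) (PiM UNIV N) (\<lambda>x i. g (x i)) = PiM UNIV (\<lambda>i. distr (M i) (N i) g)"
proof -
  have g: "(\<lambda>x i. g (x i)) \<in> measurable (PiM UNIV M) (PiM UNIV N)"
    by (rule measurable_PiM_single')
      (use measurable_space[OF assms(2)] assms(2) in \<open>auto simp: space_PiM PiE_iff
        intro!: measurable_compose[OF measurable_component_singleton]\<close>)
  show ?thesis
  proof (rule measure_eqI_PiM_infinite[of _ UNIV N])
    interpret prob_space "distr (PiM UNIV M) (PiM UNIV N) (\<lambda>x i. g (x i))"
      by (rule prob_space.prob_space_distr[OF prob_space_PiM g]) (rule assms)
    show "finite_measure (distr (PiM UNIV M) (PiM UNIV N) (\<lambda>x i. g (x i)))" by unfold_locales
    fix A and J :: "'i set" assume J: "finite J" and A: "\<And>i. i \<in> J \<Longrightarrow> A i \<in> sets (N i)"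
    have "emeasure (distr (PiM UNIV M) (PiM UNIV N) (\<lambda>x i. g (x i))) (prod_emb UNIV N J (Pi\<^sub>E J A))
        = emeasure (PiM UNIV M) ((\<lambda>x i. g (x i)) -` prod_emb UNIV N J (Pi\<^sub>E J A) \<inter> space (PiM UNIV M))"
      using J A by (intro emeasure_distr[OF g] sets_PiM_I) auto
    also have "(\<lambda>x i. g (x i)) -` prod_emb UNIV N J (Pi\<^sub>E J A) \<inter> space (PiM UNIV M)
        = prod_emb UNIV M J (\<Pi>\<^sub>E i\<in>J. g -` A i \<inter> space (M i))"
      using measurable_space[OF assms(2)] by (auto simp: prod_emb_def space_PiM PiE_iff)
    also have "emeasure (PiM UNIV M) \<dots> = (\<Prod>i\<in>J. emeasure (M i) (g -` A i \<inter> space (M i)))"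
      using J A assms by (intro emeasure_PiM_emb) auto
    also have "\<dots> = (\<Prod>i\<in>J. emeasure (distr (M i) (N i) g) (A i))"
      using A assms(2) by (intro prod.cong refl) (simp add: emeasure_distr)
    also have "\<dots> = emeasure (PiM UNIV (\<lambda>i. distr (M i) (N i) g)) (prod_emb UNIV (\<lambda>i. distr (M i) (N i) g) J (Pi\<^sub>E J A))"
      using J A assms by (intro emeasure_PiM_emb[symmetric] prob_space.prob_space_distr) auto
    also have "prod_emb UNIV (\<lambda>i. distr (M i) (N i) g) J (Pi\<^sub>E J A) = prod_emb UNIV N J (Pi\<^sub>E J A)"
      by (simp add: prod_emb_def)
    finally show "emeasure (distr (PiM UNIV M) (PiM UNIV N) (\<lambda>x i. g (x i))) (prod_emb UNIV N J (Pi\<^sub>E J A))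
      = emeasure (PiM UNIV (\<lambda>i. distr (M i) (N i) g)) (prod_emb UNIV N J (Pi\<^sub>E J A))" .
  qed (auto intro!: sets_PiM_cong)
qed

lemma integral_tCSP_map:
  fixes F :: "ctree \<Rightarrow> real"
  assumes F: "F \<in> borel_measurable tree_space" and q: "offspring_pmf k \<alpha> p = map_pmf g q"
  shows "(\<integral>T. F T \<partial>tCSP k \<alpha> p) = (\<integral>\<omega>. F (\<lambda>v. g (\<omega> v)) \<partial>PiM UNIV (\<lambda>_. measure_pmf q))"
proof -
  have "tCSP k \<alpha> p = distr (PiM UNIV (\<lambda>_. measure_pmf q)) tree_space (\<lambda>\<omega> v. g (\<omega> v))"
    unfolding tCSP_def q
    by (subst distr_PiM_pointwise) (auto simp: map_pmf_rep_eq prob_space_measure_pmf)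
  then show ?thesis
  proof -
    have "(\<lambda>\<omega> v. g (\<omega> v)) \<in> measurable (PiM UNIV (\<lambda>_. measure_pmf q)) tree_space"
      by (rule measurable_PiM_single')
        (auto simp: space_PiM PiE_iff intro!: measurable_compose[OF measurable_component_singleton])
    then show ?thesis unfolding \<open>tCSP k \<alpha> p = _\<close> by (rule integral_distr[OF _ F])
  qed
qed

lemma reconstruction_tv_bounds: "0 \<le> reconstruction_tv k l T" "reconstruction_tv k l T \<le> 1"
  by (simp_all add: reconstruction_tv_def Let_def tv_dist_nonneg tv_dist_le_1)

text \<open>Coupling: both ensembles are images of one field of independent pairs of clause lists,
  by taking the first component and by appending both. The comparison then holds for every
  outcome.\<close>

lemma expected_tv_mono:
  assumes "0 < \<alpha>" "\<alpha> \<le> \<beta>"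
  shows "(\<integral>T. reconstruction_tv (Suc n) l T \<partial>tCSP (Suc n) \<alpha> p)
    \<le> (\<integral>T. reconstruction_tv (Suc n) l T \<partial>tCSP (Suc n) \<beta> p)"
proof (cases "\<alpha> = \<beta>")
  case False
  with assms have pos: "0 < \<beta> - \<alpha>" by simp
  let ?q = "pair_pmf (offspring_pmf (Suc n) \<alpha> p) (offspring_pmf (Suc n) (\<beta> - \<alpha>) p)"
  let ?Q = "PiM UNIV (\<lambda>_ :: (nat \<times> nat) list. measure_pmf ?q)"
  let ?F = "reconstruction_tv (Suc n) l"
  interpret Q: prob_space ?Q by (intro prob_space_PiM prob_space_measure_pmf)
  have \<alpha>: "offspring_pmf (Suc n) \<alpha> p = map_pmf fst ?q" by (simp add: map_fst_pair_pmf)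
  have \<beta>: "offspring_pmf (Suc n) \<beta> p = map_pmf (\<lambda>(x, y). x @ y) ?q"
    using offspring_pmf_add[of "Suc n" \<alpha> "\<beta> - \<alpha>" p] assms pos by simp
  have int: "integrable ?Q (\<lambda>\<omega>. ?F (\<lambda>v. g (\<omega> v)))" for g
  proof (rule Q.integrable_const_bound[of _ 1])
    have "(\<lambda>\<omega> v. g (\<omega> v)) \<in> measurable ?Q tree_space"
      by (rule measurable_PiM_single')
        (auto simp: space_PiM PiE_iff intro!: measurable_compose[OF measurable_component_singleton])
    from measurable_compose[OF this reconstruction_tv_measurable]
    show "(\<lambda>\<omega>. ?F (\<lambda>v. g (\<omega> v))) \<in> borel_measurable ?Q" .
  qed (simp add: reconstruction_tv_bounds)
  show ?thesis
    unfolding integral_tCSP_map[OF reconstruction_tv_measurable \<alpha>]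
      integral_tCSP_map[OF reconstruction_tv_measurable \<beta>]
  proof (rule integral_mono[OF int int])
    fix \<omega> :: "(nat \<times> nat) list \<Rightarrow> clause list \<times> clause list"
    have "(\<lambda>v. case \<omega> v of (x, y) \<Rightarrow> x @ y) = tree_append (\<lambda>v. fst (\<omega> v)) (\<lambda>v. snd (\<omega> v))"
      by (simp add: tree_append_def fun_eq_iff case_prod_unfold)
    then show "?F (\<lambda>v. fst (\<omega> v)) \<le> ?F (\<lambda>v. case \<omega> v of (x, y) \<Rightarrow> x @ y)"
      by (simp add: reconstruction_tv_append)
  qed
qed simp

lemma tree_solvable_mono:
  assumes "tree_solvable (Suc n) \<alpha> p" "0 < \<alpha>" "\<alpha> \<le> \<beta>"
  shows "tree_solvable (Suc n) \<beta> p"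
proof -
  have "liminf (\<lambda>l. ereal (\<integral>T. reconstruction_tv (Suc n) l T \<partial>tCSP (Suc n) \<alpha> p))
      \<le> liminf (\<lambda>l. ereal (\<integral>T. reconstruction_tv (Suc n) l T \<partial>tCSP (Suc n) \<beta> p))"
    using assms by (intro Liminf_mono always_eventually allI) (simp add: expected_tv_mono)
  with assms(1) show ?thesis unfolding tree_solvable_def by (rule less_le_trans)
qed

section \<open>Recursions for the ensemble\<close>

text \<open>This bound assumes no finite supports, so it gives integrability over all trees,
  including the null set with invalid clauses.\<close>

lemma info_bound: "\<bar>info W\<bar> \<le> 1"
proof -
  have frac: "2 * y / (x + y) \<le> 2" if "0 \<le> x" "0 \<le> y" for x y :: real
    using that by (cases "x + y = 0") (auto simp: divide_le_eq)
  have "overlap (W 1) (W (-1)) \<le> 2"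
    unfolding overlap_def
  proof (rule measure_pmf.integral_le_const)
    show "integrable (measure_pmf (W 1)) (\<lambda>b. 2 * pmf (W (-1)) b / (pmf (W 1) b + pmf (W (-1)) b))"
      by (rule measure_pmf.integrable_const_bound[of _ 2])
        (auto simp: frac)
    show "AE b in W 1. 2 * pmf (W (-1)) b / (pmf (W 1) b + pmf (W (-1)) b) \<le> 2"
      by (auto simp: frac)
  qed
  then show ?thesis using overlap_nonneg[of "W 1" "W (-1)"] by (simp add: info_def abs_le_iff)
qed

lemma info_nonneg: "finite (set_pmf (W 1)) \<Longrightarrow> finite (set_pmf (W (-1))) \<Longrightarrow> 0 \<le> info W"
  by (simp add: info_def overlap_le_1)

text \<open>The root label is independent of all others, so it can be drawn afresh in an outer
  integral.\<close>

lemma integral_tCSP_root: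
  fixes g :: "ctree \<Rightarrow> real"
  assumes g: "g \<in> borel_measurable tree_space" and bound: "\<And>T. \<bar>g T\<bar> \<le> B"
  shows "(\<integral>T. g T \<partial>tCSP k \<alpha> p)
    = (\<integral>cl. (\<integral>T. g (T([] := cl)) \<partial>tCSP k \<alpha> p) \<partial>measure_pmf (offspring_pmf k \<alpha> p))"
proof -
  let ?Q = "measure_pmf (offspring_pmf k \<alpha> p)" and ?P = "tCSP k \<alpha> p"
  let ?upd = "\<lambda>(cl, T :: ctree). T([] := cl)"
  interpret P: prob_space ?P by (rule prob_space_tCSP)
  interpret PP: pair_prob_space ?Q ?P by unfold_locales
  have distr: "distr (?Q \<Otimes>\<^sub>M ?P) ?P ?upd = ?P"
    using distr_pair_PiM_eq_PiM[of UNIV "\<lambda>_. ?Q" "[]"] by (simp add: tCSP_def prob_space_measure_pmf)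
  have upd: "?upd \<in> measurable (?Q \<Otimes>\<^sub>M ?P) ?P"
    unfolding tCSP_def
  proof (rule measurable_PiM_single')
    fix i :: "(nat \<times> nat) list"
    show "(\<lambda>\<omega>. ?upd \<omega> i) \<in> measurable (?Q \<Otimes>\<^sub>M PiM UNIV (\<lambda>_. ?Q)) ?Q"
    proof (cases "i = []")
      case False
      have "(\<lambda>\<omega>. snd \<omega> i) \<in> measurable (?Q \<Otimes>\<^sub>M PiM UNIV (\<lambda>_. ?Q)) ?Q"
        by (rule measurable_compose[OF measurable_snd measurable_component_singleton]) simp
      with False show ?thesis by (simp add: case_prod_unfold)
    qed (simp add: case_prod_unfold)
  qed (auto simp: space_PiM)
  have g': "g \<in> borel_measurable ?P" using g by simp
  have int: "integrable (?Q \<Otimes>\<^sub>M ?P) (\<lambda>\<omega>. g (?upd \<omega>))"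
    by (rule PP.P.integrable_const_bound[of _ B]) (use bound measurable_compose[OF upd g'] in auto)
  have "(\<integral>T. g T \<partial>?P) = (\<integral>T. g T \<partial>distr (?Q \<Otimes>\<^sub>M ?P) ?P ?upd)" by (simp add: distr)
  also have "\<dots> = (\<integral>\<omega>. g (?upd \<omega>) \<partial>(?Q \<Otimes>\<^sub>M ?P))" by (rule integral_distr[OF upd g'])
  also have "\<dots> = (\<integral>cl. (\<integral>T. g (?upd (cl, T)) \<partial>?P) \<partial>?Q)"
    by (rule PP.integral_fst'[symmetric, OF int])
  finally show ?thesis by simp
qed

text \<open>Addresses below different clauses begin with different pairs, so the clauses see
  independent parts of the tree. All subtrees below one clause are collected in a single function of
  \<open>(i, v)\<close>.\<close>

lemma integral_clause_product:
  fixes A :: "clause \<Rightarrow> (nat \<Rightarrow> ctree) \<Rightarrow> real"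
  assumes A: "\<And>\<phi>. \<phi> \<in> set cl \<Longrightarrow> (\<lambda>Y. A \<phi> (\<lambda>i v. Y (i, v))) \<in> borel_measurable tree_space"
    and bound: "\<And>\<phi> X. \<bar>A \<phi> X\<bar> \<le> B"
  shows "(\<integral>T. (\<Prod>j<length cl. A (cl ! j) (\<lambda>i. subtree T (j, i))) \<partial>tCSP k \<alpha> p)
    = prod_list (map (\<lambda>\<phi>. \<integral>Y. A \<phi> (\<lambda>i v. Y (i, v)) \<partial>PiM UNIV (\<lambda>_. measure_pmf (offspring_pmf k \<alpha> p))) cl)"
proof -
  have "(\<integral>T. (\<Prod>j<length cl. A (cl ! j) (\<lambda>i. subtree T (j, i))) \<partial>tCSP k \<alpha> p)
    = (\<integral>T. (\<Prod>j<length cl. (\<lambda>Y. A (cl ! j) (\<lambda>i v. Y (i, v))) (\<lambda>x. T ((\<lambda>(i, v). (j, i) # v) x)))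
        \<partial>PiM UNIV (\<lambda>_. measure_pmf (offspring_pmf k \<alpha> p)))"
    by (simp add: tCSP_def subtree_def)
  also have "\<dots> = (\<Prod>j<length cl. \<integral>Y. A (cl ! j) (\<lambda>i v. Y (i, v))
      \<partial>PiM UNIV (\<lambda>_. measure_pmf (offspring_pmf k \<alpha> p)))"
    by (rule integral_PiM_blocks[where B = B])
      (auto simp: inj_on_def disjoint_family_on_def prob_space_measure_pmf bound intro!: A)
  finally show ?thesis by (simp add: prod.list_conv_set_nth atLeast0LessThan)
qed

lemma generation_measurable:
  "(\<lambda>T. info (generation_pmf (Suc n) l T)) \<in> borel_measurable tree_space"
  "(\<lambda>T. undetermined (generation_pmf (Suc n) l T)) \<in> borel_measurable tree_space"
  by (rule info_measurable[where B = "lists possible_signs"]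
      undetermined_measurable[where B = "lists possible_signs"];
    auto intro!: pmf_measurable_generation countable_possible_signs
      simp: set_generation_subset possible_signs_def[THEN eqset_imp_iff])+

lemma clause_channel_measurable:
  fixes l n \<phi>
  defines "ch \<equiv> \<lambda>Y. clause_channel n \<phi> (\<lambda>i. generation_pmf (Suc n) l (\<lambda>v. Y (i, v)))"
  shows "(\<lambda>Y. info (ch Y)) \<in> borel_measurable tree_space"
    and "(\<lambda>Y. undetermined (ch Y)) \<in> borel_measurable tree_space"
proof -
  have ch: "pmf_measurable tree_space (\<lambda>Y. ch Y s)" for s
    unfolding ch_def
    by (intro pmf_measurable_clause_channel pmf_measurable_compose[OF measurable_reindex pmf_measurable_generation])
  have B: "countable (lists (lists possible_signs))"
    by (intro countable_lists countable_possible_signs)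
  have sub: "set_pmf (ch Y 1) \<subseteq> lists (lists possible_signs)" for Y
    unfolding ch_def by (intro set_clause_channel_subset set_generation_subset)
  show "(\<lambda>Y. info (ch Y)) \<in> borel_measurable tree_space"
    by (rule info_measurable[where W = ch, OF ch ch B sub])
  show "(\<lambda>Y. undetermined (ch Y)) \<in> borel_measurable tree_space"
    by (rule undetermined_measurable[where W = ch, OF ch ch B sub])
qed

locale csp_ensemble =
  fixes n :: nat and p :: "clause pmf" and \<alpha> :: real
  assumes valid: "\<phi> \<in> set_pmf p \<Longrightarrow> valid_clause n \<phi>" and \<alpha>_pos: "0 < \<alpha>"
begin

abbreviation offspring :: "clause list pmf" where
  "offspring \<equiv> offspring_pmf (Suc n) \<alpha> p"

abbreviation ensemble :: "ctree measure" where
  "ensemble \<equiv> tCSP (Suc n) \<alpha> p"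

abbreviation blocks :: "(nat \<times> (nat \<times> nat) list \<Rightarrow> clause list) measure" where
  "blocks \<equiv> PiM UNIV (\<lambda>_. measure_pmf offspring)"

abbreviation gen :: "nat \<Rightarrow> ctree \<Rightarrow> real \<Rightarrow> real list pmf" where
  "gen \<equiv> generation_pmf (Suc n)"

abbreviation ch :: "nat \<Rightarrow> clause \<Rightarrow> (nat \<Rightarrow> ctree) \<Rightarrow> real \<Rightarrow> real list list pmf" where
  "ch l \<phi> X \<equiv> clause_channel n \<phi> (\<lambda>i. gen l (X i))"

definition mean_info :: "nat \<Rightarrow> real" where
  "mean_info l = (\<integral>T. info (gen l T) \<partial>ensemble)"

definition mean_undet :: "nat \<Rightarrow> real" where
  "mean_undet l = (\<integral>T. undetermined (gen l T) \<partial>ensemble)"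

definition frequency :: real where
  "frequency = measure_pmf.expectation p (pivotal (Suc n))"

lemma finite_support: "finite (set_pmf p)"
proof (rule finite_subset)
  show "set_pmf p \<subseteq> clauses (Suc n)" using valid by (auto dest: valid_clause.clause)
  show "finite (clauses (Suc n))" unfolding clauses_def by (intro finite_PiE) auto
qed

lemma AE_valid_PiM:
  "AE T in PiM (UNIV :: 'i :: countable set) (\<lambda>_. measure_pmf offspring). \<forall>v. \<forall>\<phi>\<in>set (T v). valid_clause n \<phi>"
  unfolding AE_all_countable
proof
  fix v :: 'i
  have "AE cl in offspring. \<forall>\<phi>\<in>set cl. valid_clause n \<phi>"
    using set_offspring_pmf valid by (fastforce simp: AE_measure_pmf_iff)
  then show "AE T in PiM (UNIV :: 'i set) (\<lambda>_. measure_pmf offspring). \<forall>\<phi>\<in>set (T v). valid_clause n \<phi>"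
    by (intro AE_PiM_component[where P = "\<lambda>cl. \<forall>\<phi>\<in>set cl. valid_clause n \<phi>"])
      (auto intro: prob_space_measure_pmf)
qed

lemma AE_valid_tree: "AE T in ensemble. valid_tree n T"
  unfolding valid_tree_def tCSP_def by (rule AE_valid_PiM)

lemma AE_valid_blocks: "AE Y in blocks. \<forall>i. valid_tree n (\<lambda>v. Y (i, v))"
  using AE_valid_PiM by eventually_elim (auto simp: valid_tree_def)

sublocale P: prob_space ensemble by (rule prob_space_tCSP)

lemma prob_space_blocks: "prob_space blocks"
  by (intro prob_space_PiM prob_space_measure_pmf)

sublocale Y: prob_space blocks by (rule prob_space_blocks)

lemma integrable_info: "integrable ensemble (\<lambda>T. info (gen l T))"
  by (rule P.integrable_const_bound[of _ 1]) (auto simp: info_bound generation_measurable)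

lemma integrable_undet: "integrable ensemble (\<lambda>T. undetermined (gen l T))"
  by (rule P.integrable_const_bound[of _ 1])
    (auto simp: undetermined_nonneg undetermined_le_1 generation_measurable)

lemma mean_info_nonneg: "0 \<le> mean_info l"
  unfolding mean_info_def
proof (rule integral_nonneg_AE)
  show "AE T in ensemble. 0 \<le> info (gen l T)"
    using AE_valid_tree by eventually_elim (auto intro!: info_nonneg finite_set_generation)
qed

lemma mean_info_le_1: "mean_info l \<le> 1"
  unfolding mean_info_def
  by (rule P.integral_le_const[OF integrable_info]) (use info_bound in \<open>auto simp: abs_le_iff\<close>)

lemma integral_block_product:
  fixes F :: "nat \<Rightarrow> ctree \<Rightarrow> real"
  assumes F: "\<And>i. i < n \<Longrightarrow> F i \<in> borel_measurable tree_space" and B: "\<And>i T. \<bar>F i T\<bar> \<le> B"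
  shows "(\<integral>Y. (\<Prod>i<n. F i (\<lambda>v. Y (i, v))) \<partial>blocks) = (\<Prod>i<n. \<integral>T. F i T \<partial>ensemble)"
    (is ?eq) and "integrable blocks (\<lambda>Y. \<Prod>i<n. F i (\<lambda>v. Y (i, v)))" (is ?int)
proof -
  have "(\<integral>Y. (\<Prod>i\<in>{..<n}. F i (\<lambda>v. Y ((\<lambda>v. (i, v)) v))) \<partial>blocks)
      = (\<Prod>i\<in>{..<n}. \<integral>T. F i T \<partial>PiM UNIV (\<lambda>_. measure_pmf offspring))"
    by (rule integral_PiM_blocks[of "measure_pmf offspring" "{..<n}" "\<lambda>i v. (i, v)" F B])
      (auto simp: inj_on_def disjoint_family_on_def prob_space_measure_pmf B intro!: F)
  then show ?eq by (simp add: tCSP_def)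
  show ?int
  proof (rule Y.integrable_const_bound[of _ "B ^ n"])
    have "\<bar>\<Prod>i<n. F i (\<lambda>v. Y (i, v))\<bar> \<le> B ^ n" for Y
      unfolding abs_prod using prod_mono[of "{..<n}" "\<lambda>i. \<bar>F i (\<lambda>v. Y (i, v))\<bar>" "\<lambda>_. B"] B
      by simp
    then show "AE Y in blocks. norm (\<Prod>i<n. F i (\<lambda>v. Y (i, v))) \<le> B ^ n" by simp
    show "(\<lambda>Y. \<Prod>i<n. F i (\<lambda>v. Y (i, v))) \<in> borel_measurable blocks"
      using measurable_compose[OF measurable_reindex F, of _ "\<lambda>v. (_, v)"]
      by (auto intro!: borel_measurable_prod)
  qed
qed

text \<open>The bound of \<open>info_channel_le\<close> is affine in the information of each child,
  and the children's subtrees are independent, so in the mean each information is simply replaced by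
  \<open>mean_info l\<close>.\<close>

lemma mean_info_channel_le:
  assumes \<phi>: "\<phi> \<in> set_pmf p"
  shows "(\<integral>Y. info (ch l \<phi> (\<lambda>i v. Y (i, v))) \<partial>blocks)
    \<le> 2 / (unorm (Suc n) \<phi>)\<^sup>2 * stab n (cube_deriv 0 \<phi>) (\<lambda>_. mean_info l)"
proof -
  interpret valid_clause n \<phi> by (rule valid[OF \<phi>])
  define F where "F y z i T = 1 + y ! i * z ! i * info (gen l T)" for y z :: "real list" and i T
  have Fm: "F y z i \<in> borel_measurable tree_space" for y z i
    unfolding F_def[abs_def] by (intro borel_measurable_add borel_measurable_times generation_measurable) auto

  have bound: "\<bar>if y \<in> cube n \<and> z \<in> cube n \<and> i < n then F y z i T else 0\<bar> \<le> 2" for y z i T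
  proof -
    have "\<bar>F y z i T\<bar> \<le> 2" if "y \<in> cube n" "z \<in> cube n" "i < n"
    proof -
      have "\<bar>y ! i * z ! i\<bar> = 1"
        using cube_nth[of y n i] cube_nth[of z n i] that by (auto simp: abs_mult)
      then have "\<bar>y ! i * z ! i * info (gen l T)\<bar> \<le> 1"
        using info_bound[of "gen l T"] by (simp add: abs_mult)
      then show ?thesis by (simp add: F_def abs_le_iff)
    qed
    then show ?thesis by auto
  qed
  have G: "integrable blocks (\<lambda>Y. \<Prod>i<n. F y z i (\<lambda>v. Y (i, v)))"
    "(\<integral>Y. (\<Prod>i<n. F y z i (\<lambda>v. Y (i, v))) \<partial>blocks) = (\<Prod>i<n. 1 + y ! i * z ! i * mean_info l)"
    if yz: "y \<in> cube n" "z \<in> cube n" for y z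
  proof -
    \<comment> \<open>The factor is cut off because \<open>integral_block_product\<close> wants a
      bound for every index, and beyond \<open>n\<close> the entries of \<open>y\<close> and
      \<open>z\<close> are arbitrary.\<close>
    let ?F = "\<lambda>i T. if y \<in> cube n \<and> z \<in> cube n \<and> i < n then F y z i T else 0"
    have m: "?F i \<in> borel_measurable tree_space" if "i < n" for i
      using that yz Fm[of y z i] by simp
    have eq: "(\<Prod>i<n. ?F i (\<lambda>v. Y (i, v))) = (\<Prod>i<n. F y z i (\<lambda>v. Y (i, v)))" for Y
      using yz by simp
    show "integrable blocks (\<lambda>Y. \<Prod>i<n. F y z i (\<lambda>v. Y (i, v)))"
      using integral_block_product(2)[of ?F 2, OF m bound] unfolding eq .
    have "(\<integral>Y. (\<Prod>i<n. F y z i (\<lambda>v. Y (i, v))) \<partial>blocks) = (\<Prod>i<n. \<integral>T. ?F i T \<partial>ensemble)"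
      using integral_block_product(1)[of ?F 2, OF m bound] unfolding eq .
    also have "\<dots> = (\<Prod>i<n. 1 + y ! i * z ! i * mean_info l)"
      using yz integrable_info
      by (intro prod.cong refl) (simp add: F_def mean_info_def P.prob_space)
    finally show "(\<integral>Y. (\<Prod>i<n. F y z i (\<lambda>v. Y (i, v))) \<partial>blocks)
      = (\<Prod>i<n. 1 + y ! i * z ! i * mean_info l)" .
  qed
  let ?R = "\<lambda>Y. 2 / (unorm (Suc n) \<phi>)\<^sup>2 * stab n f (\<lambda>i. info (gen l (\<lambda>v. Y (i, v))))"
  have stab: "stab n f (\<lambda>i. info (gen l (\<lambda>v. Y (i, v))))
      = (\<Sum>y\<in>cube n. \<Sum>z\<in>cube n. f y * f z * (\<Prod>i<n. F y z i (\<lambda>v. Y (i, v)))) / 4 ^ n" for Y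
    by (simp add: stab_def F_def)
  have int: "integrable blocks ?R"
    unfolding stab
    by (intro integrable_mult_right integrable_divide Bochner_Integration.integrable_sum G)
  have "(\<integral>Y. info (ch l \<phi> (\<lambda>i v. Y (i, v))) \<partial>blocks) \<le> (\<integral>Y. ?R Y \<partial>blocks)"
  proof (rule integral_mono_AE)
    show "integrable blocks (\<lambda>Y. info (ch l \<phi> (\<lambda>i v. Y (i, v))))"
      by (rule Y.integrable_const_bound[of _ 1]) (auto simp: info_bound intro!: clause_channel_measurable)
    show "AE Y in blocks. info (ch l \<phi> (\<lambda>i v. Y (i, v))) \<le> ?R Y"
      using AE_valid_blocks
    proof eventually_elim
      case (elim Y)
      then show ?case by (intro info_channel_le finite_set_generation) auto
    qed
  qed (rule int)
  also have "(\<integral>Y. ?R Y \<partial>blocks) = 2 / (unorm (Suc n) \<phi>)\<^sup>2 * stab n f (\<lambda>_. mean_info l)"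
    unfolding stab using G by (simp add: Bochner_Integration.integral_sum stab_def)
  finally show ?thesis .
qed

lemma mean_undet_channel_le:
  assumes \<phi>: "\<phi> \<in> set_pmf p"
  shows "(\<integral>Y. undetermined (ch l \<phi> (\<lambda>i v. Y (i, v))) \<partial>blocks)
    \<le> 1 - pivotal (Suc n) \<phi> * (1 - mean_undet l) ^ n"
proof -
  interpret valid_clause n \<phi> by (rule valid[OF \<phi>])
  let ?d = "\<lambda>T. 1 - undetermined (gen l T)"
  have dm: "?d \<in> borel_measurable tree_space"
    by (intro borel_measurable_diff generation_measurable) auto
  have db: "\<bar>?d T\<bar> \<le> 1" for T
    using undetermined_nonneg[of "gen l T"] undetermined_le_1[of "gen l T"] by simp
  note prod = integral_block_product[of "\<lambda>_. ?d" 1, OF dm db]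
  have int: "integrable blocks (\<lambda>Y. 1 - pivotal (Suc n) \<phi> * (\<Prod>i<n. ?d (\<lambda>v. Y (i, v))))"
    using prod(2) by simp
  have "(\<integral>Y. undetermined (ch l \<phi> (\<lambda>i v. Y (i, v))) \<partial>blocks)
      \<le> (\<integral>Y. 1 - pivotal (Suc n) \<phi> * (\<Prod>i<n. ?d (\<lambda>v. Y (i, v))) \<partial>blocks)"
  proof (rule integral_mono_AE[OF _ int])
    show "integrable blocks (\<lambda>Y. undetermined (ch l \<phi> (\<lambda>i v. Y (i, v))))"
      by (rule Y.integrable_const_bound[of _ 1])
        (auto simp: undetermined_nonneg undetermined_le_1 intro!: clause_channel_measurable)
    show "AE Y in blocks. undetermined (ch l \<phi> (\<lambda>i v. Y (i, v)))
        \<le> 1 - pivotal (Suc n) \<phi> * (\<Prod>i<n. ?d (\<lambda>v. Y (i, v)))"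
      using AE_valid_blocks
    proof eventually_elim
      case (elim Y)
      let ?W = "\<lambda>i. gen l (\<lambda>v. Y (i, v))"
      have "pivotal (Suc n) \<phi> * (\<Prod>i<n. ?d (\<lambda>v. Y (i, v)))
          \<le> measure_pmf.prob (channel ?W 1) (- set_pmf (channel ?W (- 1)))"
        by (rule prob_channel_determined) (use elim in \<open>auto intro!: determined_generation\<close>)
      also have "\<dots> = 1 - undetermined (channel ?W)"
        using measure_pmf.prob_compl[of "set_pmf (channel ?W (-1))" "channel ?W 1"]
        by (simp add: undetermined_def Compl_eq_Diff_UNIV)
      finally show ?case by simp
    qed
  qed
  also have "\<dots> = 1 - pivotal (Suc n) \<phi> * (1 - mean_undet l) ^ n"
    using prod integrable_undet by (simp add: Y.prob_space P.prob_space mean_undet_def)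
  finally show ?thesis .
qed

section \<open>Recursion from one generation to the next\<close>

lemma AE_valid_update:
  assumes "cl \<in> set_pmf offspring"
  shows "AE T in ensemble. valid_tree n (T([] := cl))"
  using AE_valid_tree
proof eventually_elim
  case (elim T)
  then show ?case using set_offspring_pmf[OF assms] valid by (auto simp: valid_tree_def)
qed

lemma subtree_update [simp]: "subtree (T([] := cl)) c = subtree T c"
  by (simp add: subtree_def)

lemma measurable_update: "(\<lambda>T :: ctree. T([] := cl)) \<in> measurable tree_space tree_space"
proof (rule measurable_PiM_single')
  fix i :: "(nat \<times> nat) list"
  show "(\<lambda>T. (T([] := cl)) i) \<in> measurable tree_space (count_space UNIV)"
    by (cases "i = []") (auto intro: measurable_component_singleton)
qed (auto simp: space_PiM)

text \<open>A node factorizes exactly over its clauses; the only loss is the inequality inside a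
  single clause.\<close>

lemma mean_undet_Suc:
  "mean_undet (Suc l) \<le> exp (- (real (Suc n) * \<alpha> * frequency * (1 - mean_undet l) ^ n))"
proof -
  define a where "a \<phi> = (\<integral>Y. undetermined (ch l \<phi> (\<lambda>i v. Y (i, v))) \<partial>blocks)" for \<phi>
  have a: "0 \<le> a \<phi>" for \<phi>
    unfolding a_def by (intro Bochner_Integration.integral_nonneg undetermined_nonneg)
  have "mean_undet (Suc l) = (\<integral>cl. (\<integral>T. undetermined (gen (Suc l) (T([] := cl))) \<partial>ensemble) \<partial>offspring)"
    unfolding mean_undet_def
    by (rule integral_tCSP_root[of _ 1])
      (auto intro: generation_measurable simp: undetermined_nonneg undetermined_le_1)
  also have "\<dots> = (\<integral>cl. prod_list (map a cl) \<partial>offspring)"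
  proof -
    have "(\<integral>T. undetermined (gen (Suc l) (T([] := cl))) \<partial>ensemble) = prod_list (map a cl)" for cl
      unfolding a_def undetermined_generation_Suc subtree_update fun_upd_same
      by (rule integral_clause_product[where B = 1])
        (auto intro: clause_channel_measurable simp: undetermined_nonneg undetermined_le_1)
    then show ?thesis by simp
  qed
  also have "\<dots> = exp (real (Suc n) * \<alpha> * (measure_pmf.expectation p a - 1))"
    using \<alpha>_pos by (intro expectation_offspring_prod finite_support a) auto
  also have "\<dots> \<le> exp (- (real (Suc n) * \<alpha> * frequency * (1 - mean_undet l) ^ n))"
  proof -
    have "measure_pmf.expectation p a
        \<le> measure_pmf.expectation p (\<lambda>\<phi>. 1 - pivotal (Suc n) \<phi> * (1 - mean_undet l) ^ n)"
      by (intro integral_mono_AE integrable_measure_pmf_finite finite_support)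
        (auto simp: AE_measure_pmf_iff a_def mean_undet_channel_le)
    also have "\<dots> = 1 - frequency * (1 - mean_undet l) ^ n"
      by (simp add: frequency_def integrable_measure_pmf_finite finite_support)
    finally have "real (Suc n) * \<alpha> * (measure_pmf.expectation p a - 1)
        \<le> real (Suc n) * \<alpha> * (- (frequency * (1 - mean_undet l) ^ n))"
      using \<alpha>_pos by (intro mult_left_mono) auto
    then show ?thesis by (simp add: mult_ac)
  qed
  finally show ?thesis .
qed

definition stab_mean :: "real \<Rightarrow> real" where
  "stab_mean t = measure_pmf.expectation p
     (\<lambda>\<phi>. 2 / (unorm (Suc n) \<phi>)\<^sup>2 * stab n (cube_deriv 0 \<phi>) (\<lambda>_. t))"

lemma mean_info_Suc:
  "mean_info (Suc l) \<le> 1 - exp (- (real (Suc n) * \<alpha> * stab_mean (mean_info l)))"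
proof -
  define A where "A \<phi> X = 1 - info (ch l \<phi> X)" for \<phi> X
  define a where "a \<phi> = (\<integral>Y. A \<phi> (\<lambda>i v. Y (i, v)) \<partial>blocks)" for \<phi>
  have A: "0 \<le> A \<phi> X" "\<bar>A \<phi> X\<bar> \<le> 2" for \<phi> X
    using info_bound[of "ch l \<phi> X"] by (auto simp: A_def abs_le_iff)
  have Am: "(\<lambda>Y. A \<phi> (\<lambda>i v. Y (i, v))) \<in> borel_measurable tree_space" for \<phi>
    unfolding A_def by (intro borel_measurable_diff clause_channel_measurable) auto
  have a: "0 \<le> a \<phi>" for \<phi>
    unfolding a_def by (intro Bochner_Integration.integral_nonneg A)
  have Gm: "(\<lambda>T. 1 - info (gen (Suc l) T)) \<in> borel_measurable tree_space"
    by (intro borel_measurable_diff generation_measurable) auto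
  have Gb: "\<bar>1 - info (gen (Suc l) T)\<bar> \<le> 2" for T
    using info_bound[of "gen (Suc l) T"] by (auto simp: abs_le_iff)
  have Gpos: "0 \<le> 1 - info (gen (Suc l) T)" for T
    using info_bound[of "gen (Suc l) T"] by (simp add: abs_le_iff)
  have "exp (- (real (Suc n) * \<alpha> * stab_mean (mean_info l)))
      \<le> exp (real (Suc n) * \<alpha> * (measure_pmf.expectation p a - 1))"
  proof -
    have "1 - stab_mean (mean_info l) = measure_pmf.expectation p
        (\<lambda>\<phi>. 1 - 2 / (unorm (Suc n) \<phi>)\<^sup>2 * stab n (cube_deriv 0 \<phi>) (\<lambda>_. mean_info l))"
      by (simp add: stab_mean_def integrable_measure_pmf_finite finite_support)
    also have "\<dots> \<le> measure_pmf.expectation p a"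
    proof (intro integral_mono_AE integrable_measure_pmf_finite finite_support)
      have "a \<phi> = 1 - (\<integral>Y. info (ch l \<phi> (\<lambda>i v. Y (i, v))) \<partial>blocks)" for \<phi>
      proof -
        have "integrable blocks (\<lambda>Y. info (ch l \<phi> (\<lambda>i v. Y (i, v))))"
          by (rule Y.integrable_const_bound[of _ 1]) (auto simp: info_bound intro!: clause_channel_measurable)
        then show ?thesis by (simp add: a_def A_def Y.prob_space)
      qed
      then show "AE \<phi> in p. 1 - 2 / (unorm (Suc n) \<phi>)\<^sup>2 * stab n (cube_deriv 0 \<phi>) (\<lambda>_. mean_info l) \<le> a \<phi>"
        using mean_info_channel_le by (simp add: AE_measure_pmf_iff)
    qed
    finally have "real (Suc n) * \<alpha> * (- stab_mean (mean_info l))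
        \<le> real (Suc n) * \<alpha> * (measure_pmf.expectation p a - 1)"
      using \<alpha>_pos by (intro mult_left_mono) auto
    then show ?thesis by simp
  qed
  also have "\<dots> = (\<integral>cl. prod_list (map a cl) \<partial>offspring)"
    using \<alpha>_pos by (intro expectation_offspring_prod[symmetric] finite_support a) auto
  also have "\<dots> \<le> (\<integral>cl. (\<integral>T. 1 - info (gen (Suc l) (T([] := cl))) \<partial>ensemble) \<partial>offspring)"
  proof -
    define g where "g cl = (\<integral>T. 1 - info (gen (Suc l) (T([] := cl))) \<partial>ensemble)" for cl
    have gm: "(\<lambda>T. 1 - info (gen (Suc l) (T([] := cl)))) \<in> borel_measurable ensemble" for cl
      using measurable_compose[OF measurable_update Gm] by simp
    have gint: "integrable ensemble (\<lambda>T. 1 - info (gen (Suc l) (T([] := cl))))" for cl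
      by (rule P.integrable_const_bound[of _ 2]) (use Gb gm in auto)
    have le: "prod_list (map a cl) \<le> g cl" if cl: "cl \<in> set_pmf offspring" for cl
    proof -
      have "prod_list (map a cl)
          = (\<integral>T. (\<Prod>j<length cl. A (cl ! j) (\<lambda>i. subtree T (j, i))) \<partial>ensemble)"
        unfolding a_def by (rule integral_clause_product[symmetric, OF Am A(2)])
      also have "\<dots> \<le> g cl"
        unfolding g_def
      \<comment> \<open>This form of monotonicity needs integrability and nonnegativity of the
        larger function only.\<close>
      proof (rule integral_mono_AE')
        show "AE T in ensemble. (\<Prod>j<length cl. A (cl ! j) (\<lambda>i. subtree T (j, i)))
            \<le> 1 - info (gen (Suc l) (T([] := cl)))"
          using AE_valid_update[OF cl]
        proof eventually_elim
          case (elim T)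
          from info_generation_Suc[OF this, of l] show ?case by (simp add: A_def)
        qed
        show "AE T in ensemble. 0 \<le> 1 - info (gen (Suc l) (T([] := cl)))"
          by (intro AE_I2 Gpos)
      qed (rule gint)
      finally show ?thesis .
    qed
    have gb: "0 \<le> g cl" "g cl \<le> 2" for cl
    proof -
      show "0 \<le> g cl" unfolding g_def
        by (intro Bochner_Integration.integral_nonneg Gpos)
      show "g cl \<le> 2" unfolding g_def
        by (rule P.integral_le_const[OF gint]) (use Gb in \<open>auto simp: abs_le_iff\<close>)
    qed
    show ?thesis
      unfolding g_def[symmetric]
    proof (rule integral_mono_AE')
      show "integrable offspring g"
        by (rule measure_pmf.integrable_const_bound[of _ 2]) (use gb in auto)
      show "AE cl in offspring. prod_list (map a cl) \<le> g cl"
        using le by (simp add: AE_measure_pmf_iff)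
      show "AE cl in offspring. 0 \<le> g cl"
        by (simp add: gb)
    qed
  qed
  also have "\<dots> = (\<integral>T. 1 - info (gen (Suc l) T) \<partial>ensemble)"
    by (rule integral_tCSP_root[symmetric, OF Gm Gb])
  also have "\<dots> = 1 - mean_info (Suc l)"
    using integrable_info by (simp add: mean_info_def P.prob_space)
  finally show ?thesis by simp
qed

section \<open>Criteria for solvability in terms of the recursions\<close>

lemma mean_undet_0: "mean_undet 0 = 0"
  by (simp add: mean_undet_def undetermined_def)

text \<open>The recursion for the probability of determination is monotone and starts at 1, so it
  cannot drop below a value \<open>z\<close> that it does not decrease. Every generation then has
  expected total variation at least \<open>z / 4\<close>.\<close>

lemma tree_solvable_of_fixed_point:
  assumes z: "0 < z" "z \<le> 1" "exp (- (real (Suc n) * \<alpha> * frequency * z ^ n)) \<le> 1 - z"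
    and freq: "0 \<le> frequency"
  shows "tree_solvable (Suc n) \<alpha> p"
proof -
  have le: "z \<le> 1 - mean_undet l" for l
  proof (induction l)
    case 0
    then show ?case using z by (simp add: mean_undet_0)
  next
    case (Suc l)
    have "real (Suc n) * \<alpha> * frequency * z ^ n \<le> real (Suc n) * \<alpha> * frequency * (1 - mean_undet l) ^ n"
      using Suc z freq \<alpha>_pos by (intro mult_left_mono power_mono) auto
    then have "exp (- (real (Suc n) * \<alpha> * frequency * (1 - mean_undet l) ^ n)) \<le> 1 - z"
      using z(3) by (meson exp_le_cancel_iff neg_le_iff_le order_trans)
    then show ?case using mean_undet_Suc[of l] by linarith
  qed
  have "z / 4 \<le> (\<integral>T. reconstruction_tv (Suc n) l T \<partial>ensemble)" for l
  proof -
    have "(1 - mean_undet l) / 4 = (\<integral>T. (1 - undetermined (gen l T)) / 4 \<partial>ensemble)"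
      using integrable_undet by (simp add: mean_undet_def P.prob_space)
    also have "\<dots> \<le> (\<integral>T. reconstruction_tv (Suc n) l T \<partial>ensemble)"
    proof (rule integral_mono)
      show "integrable ensemble (\<lambda>T. (1 - undetermined (gen l T)) / 4)"
        using integrable_undet by simp
      show "integrable ensemble (reconstruction_tv (Suc n) l)"
        by (rule P.integrable_const_bound[of _ 1])
          (auto simp: reconstruction_tv_bounds reconstruction_tv_measurable)
    qed (simp only: reconstruction_tv_eq coupled_tv_ge)
    finally show ?thesis using le[of l] by simp
  qed
  then have "ereal (z / 4) \<le> liminf (\<lambda>l. ereal (\<integral>T. reconstruction_tv (Suc n) l T \<partial>ensemble))"
    by (intro Liminf_bounded always_eventually) simp
  then show ?thesis unfolding tree_solvable_def using z(1)
    by (metis (no_types) divide_pos_pos ereal_less(2) less_le_trans zero_less_numeral)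
qed

lemma not_tree_solvable_of_vanishing:
  assumes "mean_info \<longlonglongrightarrow> 0"
  shows "\<not> tree_solvable (Suc n) \<alpha> p"
proof -
  let ?E = "\<lambda>l. \<integral>T. reconstruction_tv (Suc n) l T \<partial>ensemble"
  have int: "integrable ensemble (reconstruction_tv (Suc n) l)" for l
    by (rule P.integrable_const_bound[of _ 1])
      (auto simp: reconstruction_tv_bounds reconstruction_tv_measurable)
  have int2: "integrable ensemble (\<lambda>T. (reconstruction_tv (Suc n) l T)\<^sup>2)" for l
    by (rule P.integrable_const_bound[of _ 1])
      (auto simp: reconstruction_tv_bounds reconstruction_tv_measurable power_le_one intro: borel_measurable_power)
  have le: "?E l \<le> sqrt (mean_info l)" for l
  proof (rule real_le_rsqrt)
    \<comment> \<open>Jensen's inequality, in the form that a variance is nonnegative.\<close>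
    have "(?E l)\<^sup>2 \<le> (\<integral>T. (reconstruction_tv (Suc n) l T)\<^sup>2 \<partial>ensemble)"
      using P.variance_eq[OF int int2] P.variance_positive[of "reconstruction_tv (Suc n) l"] by simp
    also have "\<dots> \<le> mean_info l"
      unfolding mean_info_def
    proof (rule integral_mono_AE[OF int2 integrable_info])
      show "AE T in ensemble. (reconstruction_tv (Suc n) l T)\<^sup>2 \<le> info (gen l T)"
        using AE_valid_tree
      proof eventually_elim
        case (elim T)
        then have fin: "finite (set_pmf (gen l T 1))" "finite (set_pmf (gen l T (-1)))"
          by (auto intro: finite_set_generation)
        have "(reconstruction_tv (Suc n) l T)\<^sup>2 \<le> (sqrt (info (gen l T)))\<^sup>2"
          using coupled_tv_le[of "gen l T", OF fin] reconstruction_tv_bounds[of "Suc n" l T]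
          unfolding reconstruction_tv_eq by (intro power_mono)
        then show ?case using info_nonneg[of "gen l T", OF fin] by simp
      qed
    qed
    finally show "(?E l)\<^sup>2 \<le> mean_info l" .
  qed
  have "?E \<longlonglongrightarrow> 0"
  proof (rule tendsto_sandwich[of "\<lambda>_. 0"])
    show "\<forall>\<^sub>F l in sequentially. 0 \<le> ?E l"
      by (intro always_eventually allI Bochner_Integration.integral_nonneg reconstruction_tv_bounds)
    show "\<forall>\<^sub>F l in sequentially. ?E l \<le> sqrt (mean_info l)" using le by simp
    show "(\<lambda>l. sqrt (mean_info l)) \<longlonglongrightarrow> 0" using tendsto_real_sqrt[OF assms] by simp
  qed simp
  then have "(\<lambda>l. ereal (?E l)) \<longlonglongrightarrow> ereal 0" by simp
  then have "liminf (\<lambda>l. ereal (?E l)) = ereal 0"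
    by (intro lim_imp_Liminf) auto
  then show ?thesis by (simp add: tree_solvable_def)
qed

end

section \<open>The threshold\<close>

locale noise_sensitive_ensemble = csp_ensemble +
  fixes C :: real
  assumes C_pos: "0 < C"
    and noise_bound: "\<phi> \<in> set_pmf p \<Longrightarrow> \<theta> \<in> {0..1} \<Longrightarrow>
      (unorm n (noise_op n \<theta> (cube_deriv 0 \<phi>)))\<^sup>2
        \<le> exp (- C * real (Suc n) * (1 - \<theta>)) * (unorm n (cube_deriv 0 \<phi>))\<^sup>2"
begin

lemma stab_bound:
  assumes "\<phi> \<in> set_pmf p" "\<theta> \<in> {0..1}"
  shows "2 / (unorm (Suc n) \<phi>)\<^sup>2 * stab n (cube_deriv 0 \<phi>) (\<lambda>_. \<theta>\<^sup>2)
    \<le> exp (- C * real (Suc n) * (1 - \<theta>)) * pivotal (Suc n) \<phi>"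
proof -
  have "2 / (unorm (Suc n) \<phi>)\<^sup>2 * stab n (cube_deriv 0 \<phi>) (\<lambda>_. \<theta>\<^sup>2)
      \<le> 2 / (unorm (Suc n) \<phi>)\<^sup>2 * (exp (- C * real (Suc n) * (1 - \<theta>)) * influence (Suc n) 0 \<phi>)"
    using noise_bound[OF assms]
    by (intro mult_left_mono) (simp_all add: noise_op_norm influence_def)
  then show ?thesis by (simp add: pivotal_def mult_ac)
qed

lemma stab_mean_le:
  assumes "0 \<le> t" "t \<le> 1"
  shows "stab_mean t \<le> exp (- C * real (Suc n) * (1 - sqrt t)) * frequency"
proof -
  have "stab_mean t \<le> measure_pmf.expectation p
      (\<lambda>\<phi>. exp (- C * real (Suc n) * (1 - sqrt t)) * pivotal (Suc n) \<phi>)"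
    unfolding stab_mean_def
  proof (intro integral_mono_AE integrable_measure_pmf_finite finite_support)
    show "AE \<phi> in p. 2 / (unorm (Suc n) \<phi>)\<^sup>2 * stab n (cube_deriv 0 \<phi>) (\<lambda>_. t)
        \<le> exp (- C * real (Suc n) * (1 - sqrt t)) * pivotal (Suc n) \<phi>"
      using stab_bound[of _ "sqrt t"] assms by (simp add: AE_measure_pmf_iff)
  qed
  then show ?thesis by (simp add: frequency_def)
qed

lemma stab_mean_linear:
  assumes "0 \<le> t" "t \<le> 1 / 4"
  shows "stab_mean t \<le> 4 * t * exp (- C * real (Suc n) / 2) * frequency"
proof -
  have "stab_mean t \<le> measure_pmf.expectation p
      (\<lambda>\<phi>. 4 * t * exp (- C * real (Suc n) / 2) * pivotal (Suc n) \<phi>)"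
    unfolding stab_mean_def
  proof (intro integral_mono_AE integrable_measure_pmf_finite finite_support, unfold AE_measure_pmf_iff, rule ballI)
    fix \<phi> assume \<phi>: "\<phi> \<in> set_pmf p"
    interpret valid_clause n \<phi> by (rule valid[OF \<phi>])
    have "2 / (unorm (Suc n) \<phi>)\<^sup>2 * stab n f (\<lambda>_. t)
        \<le> 2 / (unorm (Suc n) \<phi>)\<^sup>2 * (4 * t * stab n f (\<lambda>_. 1 / 4))"
      using assms by (intro mult_left_mono stab_linear_bound mean_f) auto
    also have "\<dots> = 4 * t * (2 / (unorm (Suc n) \<phi>)\<^sup>2 * stab n f (\<lambda>_. (1 / 2)\<^sup>2))"
      by (simp add: power2_eq_square)
    also have "\<dots> \<le> 4 * t * (exp (- C * real (Suc n) * (1 - 1 / 2)) * pivotal (Suc n) \<phi>)"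
      using assms by (intro mult_left_mono stab_bound \<phi>) auto
    finally show "2 / (unorm (Suc n) \<phi>)\<^sup>2 * stab n f (\<lambda>_. t)
        \<le> 4 * t * exp (- C * real (Suc n) / 2) * pivotal (Suc n) \<phi>"
      by (simp add: field_simps)
  qed
  then show ?thesis by (simp add: frequency_def)
qed

lemma frequency_nonneg: "0 \<le> frequency"
  unfolding frequency_def pivotal_def influence_def
  by (intro Bochner_Integration.integral_nonneg) auto

definition rate :: real where
  "rate = real (Suc n) * \<alpha> * frequency"

lemma rate_nonneg: "0 \<le> rate"
  using \<alpha>_pos frequency_nonneg by (simp add: rate_def)

lemma mean_info_Suc_le: "mean_info (Suc l) \<le> real (Suc n) * \<alpha> * stab_mean (mean_info l)"
  using mean_info_Suc[of l] exp_ge_add_one_self[of "- (real (Suc n) * \<alpha> * stab_mean (mean_info l))"]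
  by linarith

text \<open>One generation suffices to lose information of order \<open>exp (- rate)\<close>; noise sensitivity of the
  clauses amplifies this loss in the second generation, and from then on the recursion contracts.\<close>

lemma not_tree_solvable_below:
  assumes small: "rate * exp (- C * real (Suc n) * exp (- rate) / 2) \<le> 1 / 8"
  shows "\<not> tree_solvable (Suc n) \<alpha> p"
proof (rule not_tree_solvable_of_vanishing)
  have pos: "0 \<le> real (Suc n) * \<alpha>" using \<alpha>_pos by simp
  have le: "mean_info (Suc l) \<le> exp (- C * real (Suc n) * (1 - sqrt (mean_info l))) * rate" for l
  proof -
    have "mean_info (Suc l) \<le> real (Suc n) * \<alpha> * stab_mean (mean_info l)" by (rule mean_info_Suc_le)
    also have "\<dots> \<le> real (Suc n) * \<alpha> * (exp (- C * real (Suc n) * (1 - sqrt (mean_info l))) * frequency)"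
      using pos by (intro mult_left_mono stab_mean_le mean_info_nonneg mean_info_le_1)
    finally show ?thesis by (simp add: rate_def mult_ac)
  qed
  \<comment> \<open>Generation 0 reveals the root, so the noise factor gives nothing better than 1
    here.\<close>
  have m1: "mean_info 1 \<le> 1 - exp (- rate)"
  proof -
    have "stab_mean (mean_info 0) \<le> exp (- C * real (Suc n) * (1 - sqrt (mean_info 0))) * frequency"
      by (intro stab_mean_le mean_info_nonneg mean_info_le_1)
    also have "\<dots> \<le> 1 * frequency"
      using C_pos mean_info_le_1[of 0] frequency_nonneg by (intro mult_right_mono) (auto simp: mult_nonneg_nonneg)
    finally have "real (Suc n) * \<alpha> * stab_mean (mean_info 0) \<le> rate"
      unfolding rate_def using pos by (intro mult_left_mono) auto
    then have "exp (- rate) \<le> exp (- (real (Suc n) * \<alpha> * stab_mean (mean_info 0)))" by simp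
    then show ?thesis using mean_info_Suc[of 0] unfolding One_nat_def by linarith
  qed
  \<comment> \<open>The noise parameter is the square root of the information, and
    \<open>sqrt (1 - x) \<le> 1 - x / 2\<close>.\<close>
  have sqrt1: "exp (- rate) / 2 \<le> 1 - sqrt (mean_info 1)"
  proof -
    have "exp (- rate) \<le> 1" using rate_nonneg by simp
    then have "0 \<le> 1 - exp (- rate) / 2" by linarith
    moreover have "1 - exp (- rate) \<le> (1 - exp (- rate) / 2)\<^sup>2"
      by (simp add: power2_eq_square algebra_simps)
    ultimately have "sqrt (mean_info 1) \<le> 1 - exp (- rate) / 2"
      using m1 by (intro real_le_lsqrt) auto
    then show ?thesis by simp
  qed
  have m2: "mean_info 2 \<le> 1 / 8"
  proof -
    have "C * real (Suc n) * (exp (- rate) / 2) \<le> C * real (Suc n) * (1 - sqrt (mean_info 1))"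
      using C_pos sqrt1 by (intro mult_left_mono) auto
    then have "exp (- C * real (Suc n) * (1 - sqrt (mean_info 1))) * rate
        \<le> exp (- C * real (Suc n) * exp (- rate) / 2) * rate"
      using rate_nonneg by (intro mult_right_mono) auto
    then show ?thesis using le[of 1] small by (simp add: numeral_2_eq_2 mult.commute)
  qed
  have contract: "mean_info (Suc l) \<le> mean_info l / 2" if "mean_info l \<le> 1 / 4" for l
  proof -
    have "mean_info (Suc l) \<le> real (Suc n) * \<alpha> * stab_mean (mean_info l)" by (rule mean_info_Suc_le)
    also have "\<dots> \<le> real (Suc n) * \<alpha> * (4 * mean_info l * exp (- C * real (Suc n) / 2) * frequency)"
      using pos that by (intro mult_left_mono stab_mean_linear mean_info_nonneg)
    also have "\<dots> = 4 * mean_info l * (rate * exp (- C * real (Suc n) / 2))"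
      by (simp add: rate_def)
    \<comment> \<open>The constant \<open>1 / 8\<close> in \<open>small\<close> offsets the factor 4
      of \<open>stab_mean_linear\<close> and leaves a contraction by \<open>1 / 2\<close>.\<close>
    also have "\<dots> \<le> 4 * mean_info l * (1 / 8)"
    proof (intro mult_left_mono)
      have "C * real (Suc n) * exp (- rate) \<le> C * real (Suc n) * 1"
        using C_pos rate_nonneg by (intro mult_left_mono) auto
      then have "rate * exp (- C * real (Suc n) / 2) \<le> rate * exp (- C * real (Suc n) * exp (- rate) / 2)"
        using rate_nonneg by (intro mult_left_mono) auto
      then show "rate * exp (- C * real (Suc n) / 2) \<le> 1 / 8" using small by linarith
    qed (use mean_info_nonneg in auto)
    finally show ?thesis by simp
  qed
  have geo: "mean_info (l + 2) \<le> 1 / 8 * (1 / 2) ^ l" for l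
  proof (induction l)
    case 0
    then show ?case using m2 by (simp add: numeral_2_eq_2)
  next
    case (Suc l)
    have "(1 / 2 :: real) ^ l \<le> 1" by (intro power_le_one) auto
    then have "mean_info (l + 2) \<le> 1 / 4" using Suc by simp
    from contract[OF this] Suc show ?case by simp
  qed
  have "(\<lambda>l. mean_info (l + 2)) \<longlonglongrightarrow> 0"
  proof (rule tendsto_sandwich[of "\<lambda>_. 0" _ _ "\<lambda>l. 1 / 8 * (1 / 2) ^ l"])
    show "(\<lambda>l. 1 / 8 * (1 / 2 :: real) ^ l) \<longlonglongrightarrow> 0"
      by (intro tendsto_mult_right_zero LIMSEQ_power_zero) simp
  qed (use mean_info_nonneg geo in auto)
  then show "mean_info \<longlonglongrightarrow> 0" by (rule LIMSEQ_offset)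
qed

end

text \<open>For \<open>r\<close> in this range \<open>k * exp (- r)\<close> is at least
  \<open>k powr \<delta>\<close>, and an exponential in a power of \<open>k\<close> beats the
  logarithm.\<close>

lemma eventually_below:
  assumes "0 < \<delta>" "\<delta> < 1" "0 < C"
  shows "\<forall>\<^sub>F k in sequentially. \<forall>r\<ge>0. r \<le> (1 - \<delta>) * ln (real k) \<longrightarrow>
    r * exp (- C * real k * exp (- r) / 2) \<le> 1 / 8"
proof -
  have "((\<lambda>k. ln (real k) * exp (- C / 2 * real k powr \<delta>)) \<longlongrightarrow> 0) sequentially"
    using assms by real_asymp
  then have "\<forall>\<^sub>F k in sequentially. ln (real k) * exp (- C / 2 * real k powr \<delta>) < 1 / 8"
    by (rule order_tendstoD) simp
  then show ?thesis
    using eventually_ge_at_top[of 1]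
  proof eventually_elim
    case (elim k)
    show ?case
    proof (intro allI impI)
      fix r :: real assume r: "0 \<le> r" "r \<le> (1 - \<delta>) * ln (real k)"
      have ln: "0 \<le> ln (real k)" using elim by simp
      have "(1 - \<delta>) * ln (real k) \<le> 1 * ln (real k)" using ln assms by (intro mult_right_mono) auto
      then have r2: "r \<le> ln (real k)" using r by simp
      have "real k powr \<delta> = real k * exp (- ((1 - \<delta>) * ln (real k)))"
        using elim by (simp add: powr_def exp_add[symmetric] algebra_simps exp_diff)
      also have "\<dots> \<le> real k * exp (- r)" using r by (intro mult_left_mono) auto
      finally have "C / 2 * real k powr \<delta> \<le> C / 2 * (real k * exp (- r))"
        using assms by (intro mult_left_mono) auto
      then have "exp (- C * real k * exp (- r) / 2) \<le> exp (- C / 2 * real k powr \<delta>)"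
        by simp
      then have "r * exp (- C * real k * exp (- r) / 2) \<le> ln (real k) * exp (- C / 2 * real k powr \<delta>)"
        using r r2 by (intro mult_mono) auto
      then show "r * exp (- C * real k * exp (- r) / 2) \<le> 1 / 8" using elim by linarith
    qed
  qed
qed

lemma eventually_above:
  assumes "0 < \<delta>"
  shows "\<forall>\<^sub>F k in sequentially. \<exists>z. 0 < z \<and> z \<le> 1 \<and>
    exp (- ((1 + \<delta>) * ln (real k) * z ^ (k - 1))) \<le> 1 - z"
proof -
  have "((\<lambda>k. (1 + \<delta>) * (1 - real k powr (- \<delta> / 2))) \<longlongrightarrow> 1 + \<delta>) sequentially"
    using assms by real_asymp
  then have "\<forall>\<^sub>F k in sequentially. 1 + \<delta> / 2 < (1 + \<delta>) * (1 - real k powr (- \<delta> / 2))"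
    using assms by (intro order_tendstoD) auto
  then show ?thesis
    using eventually_ge_at_top[of 2]
  proof eventually_elim
    case (elim k)
    \<comment> \<open>With \<open>z = 1 - w\<close>, Bernoulli's inequality keeps
      \<open>z ^ (k - 1)\<close> above \<open>1 - k powr (- \<delta> / 2)\<close>, so the exponent
      exceeds \<open>(1 + \<delta> / 2) * ln k\<close>. The exponential is then at most
      \<open>w\<close> itself, which is exactly \<open>1 - z\<close>.\<close>
    define w where "w = real k powr (- 1 - \<delta> / 2)"
    have k: "1 < real k" using elim by simp
    have w: "0 < w" "w < 1"
      using k assms powr_less_mono[of "- 1 - \<delta> / 2" 0 "real k"] by (auto simp: w_def)
    have "real (k - 1) * w \<le> real k * w" using w elim by (intro mult_right_mono) auto
    also have "real k * w = real k powr (- \<delta> / 2)"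
      using k by (simp add: w_def powr_mult_base)
    finally have "1 - real k powr (- \<delta> / 2) \<le> 1 + real (k - 1) * (- w)" by simp
    also have "\<dots> \<le> (1 + (- w)) ^ (k - 1)"
      using w by (intro Bernoulli_inequality) simp
    finally have "1 - real k powr (- \<delta> / 2) \<le> (1 - w) ^ (k - 1)" by simp
    then have "(1 + \<delta>) * (1 - real k powr (- \<delta> / 2)) \<le> (1 + \<delta>) * (1 - w) ^ (k - 1)"
      using assms by (intro mult_left_mono) auto
    then have "1 + \<delta> / 2 \<le> (1 + \<delta>) * (1 - w) ^ (k - 1)" using elim by linarith
    then have "(1 + \<delta> / 2) * ln (real k) \<le> (1 + \<delta>) * (1 - w) ^ (k - 1) * ln (real k)"
      using k by (intro mult_right_mono) auto
    then have "exp (- ((1 + \<delta>) * ln (real k) * (1 - w) ^ (k - 1))) \<le> exp (- ((1 + \<delta> / 2) * ln (real k)))"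
      by (simp add: mult_ac)
    also have "\<dots> = 1 - (1 - w)" using k by (simp add: w_def powr_def algebra_simps)
    finally show ?case using w by (intro exI[of _ "1 - w"]) auto
  qed
qed

theorem theorem7:
  fixes p :: "nat \<Rightarrow> clause pmf" and a C :: real
  assumes support: "\<And>k. k \<ge> 1 \<Longrightarrow> set_pmf (p k) \<subseteq> clauses k"
    and permutation_invariant:
      "\<And>k \<pi> \<phi>. k \<ge> 1 \<Longrightarrow> \<pi> permutes {..<k} \<Longrightarrow> \<phi> \<in> clauses k \<Longrightarrow>
         pmf (p k) (permute_args k \<pi> \<phi>) = pmf (p k) \<phi>"
    and sign_symmetric:
      "\<And>k \<phi> x. k \<ge> 1 \<Longrightarrow> \<phi> \<in> set_pmf (p k) \<Longrightarrow> x \<in> cube k \<Longrightarrow> \<phi> (map uminus x) = \<phi> x"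
    and extendable:
      "\<And>k \<phi> y. k \<ge> 1 \<Longrightarrow> \<phi> \<in> set_pmf (p k) \<Longrightarrow> y \<in> cube (k - 1) \<Longrightarrow>
         \<exists>s\<in>{-1, 1}. \<phi> (s # y) = 1"
    and unbiased_dominates:
      "\<And>k \<theta>. k \<ge> 1 \<Longrightarrow> \<theta> \<in> {-1..1} \<Longrightarrow>
         fin_expectation (p k) (\<lambda>\<phi>. elog (bias_norm k \<theta> \<phi>))
           \<le> fin_expectation (p k) (\<lambda>\<phi>. elog (unorm k \<phi>))"
    and fourier_bound:
      "\<And>k \<phi> i. k \<ge> 1 \<Longrightarrow> \<phi> \<in> set_pmf (p k) \<Longrightarrow> i < k \<Longrightarrow>
         (\<Sum>Q\<in>Pow {..<k - 1}. \<bar>fourier_coeff (k - 1) (cube_deriv i \<phi>) Q\<bar>) \<le> real k powr a"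
    and C_pos: "C > 0"
    and noise_bound:
      "\<And>k \<phi> i \<theta>. k \<ge> 1 \<Longrightarrow> \<phi> \<in> set_pmf (p k) \<Longrightarrow> i < k \<Longrightarrow> \<theta> \<in> {0..1} \<Longrightarrow>
         (unorm (k - 1) (noise_op (k - 1) \<theta> (cube_deriv i \<phi>)))\<^sup>2
           \<le> exp (- C * real k * (1 - \<theta>)) * (unorm (k - 1) (cube_deriv i \<phi>))\<^sup>2"
  shows "\<exists>\<alpha>_tree :: nat \<Rightarrow> ereal.
     (\<exists>\<epsilon> :: nat \<Rightarrow> real. \<epsilon> \<in> o(\<lambda>k. ln (real k)) \<and>
        (\<forall>k\<ge>1. \<alpha>_tree k = Omega k (p k) / ereal (real k) * ereal (ln (real k) + \<epsilon> k))) \<and>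
     (\<forall>k\<ge>1. \<forall>\<alpha>>0. ereal \<alpha> \<noteq> \<alpha>_tree k \<longrightarrow>
        (tree_solvable k \<alpha> (p k) \<longleftrightarrow> ereal \<alpha> > \<alpha>_tree k))"
proof -
  define q where "q k = measure_pmf.expectation (p k) (pivotal k)" for k
  define S where "S k = {\<alpha>. 0 < \<alpha> \<and> tree_solvable k \<alpha> (p k)}" for k
  define r where "r k = Inf (S k)" for k
  \<comment> \<open>For \<open>q k \<noteq> 0\<close> the required formula is solved for
    \<open>\<epsilon> k\<close>. For \<open>q k = 0\<close> the value 1 keeps
    \<open>ln k + \<epsilon> k\<close> positive even at \<open>k = 1\<close>, so that the product
    with \<open>Omega = \<infinity>\<close> is infinite.\<close>
  define \<epsilon> where "\<epsilon> k = (if q k = 0 then 1 else real k * r k * q k - ln (real k))" for k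
  define \<alpha>_tree where "\<alpha>_tree k = (if q k = 0 then \<infinity> else ereal (r k))" for k
  have Omega: "Omega k (p k) = 1 / ereal (q k)" for k
    by (simp add: Omega_def q_def pivotal_def[abs_def])
  have ensemble: "noise_sensitive_ensemble n (p (Suc n)) \<alpha> C" if "0 < \<alpha>" for n \<alpha>
    by unfold_locales
      (use that C_pos support[of "Suc n"] sign_symmetric[of "Suc n"] extendable[of "Suc n"]
        noise_bound[of "Suc n" _ 0] in auto)
  have q_nonneg: "0 \<le> q k" if "1 \<le> k" for k
    unfolding q_def pivotal_def influence_def
    by (intro Bochner_Integration.integral_nonneg) auto
  have below: "\<not> tree_solvable k \<alpha> (p k)"
    if "1 \<le> k" "0 < \<alpha>" "real k * \<alpha> * q k * exp (- C * real k * exp (- (real k * \<alpha> * q k)) / 2) \<le> 1 / 8" for k \<alpha>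
  proof -
    from \<open>1 \<le> k\<close> obtain n where k: "k = Suc n" by (cases k) auto
    interpret noise_sensitive_ensemble n "p (Suc n)" \<alpha> C by (rule ensemble) fact
    show ?thesis
      using not_tree_solvable_below that(3) by (simp add: k rate_def frequency_def q_def)
  qed
  have above: "tree_solvable k \<alpha> (p k)"
    if "1 \<le> k" "0 < \<alpha>" "0 < z" "z \<le> 1" "exp (- (real k * \<alpha> * q k * z ^ (k - 1))) \<le> 1 - z" for k \<alpha> z
  proof -
    from \<open>1 \<le> k\<close> obtain n where k: "k = Suc n" by (cases k) auto
    interpret noise_sensitive_ensemble n "p (Suc n)" \<alpha> C by (rule ensemble) fact
    show ?thesis
      using tree_solvable_of_fixed_point[of z] frequency_nonneg that(3-5)
      by (simp add: k frequency_def q_def)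
  qed
  have S_bdd: "bdd_below (S k)" for k by (rule bdd_belowI[of _ 0]) (auto simp: S_def)
  have S_nonempty: "S k \<noteq> {}" if k: "1 \<le> k" and q: "q k \<noteq> 0" for k
  proof -
    have pos: "0 < real k * q k" using k q q_nonneg[OF k] by auto
    \<comment> \<open>Solved from \<open>above\<close> at \<open>z = 1 / 2\<close>, which works for
      every \<open>k\<close>; the infimum has to make sense also where the asymptotic bounds do not
      apply yet.\<close>
    define \<alpha> where "\<alpha> = ln 2 * 2 ^ (k - 1) / (real k * q k)"
    have \<alpha>: "0 < \<alpha>" using pos by (auto simp: \<alpha>_def intro!: divide_pos_pos)
    have "real k * \<alpha> * q k * (1 / 2) ^ (k - 1) = ln 2"
      using k q by (simp add: \<alpha>_def power_divide)
    then have "tree_solvable k \<alpha> (p k)"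
      by (intro above[OF k \<alpha>, of "1 / 2"]) (simp_all add: exp_minus)
    with \<alpha> show ?thesis by (auto simp: S_def)
  qed
  have formula: "\<alpha>_tree k = Omega k (p k) / ereal (real k) * ereal (ln (real k) + \<epsilon> k)" if k: "1 \<le> k" for k
  proof (cases "q k = 0")
    case True
    have "0 \<le> ln (real k)" using k by simp
    then have "0 < ln (real k) + 1" by linarith
    with True k show ?thesis by (simp add: Omega \<alpha>_tree_def \<epsilon>_def)
  next
    case False
    with k show ?thesis by (simp add: Omega \<alpha>_tree_def \<epsilon>_def one_ereal_def)
  qed
  have little_o: "\<epsilon> \<in> o(\<lambda>k. ln (real k))"
  proof (rule landau_o.smallI)
    fix c :: real assume c: "0 < c"
    \<comment> \<open>The cap keeps \<open>\<delta> < 1\<close>, as \<open>eventually_below\<close>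
      demands.\<close>
    define \<delta> where "\<delta> = min c (1 / 2)"
    have \<delta>: "0 < \<delta>" "\<delta> < 1" "\<delta> \<le> c" using c by (auto simp: \<delta>_def)
    \<comment> \<open>Needed for the indices with \<open>q k = 0\<close>, where
      \<open>\<epsilon> k = 1\<close>.\<close>
    have "filterlim (\<lambda>k. ln (real k)) at_top sequentially" by real_asymp
    then have "\<forall>\<^sub>F k in sequentially. 1 / c \<le> ln (real k)" by (simp add: filterlim_at_top)
    then show "\<forall>\<^sub>F k in sequentially. norm (\<epsilon> k) \<le> c * norm (ln (real k))"
      using eventually_below[OF \<delta>(1,2) C_pos] eventually_above[OF \<delta>(1)] eventually_ge_at_top[of 2]
    proof eventually_elim
      case (elim k)
      have k: "1 \<le> k" and ln: "0 < ln (real k)" using elim by auto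
      show ?case
      proof (cases "q k = 0")
        case True
        then show ?thesis using elim c ln by (simp add: \<epsilon>_def field_simps)
      next
        case False
        then have pos: "0 < real k * q k" using k q_nonneg[OF k] by auto
        have "(1 - \<delta>) * ln (real k) / (real k * q k) \<le> r k"
          unfolding r_def
        proof (rule cInf_greatest[OF S_nonempty[OF k False]])
          fix \<alpha> assume \<alpha>: "\<alpha> \<in> S k"
          then have "0 \<le> real k * \<alpha> * q k" using q_nonneg[OF k] by (simp add: S_def)
          with \<alpha> below[OF k] elim have "(1 - \<delta>) * ln (real k) < real k * \<alpha> * q k"
            by (force simp: S_def)
          then show "(1 - \<delta>) * ln (real k) / (real k * q k) \<le> \<alpha>"
            using pos by (simp add: divide_le_eq mult_ac)
        qed
        then have lower: "(1 - \<delta>) * ln (real k) \<le> real k * r k * q k"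
          using pos by (simp add: divide_le_eq mult_ac)
        define \<alpha> where "\<alpha> = (1 + \<delta>) * ln (real k) / (real k * q k)"
        have \<alpha>: "0 < \<alpha>" using pos ln \<delta> by (simp add: \<alpha>_def)
        have eq: "real k * \<alpha> * q k = (1 + \<delta>) * ln (real k)" using k False by (simp add: \<alpha>_def)
        obtain z where "0 < z" "z \<le> 1" "exp (- ((1 + \<delta>) * ln (real k) * z ^ (k - 1))) \<le> 1 - z"
          using elim by auto
        then have "tree_solvable k \<alpha> (p k)" by (intro above[OF k \<alpha>]) (simp_all add: eq)
        then have "r k \<le> \<alpha>" unfolding r_def using \<alpha> S_bdd by (intro cInf_lower) (auto simp: S_def)
        then have "real k * q k * r k \<le> real k * q k * \<alpha>" using pos by (intro mult_left_mono) auto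
        with eq have "real k * r k * q k \<le> (1 + \<delta>) * ln (real k)" by (simp add: mult_ac)
        with lower have "\<bar>\<epsilon> k\<bar> \<le> \<delta> * ln (real k)" using False by (simp add: \<epsilon>_def algebra_simps abs_le_iff)
        also have "\<dots> \<le> c * ln (real k)" using \<delta> ln by (intro mult_right_mono) auto
        finally show ?thesis using ln by simp
      qed
    qed
  qed
  have threshold: "tree_solvable k \<alpha> (p k) \<longleftrightarrow> \<alpha>_tree k < ereal \<alpha>"
    if k: "1 \<le> k" and \<alpha>: "0 < \<alpha>" and ne: "ereal \<alpha> \<noteq> \<alpha>_tree k" for k \<alpha>
  proof (cases "q k = 0")
    case True
    \<comment> \<open>Here the rate is 0, so the smallness condition of \<open>below\<close> holds
      for every \<open>\<alpha>\<close>.\<close>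
    then have "\<not> tree_solvable k \<alpha> (p k)" by (intro below[OF k \<alpha>]) simp
    with True show ?thesis by (simp add: \<alpha>_tree_def)
  next
    case False
    show ?thesis
    proof
      assume "tree_solvable k \<alpha> (p k)"
      then have "r k \<le> \<alpha>" unfolding r_def using \<alpha> S_bdd by (intro cInf_lower) (auto simp: S_def)
      \<comment> \<open>The infimum yields only a weak inequality; \<open>ne\<close> makes it
        strict.\<close>
      with ne False show "\<alpha>_tree k < ereal \<alpha>" by (auto simp: \<alpha>_tree_def)
    next
      assume "\<alpha>_tree k < ereal \<alpha>"
      then have "Inf (S k) < \<alpha>" using False by (simp add: \<alpha>_tree_def r_def)
      then obtain \<beta> where \<beta>: "\<beta> \<in> S k" "\<beta> < \<alpha>" using cInf_lessD[OF S_nonempty[OF k False]] by blast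
      from k obtain n where "k = Suc n" by (cases k) auto
      with \<beta> show "tree_solvable k \<alpha> (p k)" using tree_solvable_mono[of n \<beta> "p k" \<alpha>] by (auto simp: S_def)
    qed
  qed
  show ?thesis using little_o formula threshold by blast
qed

end
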